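(* If $k,m,n\in\mathbb{N}$, $k+m<n$, $1<r<\infty$, $v_{mr,n}(t)=t^{-\frac{mr}{n}}$, and $w\in B_r\cap B^*_{\frac{r(k+m-1)}{n}}$, then $$K(f,t^k;S_r(wv_{mr,n}),W^kS_r(wv_{mr,n}))\lesssim\left(\int_0^t\left(s^{-m}K(f,s^{k+m};\Lambda_r(w),W^{k+m}\Lambda_r(w))\right)^r\frac{ds}{s}\right)^{1/r}$$ for all $t>0$ and all $f\in\Lambda_r(w)$ for which the right-hand side is finite.
   Context: All function classes are over $(\mathbb{R}^n,\lambda_n)$, $\lambda_n$ Lebesgue measure. A weight is a non-negative measurable function on $(0,\infty)$. $f^*$ is the non-increasing rearrangement of $f$ and $f^{**}(t)=\frac1t\int_0^tf^*(s)\,ds$. For a weight $w$ and $1\le r<\infty$: $\Lambda_r(w)$ is the set of measurable $f$ with $\|f\|_{\Lambda_r(w)}:=(\int_0^\infty(f^*(s))^rw(s)\,ds)^{1/r}<\infty$; $S_r(w)$ is the set of measurable $f$ with $f^*(\infty)=0$ and $\|f\|_{S_r(w)}:=(\int_0^\infty(f^{**}(s)-f^*(s))^rw(s)\,ds)^{1/r}<\infty$ (it need not be linear). $w\in B_r$: there is $c>0$ with $t^r\int_t^\infty s^{-r}w(s)\,ds\le c\int_0^tw(s)\,ds$ for all $t>0$. $w\in B_q^*$: there is $c>0$ with $t^q\int_0^ts^{-q}w(s)\,ds\le c\int_0^tw(s)\,ds$ for all $t>0$. For such a class $X$ and $k\in\mathbb{N}$, $W^kX$ is the class of all functions $f$ on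 $\mathbb{R}^n$ whose distributional derivatives $D^\alpha f$, $|\alpha|\le k$, belong to $X$, with $\|f\|_{W^kX}:=\|f\|_X+\sum_{|\alpha|=k}\|D^\alpha f\|_X$. $K(f,t;X,Y):=\inf_{f=f_1+f_2}(\|f_1\|_X+t\|f_2\|_Y)$, with $f_1\in X$, $f_2\in Y$. $\mathcal A\lesssim\mathcal B$ means $\mathcal A\le c\,\mathcal B$ with $c>0$ independent of $f$ and $t$.
   Formalization: The weight w is additionally assumed not to vanish almost everywhere on (0,∞); for w = 0 and f = 1 the right-hand side is 0 while f has no decomposition in S_r + W^k S_r, so the left-hand side is undefined. *)

theory Defs
  imports "HOL-Analysis.Analysis"
begin

section \<open>Weights\<close>

definition weight :: "(real \<Rightarrow> real) \<Rightarrow> bool" where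
  "weight w \<longleftrightarrow> set_borel_measurable lebesgue {0<..} w \<and> (\<forall>s>0. 0 \<le> w s)"

(* Both sides are computed in [0,\<infinity>]; finiteness of the integrals is not presupposed. *)

definition B_class :: "real \<Rightarrow> (real \<Rightarrow> real) set" where
  "B_class r = {w. \<exists>c>0. \<forall>t>0.
     ennreal (t powr r) * (\<integral>\<^sup>+s\<in>{t<..}. ennreal (s powr (-r) * w s) \<partial>lebesgue)
       \<le> ennreal c * (\<integral>\<^sup>+s\<in>{0<..<t}. ennreal (w s) \<partial>lebesgue)}"

definition B_star_class :: "real \<Rightarrow> (real \<Rightarrow> real) set" where
  "B_star_class q = {w. \<exists>c>0. \<forall>t>0.
     ennreal (t powr q) * (\<integral>\<^sup>+s\<in>{0<..<t}. ennreal (s powr (-q) * w s) \<partial>lebesgue)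
       \<le> ennreal c * (\<integral>\<^sup>+s\<in>{0<..<t}. ennreal (w s) \<partial>lebesgue)}"

section \<open>Rearrangements and the classes \<open>\<Lambda>\<^sub>r(w)\<close>, \<open>S\<^sub>r(w)\<close>\<close>

(* Real powers on [0,\<infinity>], meant for exponents r > 0. *)
definition epowr :: "ennreal \<Rightarrow> real \<Rightarrow> ennreal" where
  "epowr x r = (if x = \<infinity> then \<infinity> else ennreal (enn2real x powr r))"

definition rearr :: "(real ^ 'n \<Rightarrow> real) \<Rightarrow> real \<Rightarrow> ennreal" where
  "rearr f t = Inf {y. emeasure lebesgue {x. ennreal \<bar>f x\<bar> > y} \<le> ennreal t}"

definition rearr_avg :: "(real ^ 'n \<Rightarrow> real) \<Rightarrow> real \<Rightarrow> ennreal" where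
  "rearr_avg f t = ennreal (1 / t) * (\<integral>\<^sup>+s\<in>{0<..<t}. rearr f s \<partial>lebesgue)"

(* A function class: its members together with the functional written as a norm
   (which need not be a norm, and whose class need not be linear). *)
type_synonym 'n fclass = "(real ^ 'n \<Rightarrow> real) set \<times> ((real ^ 'n \<Rightarrow> real) \<Rightarrow> ennreal)"

definition Lambda_norm :: "real \<Rightarrow> (real \<Rightarrow> real) \<Rightarrow> (real ^ 'n \<Rightarrow> real) \<Rightarrow> ennreal" where
  "Lambda_norm r w f =
     epowr (\<integral>\<^sup>+s\<in>{0<..}. epowr (rearr f s) r * ennreal (w s) \<partial>lebesgue) (1 / r)"

definition Lambda_class :: "real \<Rightarrow> (real \<Rightarrow> real) \<Rightarrow> 'n::finite fclass" where
  "Lambda_class r w =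
     ({f. f \<in> borel_measurable lebesgue \<and> Lambda_norm r w f < \<infinity>}, Lambda_norm r w)"

definition S_norm :: "real \<Rightarrow> (real \<Rightarrow> real) \<Rightarrow> (real ^ 'n \<Rightarrow> real) \<Rightarrow> ennreal" where
  "S_norm r w f =
     epowr (\<integral>\<^sup>+s\<in>{0<..}. epowr (rearr_avg f s - rearr f s) r * ennreal (w s) \<partial>lebesgue) (1 / r)"

definition S_class :: "real \<Rightarrow> (real \<Rightarrow> real) \<Rightarrow> 'n::finite fclass" where
  "S_class r w =
     ({f. f \<in> borel_measurable lebesgue \<and> (rearr f \<longlongrightarrow> 0) at_top \<and> S_norm r w f < \<infinity>}, S_norm r w)"

section \<open>Distributional derivatives\<close>

definition partial :: "'n::finite \<Rightarrow> (real ^ 'n \<Rightarrow> real) \<Rightarrow> real ^ 'n \<Rightarrow> real" where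
  "partial i \<phi> x = frechet_derivative \<phi> (at x) (axis i 1)"

(* Continuous differentiability of order k: all iterated partials up to order k
   exist and are continuous. *)
fun Ck :: "nat \<Rightarrow> (real ^ 'n::finite \<Rightarrow> real) \<Rightarrow> bool" where
  "Ck 0 \<phi> \<longleftrightarrow> continuous_on UNIV \<phi>"
| "Ck (Suc k) \<phi> \<longleftrightarrow> (\<forall>x. \<phi> differentiable (at x)) \<and> (\<forall>i. Ck k (partial i \<phi>))"

definition test_fun :: "(real ^ 'n::finite \<Rightarrow> real) \<Rightarrow> bool" where
  "test_fun \<phi> \<longleftrightarrow> (\<forall>k. Ck k \<phi>) \<and> compact (closure {x. \<phi> x \<noteq> 0})"

(* Multi-indices are functions on the coordinate index type. *)
definition mi_order :: "('n::finite \<Rightarrow> nat) \<Rightarrow> nat" where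
  "mi_order \<alpha> = (\<Sum>i\<in>UNIV. \<alpha> i)"

(* An arbitrary enumeration of the coordinates.  It only fixes the order in which
   partial derivatives of test functions are taken, which is immaterial. *)
definition coords :: "'n::finite list" where
  "coords = (SOME xs. distinct xs \<and> set xs = UNIV)"

definition mi_deriv :: "('n::finite \<Rightarrow> nat) \<Rightarrow> (real ^ 'n \<Rightarrow> real) \<Rightarrow> real ^ 'n \<Rightarrow> real" where
  "mi_deriv \<alpha> \<phi> = foldr (\<lambda>i. partial i ^^ \<alpha> i) coords \<phi>"

definition locally_integrable :: "(real ^ 'n::finite \<Rightarrow> real) \<Rightarrow> bool" where
  "locally_integrable f \<longleftrightarrow> (\<forall>C. compact C \<longrightarrow> set_integrable lebesgue C f)"

(* The distribution \<open>D\<^sup>\<alpha> f\<close> is regular and represented by g. *)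
definition weak_deriv ::
    "('n::finite \<Rightarrow> nat) \<Rightarrow> (real ^ 'n \<Rightarrow> real) \<Rightarrow> (real ^ 'n \<Rightarrow> real) \<Rightarrow> bool" where
  "weak_deriv \<alpha> f g \<longleftrightarrow> locally_integrable f \<and> locally_integrable g \<and>
     (\<forall>\<phi>. test_fun \<phi> \<longrightarrow>
        (LINT x|lebesgue. f x * mi_deriv \<alpha> \<phi> x)
          = (-1) ^ mi_order \<alpha> * (LINT x|lebesgue. g x * \<phi> x))"

(* A representative of \<open>D\<^sup>\<alpha> f\<close>; it is unique up to null sets, and the functionals above
   do not distinguish functions that agree almost everywhere. *)
definition wderiv :: "('n::finite \<Rightarrow> nat) \<Rightarrow> (real ^ 'n \<Rightarrow> real) \<Rightarrow> real ^ 'n \<Rightarrow> real" where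
  "wderiv \<alpha> f = (SOME g. weak_deriv \<alpha> f g)"

definition W_class :: "nat \<Rightarrow> 'n::finite fclass \<Rightarrow> 'n fclass" where
  "W_class k X =
     ({f. \<forall>\<alpha>. mi_order \<alpha> \<le> k \<longrightarrow> (\<exists>g. weak_deriv \<alpha> f g \<and> g \<in> fst X)},
      \<lambda>f. snd X f + (\<Sum>\<alpha> | mi_order \<alpha> = k. snd X (wderiv \<alpha> f)))"

section \<open>The K-functional\<close>

(* Inf {} = \<infinity>, so K is infinite when f has no admissible decomposition. *)
definition K_fun :: "(real ^ 'n::finite \<Rightarrow> real) \<Rightarrow> real \<Rightarrow> 'n fclass \<Rightarrow> 'n fclass \<Rightarrow> ennreal" where
  "K_fun f t X Y = Inf {snd X f1 + ennreal t * snd Y f2 | f1 f2.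
     f1 \<in> fst X \<and> f2 \<in> fst Y \<and> f = (\<lambda>x. f1 x + f2 x)}"

end

theory Submission
  imports Defs
begin

text \<open>
  The estimate is an interpolation argument of Holmstedt type, run on rearrangements. Write
  \<open>n\<close> for the dimension, \<open>f\<^sup>*\<close> for the rearrangement and \<open>f\<^sup>*\<^sup>*\<close> for its average, and let
  \<open>f = g\<^sub>j + h\<^sub>j\<close> be nearly optimal for the K-functional on the right at the dyadic scale
  \<open>s\<^sub>j = s\<^sub>0 2\<^sup>-\<^sup>j\<close>, where \<open>s\<^sub>0 = t/2\<close>. The decomposition \<open>f = g\<^sub>0 + h\<^sub>0\<close> is the one used on the left.

  The smooth part \<open>h\<^sub>0\<close> costs only a Sobolev inequality: \<open>m\<close> derivatives in
  \<open>\<Lambda>\<^sub>r(w)\<close> buy the weight \<open>t powr (-mr/n)\<close> in the oscillation class. For the rough part, only the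
  oscillation \<open>g\<^sub>0\<^sup>*\<^sup>* - g\<^sub>0\<^sup>*\<close> at heights \<open>\<tau>\<close> near \<open>s\<^sub>j\<^sup>n\<close> matters on the \<open>j\<close>-th dyadic piece. There one
  rewrites \<open>g\<^sub>0 = g\<^sub>j + (h\<^sub>j - h\<^sub>0)\<close>. The oscillation of a sum is bounded by the oscillation of one summand
  (at doubled argument) plus the average of the other (oscillation_add_le); the average of \<open>g\<^sub>j\<close> is
  controlled by the K-functional, and the oscillation of \<open>h\<^sub>j - h\<^sub>0\<close> by its derivatives of order \<open>k + m\<close>,
  with the gain \<open>s\<^sub>j\<^sup>k\<close> that makes the contribution of \<open>h\<^sub>0\<close> a geometric series. Summing the pieces
  yields the dyadic form of the integral on the right (osc_energy_le_dyadic_sum, K_fun_bound).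

  The Sobolev inequality rests on the first-order estimate
  \<open>h\<^sup>*\<^sup>*(\<tau>) - h\<^sup>*(\<tau>) \<le> C \<tau> powr (1/n) \<Sum>\<^sub>i (\<partial>\<^sub>i h)\<^sup>*\<^sup>*(\<tau>)\<close> (oscillation_le_gradient). Its proof is elementary: translating \<open>h\<close> by a vector
  of length \<open>\<epsilon>\<close> changes it on a set of measure \<open>\<tau>\<close>, in the norm of \<open>L\<^sup>1\<close>, by at most \<open>\<epsilon> \<tau> \<Sum>\<^sub>i (\<partial>\<^sub>i h)\<^sup>*\<^sup>*(\<tau>)\<close>, and a cube of measure \<open>2\<tau>\<close>
  must contain a portion of measure \<open>\<tau>\<close> on which \<open>|h| \<le> h\<^sup>*(\<tau>)\<close>. The translation bound is proved
  against test functions, which are dense enough by test_fun_bound_imp_set_bound.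
  Higher orders follow by iteration: \<open>u\<^sup>*\<^sup>*\<close> is recovered from the oscillation of \<open>u\<close> by integrating
  outwards, so each further derivative costs one application of a Hardy inequality for decreasing
  functions (hardy_tail). Going from order \<open>1\<close> to order \<open>k + m\<close> uses up exactly the exponent
  \<open>r(k+m-1)/n\<close> of the condition \<open>B\<^sup>*\<close>. The last step replaces \<open>f\<^sup>*\<^sup>*\<close> by \<open>f\<^sup>*\<close> and is the Hardy inequality of
  Arino and Muckenhoupt (hardy_average), for which \<open>B\<^sub>r\<close> is assumed. Both Hardy inequalities come from the
  fact that \<open>B\<^sub>r\<close> and \<open>B\<^sup>*\<close> improve themselves by a small power, followed by Jensen's inequality for a
  power density.
\<close>

section \<open>Real powers on the extended half-line\<close>

lemma epowr_ennreal [simp]: "0 \<le> x \<Longrightarrow> epowr (ennreal x) r = ennreal (x powr r)"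
  by (simp add: epowr_def)

lemma epowr_top [simp]: "epowr top r = top"
  by (simp_all add: epowr_def)

lemma epowr_0 [simp]: "epowr 0 r = 0"
  by (simp add: epowr_def)

lemma epowr_one [simp]: "epowr x 1 = x"
  by (cases x) (auto simp: epowr_def)

lemma epowr_mono: "x \<le> y \<Longrightarrow> 0 \<le> r \<Longrightarrow> epowr x r \<le> epowr y r"
  by (cases x; cases y) (auto simp: epowr_def top_unique intro!: powr_mono2 ennreal_leI)

lemma epowr_mult:
  assumes "0 < r" shows "epowr (x * y) r = epowr x r * epowr y r"
proof -
  have *: "epowr (top * y) r = top * epowr y r" for y
    using assms by (cases y; cases "y = 0") (auto simp: epowr_def ennreal_top_mult)
  show ?thesis
  proof (cases x)
    case (real a)
    note x = this
    show ?thesis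
    proof (cases y)
      case (real b) then show ?thesis using x
        by (simp add: ennreal_mult[symmetric] powr_mult)
    next
      case top then show ?thesis using *[of x] by (simp add: mult.commute)
    qed
  next
    case top then show ?thesis using * by simp
  qed
qed

lemma epowr_epowr: "epowr (epowr x a) b = epowr x (a * b)"
  by (cases x) (auto simp: epowr_def powr_powr)

lemma epowr_eq_top_iff [simp]: "epowr x r = top \<longleftrightarrow> x = top"
  by (auto simp: epowr_def)

lemma epowr_less_top_iff [simp]: "epowr x r < top \<longleftrightarrow> x < top"
  using epowr_eq_top_iff[of x r] by (metis less_top)

lemma epowr_le_iff: "0 < r \<Longrightarrow> epowr x r \<le> epowr y r \<longleftrightarrow> x \<le> y"
proof
  assume r: "0 < r" and le: "epowr x r \<le> epowr y r"
  have "epowr (epowr x r) (1/r) \<le> epowr (epowr y r) (1/r)"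
    using le r by (simp add: epowr_mono)
  then show "x \<le> y" using r by (simp add: epowr_epowr)
qed (auto intro: epowr_mono)

lemma epowr_inverse_le_iff: "0 < r \<Longrightarrow> epowr x (1 / r) \<le> y \<longleftrightarrow> x \<le> epowr y r"
  using epowr_le_iff[of r "epowr x (1/r)" y] by (simp add: epowr_epowr)

lemma measurable_epowr [measurable]:
  assumes [measurable]: "f \<in> borel_measurable M"
  shows "(\<lambda>x. epowr (f x) r) \<in> borel_measurable M"
  unfolding epowr_def by measurable

text \<open>The sum is at most its number of terms times its largest term.\<close>

lemma epowr_sum_le:
  assumes I: "finite I" and r: "0 < r"
  shows "epowr (\<Sum>i\<in>I. x i) r \<le> ennreal (real (card I) powr r) * (\<Sum>i\<in>I. epowr (x i) r)"
proof (cases "I = {}")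
  case False
  have "Max (x ` I) \<in> x ` I" using False I by (intro Max_in) auto
  then obtain j where j: "j \<in> I" "x j = Max (x ` I)" by auto
  have "\<And>i. i \<in> I \<Longrightarrow> x i \<le> x j" using I j by simp
  have "(\<Sum>i\<in>I. x i) \<le> of_nat (card I) * x j"
    by (rule sum_bounded_above) fact
  then have "epowr (\<Sum>i\<in>I. x i) r \<le> epowr (ennreal (real (card I)) * x j) r"
    using r by (intro epowr_mono) (auto simp: ennreal_of_nat_eq_real_of_nat)
  also have "\<dots> = ennreal (real (card I) powr r) * epowr (x j) r"
    using r by (simp add: epowr_mult)
  also have "epowr (x j) r \<le> (\<Sum>i\<in>I. epowr (x i) r)"
    using j(1) I by (intro member_le_sum) auto
  finally show ?thesis by (simp add: mult_left_mono)
qed simp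

lemma epowr_add_le:
  assumes r: "0 < r"
  shows "epowr (x + y) r \<le> ennreal (2 powr r) * (epowr x r + epowr y r)"
  using epowr_sum_le[of "UNIV :: bool set" r "\<lambda>b. if b then x else y"] r
  by (simp add: UNIV_bool add.commute)

lemma ennreal_powr_mult:
  assumes "0 \<le> c"
  shows "ennreal (t powr x) * (ennreal (c * t powr y) * Z) = ennreal (c * t powr (x + y)) * Z"
proof -
  have "t powr x * (c * t powr y) = c * t powr (x + y)" by (simp add: powr_add)
  then have "ennreal (t powr x) * ennreal (c * t powr y) = ennreal (c * t powr (x + y))"
    using assms by (simp only: ennreal_mult[symmetric] powr_ge_zero mult_nonneg_nonneg)
  then show ?thesis by (simp only: mult.assoc[symmetric])
qed

lemma ennreal_powr_mult2:
  assumes "0 \<le> c" "0 \<le> d"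
  shows "ennreal (d * t powr x) * (ennreal (c * t powr y) * Z) = ennreal (d * c) * (ennreal (t powr (x + y)) * Z)"
proof -
  have "(d * t powr x) * (c * t powr y) = (d * c) * t powr (x + y)" by (simp add: powr_add)
  then have "ennreal (d * t powr x) * ennreal (c * t powr y) = ennreal (d * c) * ennreal (t powr (x + y))"
    using assms by (simp only: ennreal_mult[symmetric] powr_ge_zero mult_nonneg_nonneg)
  then show ?thesis by (simp only: mult.assoc[symmetric])
qed

text \<open>
  The graph of the convex function \<open>x \<mapsto> x powr r\<close> lies above its tangent at \<open>c\<close>; this is Young's
  inequality for the product of \<open>x\<close> and \<open>c powr (r - 1)\<close>.
\<close>

lemma epowr_tangent:
  assumes r: "1 < r" and c: "0 \<le> c"
  shows "ennreal (r * c powr (r - 1)) * x \<le> epowr x r + ennreal ((r - 1) * c powr r)"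
proof (cases x)
  case (real a)
  define p where "p = r / (r - 1)"
  have p: "p > 1" "1 / r + 1 / p = 1" using r by (auto simp: p_def field_simps)
  have "a * c powr (r - 1) \<le> a powr r / r + (c powr (r - 1)) powr p / p"
    using r p real by (intro Youngs_inequality) auto
  also have "(c powr (r - 1)) powr p = c powr r" using r by (simp add: powr_powr p_def)
  finally have "r * (a * c powr (r - 1)) \<le> r * (a powr r / r + c powr r / p)"
    using r by (intro mult_left_mono) auto
  also have "\<dots> = a powr r + (r - 1) * c powr r" using r by (simp add: p_def field_simps)
  finally show ?thesis using real r c
    by (simp add: ennreal_mult[symmetric] ennreal_plus[symmetric] mult_ac del: ennreal_plus)
qed simp

text \<open>
  Jensen's inequality: integrate the tangent inequality at \<open>c\<close> against the probability density
  \<open>\<kappa>\<close>, and choose \<open>c\<close> to be the mean. If the mean is infinite, the tangent at \<open>1\<close> already forces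
  the right-hand side to be infinite.
\<close>

lemma epowr_nn_integral_le:
  assumes [measurable]: "F \<in> borel_measurable M" "\<kappa> \<in> borel_measurable M"
    and \<kappa>: "(\<integral>\<^sup>+x. \<kappa> x \<partial>M) = 1" and r: "1 < r"
  shows "epowr (\<integral>\<^sup>+x. F x * \<kappa> x \<partial>M) r \<le> (\<integral>\<^sup>+x. epowr (F x) r * \<kappa> x \<partial>M)"
proof -
  have tan: "ennreal (r * c powr (r - 1)) * (\<integral>\<^sup>+x. F x * \<kappa> x \<partial>M)
      \<le> (\<integral>\<^sup>+x. epowr (F x) r * \<kappa> x \<partial>M) + ennreal ((r - 1) * c powr r)" if "0 \<le> c" for c
  proof -
    have "ennreal (r * c powr (r - 1)) * (\<integral>\<^sup>+x. F x * \<kappa> x \<partial>M)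
        = (\<integral>\<^sup>+x. (ennreal (r * c powr (r - 1)) * F x) * \<kappa> x \<partial>M)"
      by (simp add: nn_integral_cmult[symmetric] mult.assoc)
    also have "\<dots> \<le> (\<integral>\<^sup>+x. (epowr (F x) r + ennreal ((r - 1) * c powr r)) * \<kappa> x \<partial>M)"
      by (intro nn_integral_mono mult_right_mono epowr_tangent r that) auto
    also have "\<dots> = (\<integral>\<^sup>+x. epowr (F x) r * \<kappa> x \<partial>M) + ennreal ((r - 1) * c powr r)"
      by (simp add: distrib_right nn_integral_add nn_integral_cmult \<kappa>)
    finally show ?thesis .
  qed
  show ?thesis
  proof (cases "\<integral>\<^sup>+x. F x * \<kappa> x \<partial>M")
    case (real c)
    show ?thesis
    proof (cases "\<integral>\<^sup>+x. epowr (F x) r * \<kappa> x \<partial>M")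
      case (real d)
      have "ennreal (r * c powr (r - 1)) * ennreal c \<le> ennreal d + ennreal ((r - 1) * c powr r)"
        using tan[of c] real \<open>0 \<le> c\<close> \<open>(\<integral>\<^sup>+x. F x * \<kappa> x \<partial>M) = ennreal c\<close> by simp
      then have "r * c powr (r - 1) * c \<le> d + (r - 1) * c powr r"
        using r \<open>0 \<le> c\<close> real by (simp add: ennreal_mult[symmetric] ennreal_plus[symmetric] del: ennreal_plus)
      moreover have "c powr (r - 1) * c = c powr r"
        using \<open>0 \<le> c\<close> r by (cases "c = 0") (auto simp: powr_mult_base mult.commute)
      ultimately have "r * c powr r \<le> d + (r - 1) * c powr r" by (simp add: mult.assoc)
      then have "c powr r \<le> d" by (simp add: algebra_simps)
      then show ?thesis using real \<open>(\<integral>\<^sup>+x. F x * \<kappa> x \<partial>M) = ennreal c\<close> \<open>0 \<le> c\<close> by simp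
    qed simp
  next
    case top
    then show ?thesis using tan[of 1] r by (simp add: ennreal_mult_top top_unique)
  qed
qed

section \<open>Integrals on the half-line\<close>

lemma nn_integral_le_exhaustion:
  assumes [measurable]: "f \<in> borel_measurable M" "\<And>n. A n \<in> sets M" and "incseq A"
    and le: "\<And>n. (\<integral>\<^sup>+x\<in>A n. f x \<partial>M) \<le> C"
  shows "(\<integral>\<^sup>+x\<in>(\<Union>n. A n). f x \<partial>M) \<le> (C :: ennreal)"
proof -
  have "f x * indicator (\<Union>n. A n) x = (SUP n. f x * indicator (A n) x)" for x
  proof (rule antisym)
    show "f x * indicator (\<Union>n. A n) x \<le> (SUP n. f x * indicator (A n) x)"
    proof (cases "x \<in> (\<Union>n. A n)")
      case True
      then obtain n where "x \<in> A n" by auto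
      then show ?thesis using True by (intro SUP_upper2[of n]) auto
    qed simp
  qed (auto intro!: SUP_least mult_left_mono simp: indicator_def)
  then have "(\<integral>\<^sup>+x\<in>(\<Union>n. A n). f x \<partial>M) = (\<integral>\<^sup>+x. (SUP n. f x * indicator (A n) x) \<partial>M)" by simp
  also have "\<dots> = (SUP n. \<integral>\<^sup>+x\<in>A n. f x \<partial>M)"
    using \<open>incseq A\<close> by (intro nn_integral_monotone_convergence_SUP)
      (auto simp: incseq_def le_fun_def subset_eq indicator_def intro!: mult_left_mono)
  finally have "(\<integral>\<^sup>+x\<in>(\<Union>n. A n). f x \<partial>M) = (SUP n. \<integral>\<^sup>+x\<in>A n. f x \<partial>M)" .
  then show ?thesis using le by (simp add: SUP_le_iff)
qed

text \<open>
  Absorption needs \<open>X\<close> to be finite; this is why the self-improvement arguments below work with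
  truncated integrals.
\<close>

lemma ennreal_absorb:
  assumes "X < top" "X \<le> A + ennreal \<theta> * X" "\<theta> \<le> 1 / 2"
  shows "X \<le> 2 * (A :: ennreal)"
proof (cases "A = top")
  case False
  obtain x where x: "X = ennreal x" "0 \<le> x" using assms(1) by (cases X) auto
  obtain a where a: "A = ennreal a" "0 \<le> a" using False by (cases A) auto
  have "ennreal \<theta> * X \<le> ennreal (1/2) * X" using assms(3) by (intro mult_right_mono ennreal_leI) auto
  with assms(2) have "ennreal x \<le> A + ennreal (1/2) * X" unfolding x(1)[symmetric] by (meson add_left_mono order_trans)
  also have "\<dots> = ennreal (a + 1 / 2 * x)"
    using x a ennreal_mult[of "1/2" x] by (simp add: ennreal_plus)
  finally have "x \<le> a + 1 / 2 * x" using x a by (subst (asm) ennreal_le_iff) auto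
  then have "x \<le> 2 * a" by simp
  then have "ennreal x \<le> ennreal (2 * a)" by (rule ennreal_leI)
  then show ?thesis using x a by (simp add: ennreal_mult)
qed simp

lemma emeasure_lborel_greaterThan: "emeasure lborel {a::real<..} = top"
proof -
  have "of_nat n \<le> emeasure lborel {a<..}" for n :: nat
  proof -
    have "of_nat n = emeasure lborel {a<..<a + real n}"
      by (simp add: ennreal_of_nat_eq_real_of_nat)
    also have "\<dots> \<le> emeasure lborel {a<..}" by (intro emeasure_mono) auto
    finally show ?thesis .
  qed
  then have "(SUP n::nat. of_nat n) \<le> emeasure lborel {a<..}" by (intro SUP_least)
  then show ?thesis by (simp add: ennreal_SUP_of_nat_eq_top top_unique)
qed

lemma nn_integral_powr_above:
  assumes "0 < t" "0 < p"
  shows "(\<integral>\<^sup>+s\<in>{t<..}. ennreal (s powr (- p - 1)) \<partial>lborel) = ennreal (t powr (- p) / p)"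
proof -
  have I: "((\<lambda>x. x powr (- p - 1)) has_integral -(t powr (- p - 1 + 1)) / (- p - 1 + 1)) {t..}"
    using assms by (intro has_integral_powr_to_inf) auto
  then have "(\<integral>\<^sup>+x. ennreal (x powr (- p - 1)) * indicator {t..} x \<partial>lborel) = ennreal (t powr (- p) / p)"
    using nn_integral_has_integral_lebesgue'[OF _ I] by simp
  also have "(\<integral>\<^sup>+x. ennreal (x powr (- p - 1)) * indicator {t..} x \<partial>lborel)
      = (\<integral>\<^sup>+s\<in>{t<..}. ennreal (s powr (- p - 1)) \<partial>lborel)"
    by (intro nn_integral_cong_AE, use AE_lborel_singleton[of t] in eventually_elim)
       (auto simp: indicator_def)
  finally show ?thesis .
qed

lemma nn_integral_powr_below:
  assumes "0 < t" "0 < p"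
  shows "(\<integral>\<^sup>+s\<in>{0<..<t}. ennreal (s powr (p - 1)) \<partial>lborel) = ennreal (t powr p / p)"
proof -
  have I: "((\<lambda>x. x powr (p - 1)) has_integral (t powr (p - 1 + 1)) / (p - 1 + 1)) {0..t}"
    using assms by (intro has_integral_powr_from_0) auto
  then have "(\<integral>\<^sup>+x. ennreal (x powr (p - 1)) * indicator {0..t} x \<partial>lborel) = ennreal (t powr p / p)"
    using nn_integral_has_integral_lebesgue'[OF _ I] by simp
  also have "(\<integral>\<^sup>+x. ennreal (x powr (p - 1)) * indicator {0..t} x \<partial>lborel)
      = (\<integral>\<^sup>+s\<in>{0<..<t}. ennreal (s powr (p - 1)) \<partial>lborel)"
    by (intro nn_integral_cong_AE, use AE_lborel_singleton[of t] AE_lborel_singleton[of 0] in eventually_elim)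
       (auto simp: indicator_def)
  finally show ?thesis .
qed

lemma nn_integral_powr_between:
  assumes "0 < a" "a \<le> b" "c \<noteq> 0"
  shows "(\<integral>\<^sup>+s\<in>{a<..<b}. ennreal (\<bar>c\<bar> * s powr (c - 1)) \<partial>lborel) = ennreal \<bar>b powr c - a powr c\<bar>"
proof -
  define \<sigma> where "\<sigma> = sgn c"
  have \<sigma>: "\<bar>c\<bar> = \<sigma> * c" by (simp add: \<sigma>_def abs_sgn mult.commute)
  have mono: "0 \<le> \<sigma> * (b powr c - a powr c)"
    using assms by (cases "c > 0") (auto simp: \<sigma>_def powr_mono2 powr_mono2')
  have "(\<integral>\<^sup>+x. ennreal (\<bar>c\<bar> * x powr (c - 1)) * indicator {a..b} x \<partial>lborel)
      = ennreal (\<sigma> * b powr c - \<sigma> * a powr c)"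
    using assms
    by (intro nn_integral_FTC_Icc) (auto simp: \<sigma> \<sigma>_def sgn_if intro!: derivative_eq_intros)
  also have "(\<integral>\<^sup>+x. ennreal (\<bar>c\<bar> * x powr (c - 1)) * indicator {a..b} x \<partial>lborel)
      = (\<integral>\<^sup>+s\<in>{a<..<b}. ennreal (\<bar>c\<bar> * s powr (c - 1)) \<partial>lborel)"
    by (intro nn_integral_cong_AE, use AE_lborel_singleton[of a] AE_lborel_singleton[of b] in eventually_elim)
       (auto simp: indicator_def)
  also have "\<sigma> * b powr c - \<sigma> * a powr c = \<bar>b powr c - a powr c\<bar>"
    using mono assms(3) by (auto simp: \<sigma>_def sgn_if algebra_simps split: if_splits)
  finally show ?thesis .
qed

text \<open>Tonelli's theorem on the triangle \<open>x < s\<close>.\<close>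

lemma nn_integral_triangle:
  fixes f g :: "real \<Rightarrow> ennreal"
  assumes [measurable]: "f \<in> borel_measurable borel" "g \<in> borel_measurable borel"
  shows "(\<integral>\<^sup>+x. f x * (\<integral>\<^sup>+s\<in>{x<..}. g s \<partial>lborel) \<partial>lborel) = (\<integral>\<^sup>+s. (\<integral>\<^sup>+x\<in>{..<s}. f x \<partial>lborel) * g s \<partial>lborel)"
proof -
  have "(\<integral>\<^sup>+x. f x * (\<integral>\<^sup>+s\<in>{x<..}. g s \<partial>lborel) \<partial>lborel)
      = (\<integral>\<^sup>+x. (\<integral>\<^sup>+s. f x * (g s * indicator {x<..} s) \<partial>lborel) \<partial>lborel)"
    by (simp add: nn_integral_cmult)
  also have "\<dots> = (\<integral>\<^sup>+s. (\<integral>\<^sup>+x. f x * (g s * indicator {x<..} s) \<partial>lborel) \<partial>lborel)"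
    by (rule lborel_pair.Fubini') (simp add: indicator_def[abs_def])
  also have "\<dots> = (\<integral>\<^sup>+s. (\<integral>\<^sup>+x\<in>{..<s}. f x \<partial>lborel) * g s \<partial>lborel)"
    by (intro nn_integral_cong, subst nn_integral_multc[symmetric])
       (auto intro!: nn_integral_cong simp: indicator_def)
  finally show ?thesis .
qed

text \<open>
  A decreasing function is a superposition of indicators of initial intervals (layer cake), so
  the hypothesis on the intervals \<open>(0, T)\<close> is enough.
\<close>

lemma nn_integral_decreasing_le:
  fixes \<phi> v1 v2 :: "real \<Rightarrow> ennreal"
  assumes [measurable]: "\<phi> \<in> borel_measurable lborel" "v1 \<in> borel_measurable lborel" "v2 \<in> borel_measurable lborel"
    and anti: "\<And>s t. 0 < s \<Longrightarrow> s \<le> t \<Longrightarrow> \<phi> t \<le> \<phi> s"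
    and le: "\<And>T. 0 < T \<Longrightarrow> (\<integral>\<^sup>+s\<in>{0<..<T}. v1 s \<partial>lborel) \<le> C * (\<integral>\<^sup>+s\<in>{0<..<T}. v2 s \<partial>lborel)"
  shows "(\<integral>\<^sup>+s\<in>{0<..}. \<phi> s * v1 s \<partial>lborel) \<le> C * (\<integral>\<^sup>+s\<in>{0<..}. \<phi> s * v2 s \<partial>lborel)"
proof -
  define A where "A y = {s. 0 < s \<and> ennreal y < \<phi> s}" for y
  have [measurable]: "A y \<in> sets borel" for y unfolding A_def by measurable
  have level: "(\<integral>\<^sup>+s\<in>A y. v1 s \<partial>lborel) \<le> C * (\<integral>\<^sup>+s\<in>A y. v2 s \<partial>lborel)" for y
  proof (cases "A y = {}")
    case False
    have down: "s \<in> A y" if "t \<in> A y" "0 < s" "s \<le> t" for s t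
      using that anti[of s t] by (auto simp: A_def)
    show ?thesis
    proof (cases "bdd_above (A y)")
      case True
      define T where "T = Sup (A y)"
      obtain a where a: "a \<in> A y" using False by auto
      have T: "0 < T" using a cSup_upper[OF a True] by (auto simp: T_def A_def)
      have in_A: "s \<in> A y" if "0 < s" "s < T" for s
        using that False True down less_cSup_iff[OF False True, of s] by (auto simp: T_def)
      have out_A: "s \<le> T" if "s \<in> A y" for s using cSup_upper[OF that True] by (simp add: T_def)
      have eq: "(\<integral>\<^sup>+s\<in>A y. v s \<partial>lborel) = (\<integral>\<^sup>+s\<in>{0<..<T}. v s \<partial>lborel)" for v :: "real \<Rightarrow> ennreal"
        by (intro nn_integral_cong_AE, use AE_lborel_singleton[of T] in eventually_elim)
           (use in_A out_A in \<open>force simp: indicator_def A_def\<close>)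
      show ?thesis unfolding eq by (rule le[OF T])
    next
      case unbdd: False
      have A: "A y = (\<Union>n. {0<..<real n + 1})"
      proof safe
        fix x assume "x \<in> A y"
        then show "x \<in> (\<Union>n. {0<..<real n + 1})"
          using reals_Archimedean2[of x] by (auto simp: A_def intro: less_trans) (meson less_add_one order_less_trans)
      next
        fix x and n :: nat assume "x \<in> {0<..<real n + 1}"
        moreover obtain t where "t \<in> A y" "x < t" using unbdd by (auto simp: bdd_above_def not_le)
        ultimately show "x \<in> A y" using down[of t x] by auto
      qed
      show ?thesis
        unfolding A
      proof (rule nn_integral_le_exhaustion)
        show "incseq (\<lambda>n. {0<..<real n + 1})" by (auto simp: incseq_def)
        fix n :: nat
        have "(\<integral>\<^sup>+s\<in>{0<..<real n + 1}. v1 s \<partial>lborel) \<le> C * (\<integral>\<^sup>+s\<in>{0<..<real n + 1}. v2 s \<partial>lborel)"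
          by (rule le) auto
        also have "\<dots> \<le> C * (\<integral>\<^sup>+s\<in>(\<Union>n. {0<..<real n + 1}). v2 s \<partial>lborel)"
          by (intro mult_left_mono nn_integral_mono) (auto simp: indicator_def)
        finally show "(\<integral>\<^sup>+s\<in>{0<..<real n + 1}. v1 s \<partial>lborel) \<le> C * (\<integral>\<^sup>+s\<in>(\<Union>n. {0<..<real n + 1}). v2 s \<partial>lborel)" .
      qed auto
    qed
  qed simp
  have cake: "(\<integral>\<^sup>+y. indicator {y. 0 < y \<and> ennreal y < \<phi> s} y \<partial>lborel) = \<phi> s" for s
  proof (cases "\<phi> s")
    case (real a)
    have "{y. 0 < y \<and> ennreal y < \<phi> s} = {0<..<a}" using real by (auto simp: ennreal_less_iff)
    then show ?thesis using real by simp
  next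
    case top
    then have "{y. 0 < y \<and> ennreal y < \<phi> s} = {0<..}" by auto
    then show ?thesis using top by (simp add: emeasure_lborel_greaterThan) 
  qed
  have rew: "(\<integral>\<^sup>+s\<in>{0<..}. \<phi> s * v s \<partial>lborel) = (\<integral>\<^sup>+y\<in>{0<..}. (\<integral>\<^sup>+s\<in>A y. v s \<partial>lborel) \<partial>lborel)"
    if [measurable]: "v \<in> borel_measurable lborel" for v :: "real \<Rightarrow> ennreal"
  proof -
    have "(\<integral>\<^sup>+s\<in>{0<..}. \<phi> s * v s \<partial>lborel)
        = (\<integral>\<^sup>+s. (\<integral>\<^sup>+y. indicator {y. 0 < y \<and> ennreal y < \<phi> s} y * (v s * indicator {0<..} s) \<partial>lborel) \<partial>lborel)"
      by (intro nn_integral_cong) (simp add: nn_integral_multc cake mult.assoc)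
    also have "\<dots> = (\<integral>\<^sup>+y. (\<integral>\<^sup>+s. indicator {y. 0 < y \<and> ennreal y < \<phi> s} y * (v s * indicator {0<..} s) \<partial>lborel) \<partial>lborel)"
      by (rule lborel_pair.Fubini') (simp add: indicator_def[abs_def])
    also have "\<dots> = (\<integral>\<^sup>+y\<in>{0<..}. (\<integral>\<^sup>+s\<in>A y. v s \<partial>lborel) \<partial>lborel)"
    proof (intro nn_integral_cong)
      fix y :: real
      show "(\<integral>\<^sup>+s. indicator {y. 0 < y \<and> ennreal y < \<phi> s} y * (v s * indicator {0<..} s) \<partial>lborel)
         = (\<integral>\<^sup>+s\<in>A y. v s \<partial>lborel) * indicator {0<..} y"
        by (subst nn_integral_multc[symmetric]) (auto intro!: nn_integral_cong simp: A_def indicator_def)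
    qed
    finally show ?thesis .
  qed
  have "(\<integral>\<^sup>+s\<in>{0<..}. \<phi> s * v1 s \<partial>lborel) \<le> (\<integral>\<^sup>+y\<in>{0<..}. C * (\<integral>\<^sup>+s\<in>A y. v2 s \<partial>lborel) \<partial>lborel)"
    unfolding rew[OF assms(2)] by (intro nn_integral_mono mult_right_mono level) auto
  also have "\<dots> = C * (\<integral>\<^sup>+y\<in>{0<..}. (\<integral>\<^sup>+s\<in>A y. v2 s \<partial>lborel) \<partial>lborel)"
  proof -
    have [measurable]: "(\<lambda>y. \<integral>\<^sup>+s\<in>A y. v2 s \<partial>lborel) \<in> borel_measurable lborel"
      unfolding A_def by (intro lborel.borel_measurable_nn_integral) (simp add: indicator_def[abs_def])
    show ?thesis by (subst nn_integral_cmult[symmetric]) (auto simp: mult.assoc)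
  qed
  also have "\<dots> = C * (\<integral>\<^sup>+s\<in>{0<..}. \<phi> s * v2 s \<partial>lborel)" by (simp add: rew)
  finally show ?thesis .
qed

section \<open>Self-improvement of the weight conditions\<close>

text \<open>
  The weight enters the analysis only through a Borel representative with values in \<open>[0, \<infinity>]\<close>.
  The facts \<open>B\<close> and \<open>BS\<close> are the conditions \<open>B\<^sub>r\<close> and \<open>B\<^sup>*\<^sub>q\<close>, divided by the power of \<open>t\<close>.
\<close>

locale hardy_weight =
  fixes u :: "real \<Rightarrow> ennreal" and r q cB cS :: real and W :: "real \<Rightarrow> ennreal"
  defines "W \<equiv> \<lambda>t. \<integral>\<^sup>+s\<in>{0<..<t}. u s \<partial>lborel"
  assumes u [measurable]: "u \<in> borel_measurable borel"
    and r: "1 < r" and q: "0 < q" and cB: "0 < cB" and cS: "0 < cS"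
    and B: "\<And>t. 0 < t \<Longrightarrow> (\<integral>\<^sup>+s\<in>{t<..}. ennreal (s powr (- r)) * u s \<partial>lborel)
               \<le> ennreal (cB * t powr (- r)) * W t"
    and BS: "\<And>t. 0 < t \<Longrightarrow> (\<integral>\<^sup>+s\<in>{0<..<t}. ennreal (s powr (- q)) * u s \<partial>lborel)
               \<le> ennreal (cS * t powr (- q)) * W t"
    and nonzero: "(\<integral>\<^sup>+s\<in>{0<..}. u s \<partial>lborel) \<noteq> 0"
begin

lemma W_measurable [measurable]: "W \<in> borel_measurable borel"
  unfolding W_def by (simp add: indicator_def[abs_def])

text \<open>
  The extra factor \<open>s powr \<epsilon>\<close> is the integral of its derivative. After Tonelli, the inner
  integral is again a tail, to which \<open>B\<^sub>r\<close> applies; this reproduces the left-hand side with the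
  factor \<open>\<theta>\<close>, which is at most \<open>1/2\<close> once \<open>\<epsilon>\<close> is small compared with the constant of \<open>B\<^sub>r\<close>.
  Cutting the integral off at a finite point makes it finite, so that it can be absorbed.
\<close>

lemma B_self_improve:
  "\<exists>\<epsilon> c. 0 < \<epsilon> \<and> \<epsilon> < r - 1 \<and> 0 < c \<and>
     (\<forall>t>0. (\<integral>\<^sup>+s\<in>{t<..}. ennreal (s powr (\<epsilon> - r)) * u s \<partial>lborel) \<le> ennreal (c * t powr (\<epsilon> - r)) * W t)"
proof -
  define \<epsilon> where "\<epsilon> = min ((r - 1) / 2) (1 / (2 * cB))"
  have \<epsilon>: "0 < \<epsilon>" "\<epsilon> < r - 1" "r - \<epsilon> > 1" using r cB by (auto simp: \<epsilon>_def min_def field_simps)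
  define \<theta> where "\<theta> = \<epsilon> * cB / (r - \<epsilon>)"
  have "\<epsilon> * cB \<le> 1 / 2" using cB by (auto simp: \<epsilon>_def min_def field_simps)
  then have \<theta>: "0 \<le> \<theta>" "\<theta> \<le> 1 / 2" using \<epsilon> cB by (auto simp: \<theta>_def field_simps intro: order_trans)
  define c where "c = 2 * (cB + \<theta>)"
  have c: "0 < c" using cB \<theta> by (simp add: c_def)
  have main: "(\<integral>\<^sup>+s\<in>{t<..}. ennreal (s powr (\<epsilon> - r)) * u s \<partial>lborel) \<le> ennreal (c * t powr (\<epsilon> - r)) * W t"
    if t: "0 < t" for t
  proof (cases "W t = top")
    case True
    then show ?thesis using c t by (simp add: ennreal_mult_top)
  next
    case fin: False
    have trunc: "(\<integral>\<^sup>+s\<in>{t<..<n}. ennreal (s powr (\<epsilon> - r)) * u s \<partial>lborel) \<le> ennreal (c * t powr (\<epsilon> - r)) * W t" for n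
    proof -
      define U where "U s = u s * indicator {t<..<n} s" for s
      define \<phi> where "\<phi> x = ennreal (\<epsilon> * x powr (\<epsilon> - 1)) * indicator {t<..} x" for x
      define \<psi> where "\<psi> x = ennreal (x powr (- (r - \<epsilon>) - 1)) * indicator {t<..} x" for x
      have [measurable]: "U \<in> borel_measurable borel" "\<phi> \<in> borel_measurable borel" "\<psi> \<in> borel_measurable borel"
        unfolding U_def[abs_def] \<phi>_def[abs_def] \<psi>_def[abs_def] by measurable
      let ?h = "\<lambda>s. ennreal (s powr (- r)) * U s"
      let ?X = "\<integral>\<^sup>+s. ennreal (s powr (\<epsilon> - r)) * U s \<partial>lborel"
      have tail: "(\<integral>\<^sup>+s\<in>{x<..}. ?h s \<partial>lborel) \<le> ennreal (cB * x powr (- r)) * W x" if "0 < x" for x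
        using B[OF that]
        by (rule order_trans[rotated]) (auto intro!: nn_integral_mono simp: U_def indicator_def)
      have h_le: "integral\<^sup>N lborel ?h \<le> ennreal (cB * t powr (- r)) * W t"
        using tail[OF t] by (rule order_trans[rotated]) (auto intro!: nn_integral_mono simp: U_def indicator_def)
      have "?X \<le> (\<integral>\<^sup>+s. ennreal (n powr \<epsilon>) * ?h s \<partial>lborel)"
      proof (intro nn_integral_mono)
        fix s
        have "ennreal (s powr (\<epsilon> - r)) \<le> ennreal (n powr \<epsilon>) * ennreal (s powr (- r))" if "t < s" "s < n"
        proof -
          have "s powr (\<epsilon> - r) = s powr \<epsilon> * s powr (- r)" by (simp add: powr_add[symmetric])
          also have "\<dots> \<le> n powr \<epsilon> * s powr (- r)"
            using that t \<epsilon> by (intro mult_right_mono powr_mono2) auto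
          finally show ?thesis by (simp add: ennreal_mult[symmetric])
        qed
        then show "ennreal (s powr (\<epsilon> - r)) * U s \<le> ennreal (n powr \<epsilon>) * ?h s"
          by (auto simp: U_def indicator_def mult.assoc[symmetric] intro!: mult_right_mono)
      qed
      also have "\<dots> \<le> ennreal (n powr \<epsilon>) * (ennreal (cB * t powr (- r)) * W t)"
        by (subst nn_integral_cmult, simp, intro mult_left_mono h_le) auto
      also have "\<dots> < top" using fin by (simp add: ennreal_mult_less_top less_top)
      finally have X_fin: "?X < top" .
      have split: "ennreal (s powr (\<epsilon> - r)) * U s = ennreal (t powr \<epsilon>) * ?h s + (\<integral>\<^sup>+x\<in>{..<s}. \<phi> x \<partial>lborel) * ?h s" for s
      proof (cases "s \<in> {t<..<n}")
        case True
        have "(\<integral>\<^sup>+x\<in>{..<s}. \<phi> x \<partial>lborel) = (\<integral>\<^sup>+x\<in>{t<..<s}. ennreal (\<bar>\<epsilon>\<bar> * x powr (\<epsilon> - 1)) \<partial>lborel)"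
          using \<epsilon> by (intro nn_integral_cong) (auto simp: \<phi>_def indicator_def)
        also have "\<dots> = ennreal (s powr \<epsilon> - t powr \<epsilon>)"
          using True \<epsilon> t powr_mono2[of \<epsilon> t s] by (subst nn_integral_powr_between) auto
        finally have *: "(\<integral>\<^sup>+x\<in>{..<s}. \<phi> x \<partial>lborel) = ennreal (s powr \<epsilon> - t powr \<epsilon>)" .
        have "ennreal (t powr \<epsilon>) + ennreal (s powr \<epsilon> - t powr \<epsilon>) = ennreal (s powr \<epsilon>)"
          using True \<epsilon> t powr_mono2[of \<epsilon> t s] by (subst ennreal_plus[symmetric]) auto
        moreover have "ennreal (s powr \<epsilon>) * ?h s = ennreal (s powr (\<epsilon> - r)) * U s"
          by (simp add: mult.assoc[symmetric] ennreal_mult[symmetric] powr_add[symmetric])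
        ultimately show ?thesis unfolding * distrib_right[symmetric] by simp
      qed (simp add: U_def)
      have "?X = ennreal (t powr \<epsilon>) * integral\<^sup>N lborel ?h + (\<integral>\<^sup>+s. (\<integral>\<^sup>+x\<in>{..<s}. \<phi> x \<partial>lborel) * ?h s \<partial>lborel)"
        unfolding split
        by (subst nn_integral_add, simp, simp add: indicator_def[abs_def], subst nn_integral_cmult, simp, rule refl)
      also have "(\<integral>\<^sup>+s. (\<integral>\<^sup>+x\<in>{..<s}. \<phi> x \<partial>lborel) * ?h s \<partial>lborel) = (\<integral>\<^sup>+x. \<phi> x * (\<integral>\<^sup>+s\<in>{x<..}. ?h s \<partial>lborel) \<partial>lborel)"
        by (rule nn_integral_triangle[symmetric]) auto
      also have "\<dots> \<le> (\<integral>\<^sup>+x. ennreal (\<epsilon> * cB) * (\<psi> x * W t + (\<integral>\<^sup>+s\<in>{..<x}. U s \<partial>lborel) * \<psi> x) \<partial>lborel)"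
      proof (intro nn_integral_mono)
        fix x
        show "\<phi> x * (\<integral>\<^sup>+s\<in>{x<..}. ?h s \<partial>lborel) \<le> ennreal (\<epsilon> * cB) * (\<psi> x * W t + (\<integral>\<^sup>+s\<in>{..<x}. U s \<partial>lborel) * \<psi> x)"
        proof (cases "t < x \<and> x < n")
          case True
          have "W x \<le> (\<integral>\<^sup>+s. u s * indicator {0<..<t} s + U s * indicator {..<x} s \<partial>lborel)"
            unfolding W_def by (intro nn_integral_mono_AE, use AE_lborel_singleton[of t] in eventually_elim)
              (use True in \<open>auto simp: U_def indicator_def\<close>)
          also have "\<dots> = W t + (\<integral>\<^sup>+s\<in>{..<x}. U s \<partial>lborel)"
            unfolding W_def by (rule nn_integral_add) auto
          finally have W_x: "W x \<le> W t + (\<integral>\<^sup>+s\<in>{..<x}. U s \<partial>lborel)" .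
          have "\<phi> x * (\<integral>\<^sup>+s\<in>{x<..}. ?h s \<partial>lborel) \<le> ennreal (\<epsilon> * x powr (\<epsilon> - 1)) * (ennreal (cB * x powr (- r)) * W x)"
            using True t tail[of x] by (simp add: \<phi>_def mult_left_mono)
          also have "\<dots> = ennreal (\<epsilon> * cB) * (\<psi> x * W x)"
            using True \<epsilon> cB ennreal_powr_mult2[of cB \<epsilon> x "\<epsilon> - 1" "- r" "W x"] by (simp add: \<psi>_def algebra_simps)
          also have "\<dots> \<le> ennreal (\<epsilon> * cB) * (\<psi> x * (W t + (\<integral>\<^sup>+s\<in>{..<x}. U s \<partial>lborel)))"
            by (intro mult_left_mono W_x) auto
          finally show ?thesis by (simp only: distrib_left mult.commute[of "\<psi> x"])
        next
          case False
          have zero: "\<phi> x * (\<integral>\<^sup>+s\<in>{x<..}. ?h s \<partial>lborel) = 0"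
          proof (cases "x \<le> t")
            case False
            with \<open>\<not> (t < x \<and> x < n)\<close> have "(\<integral>\<^sup>+s\<in>{x<..}. ?h s \<partial>lborel) = (\<integral>\<^sup>+s. 0 \<partial>(lborel :: real measure))"
              by (intro nn_integral_cong) (auto simp: U_def indicator_def)
            then show ?thesis by simp
          qed (simp add: \<phi>_def)
          show ?thesis unfolding zero by simp
        qed
      qed
      also have "\<dots> = ennreal (\<epsilon> * cB) * (integral\<^sup>N lborel \<psi> * W t + (\<integral>\<^sup>+x. (\<integral>\<^sup>+s\<in>{..<x}. U s \<partial>lborel) * \<psi> x \<partial>lborel))"
        by (subst nn_integral_cmult, simp add: indicator_def[abs_def], subst nn_integral_add, simp,
            simp add: indicator_def[abs_def], subst nn_integral_multc, simp, rule refl)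
      also have "(\<integral>\<^sup>+x. (\<integral>\<^sup>+s\<in>{..<x}. U s \<partial>lborel) * \<psi> x \<partial>lborel) = (\<integral>\<^sup>+x. U x * (\<integral>\<^sup>+s\<in>{x<..}. \<psi> s \<partial>lborel) \<partial>lborel)"
        by (rule nn_integral_triangle[symmetric]) auto
      also have "\<dots> = (\<integral>\<^sup>+x. ennreal (1 / (r - \<epsilon>)) * (ennreal (x powr (\<epsilon> - r)) * U x) \<partial>lborel)"
      proof (intro nn_integral_cong)
        fix x
        have "(\<integral>\<^sup>+s\<in>{x<..}. \<psi> s \<partial>lborel) = ennreal (1 / (r - \<epsilon>)) * ennreal (x powr (\<epsilon> - r))" if "t < x"
        proof -
          have "(\<integral>\<^sup>+s\<in>{x<..}. \<psi> s \<partial>lborel) = (\<integral>\<^sup>+s\<in>{x<..}. ennreal (s powr (- (r - \<epsilon>) - 1)) \<partial>lborel)"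
            using that by (intro nn_integral_cong) (auto simp: \<psi>_def indicator_def)
          then show ?thesis using that t \<epsilon> nn_integral_powr_above[of x "r - \<epsilon>"] by (simp add: ennreal_mult[symmetric])
        qed
        then show "U x * (\<integral>\<^sup>+s\<in>{x<..}. \<psi> s \<partial>lborel) = ennreal (1 / (r - \<epsilon>)) * (ennreal (x powr (\<epsilon> - r)) * U x)"
          by (cases "t < x") (auto simp: U_def mult_ac)
      qed
      also have "\<dots> = ennreal (1 / (r - \<epsilon>)) * ?X" by (rule nn_integral_cmult) simp
      also have "integral\<^sup>N lborel \<psi> = ennreal (t powr (\<epsilon> - r) / (r - \<epsilon>))"
        unfolding \<psi>_def using t \<epsilon> nn_integral_powr_above[of t "r - \<epsilon>"] by simp
      also have "ennreal (\<epsilon> * cB) * (ennreal (t powr (\<epsilon> - r) / (r - \<epsilon>)) * W t + ennreal (1 / (r - \<epsilon>)) * ?X)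
         = ennreal (\<theta> * t powr (\<epsilon> - r)) * W t + ennreal \<theta> * ?X"
        using \<epsilon> cB by (simp add: \<theta>_def distrib_left mult.assoc[symmetric] ennreal_mult[symmetric])
      also have "ennreal (t powr \<epsilon>) * integral\<^sup>N lborel ?h \<le> ennreal (cB * t powr (\<epsilon> - r)) * W t"
        using mult_left_mono[OF h_le, of "ennreal (t powr \<epsilon>)"] cB ennreal_powr_mult[of cB t \<epsilon> "- r" "W t"] by simp
      finally have "?X \<le> (ennreal (cB * t powr (\<epsilon> - r)) * W t + ennreal (\<theta> * t powr (\<epsilon> - r)) * W t) + ennreal \<theta> * ?X"
        by (simp add: add.assoc add_right_mono add_left_mono)
      then have "?X \<le> 2 * (ennreal (cB * t powr (\<epsilon> - r)) * W t + ennreal (\<theta> * t powr (\<epsilon> - r)) * W t)"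
        by (rule ennreal_absorb[OF X_fin _ \<theta>(2)])
      also have "\<dots> = ennreal (c * t powr (\<epsilon> - r)) * W t"
        using cB \<theta> by (simp add: c_def distrib_left distrib_right ennreal_mult mult.assoc)
      finally show ?thesis by (simp add: U_def mult.assoc)
    qed
    have "(\<integral>\<^sup>+s\<in>(\<Union>n. {t<..<real n}). ennreal (s powr (\<epsilon> - r)) * u s \<partial>lborel) \<le> ennreal (c * t powr (\<epsilon> - r)) * W t"
      by (rule nn_integral_le_exhaustion) (auto simp: incseq_def trunc)
    moreover have "(\<Union>n. {t<..<real n}) = {t<..}" using reals_Archimedean2 by auto
    ultimately show ?thesis by simp
  qed
  show ?thesis using \<epsilon> c main by blast
qed

text \<open>
  The mirror image of the previous argument at the origin. Here cutting off the domain would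
  spoil the recursion, since \<open>W\<close> also sees the part of the weight that is removed; instead the
  factor \<open>s powr (-\<delta>)\<close> is capped at \<open>\<eta>\<close>.
\<close>

lemma BS_self_improve:
  "\<exists>\<delta> c. 0 < \<delta> \<and> 0 < c \<and>
     (\<forall>t>0. (\<integral>\<^sup>+s\<in>{0<..<t}. ennreal (s powr (- q - \<delta>)) * u s \<partial>lborel) \<le> ennreal (c * t powr (- q - \<delta>)) * W t)"
proof -
  define \<delta> where "\<delta> = q / (2 * (cS + 1))"
  have \<delta>: "0 < \<delta>" using q cS by (simp add: \<delta>_def)
  define \<theta> where "\<theta> = \<delta> * cS / (q + \<delta>)"
  have "\<theta> \<le> \<delta> * cS / q" unfolding \<theta>_def using \<delta> q cS by (intro divide_left_mono) auto
  also have "\<dots> = cS / (2 * (cS + 1))" using q by (simp add: \<delta>_def)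
  also have "\<dots> \<le> 1 / 2" using cS by (simp add: divide_le_eq)
  finally have \<theta>: "\<theta> \<le> 1 / 2" .
  have main: "(\<integral>\<^sup>+s\<in>{0<..<t}. ennreal (s powr (- q - \<delta>)) * u s \<partial>lborel) \<le> ennreal ((2 * cS) * t powr (- q - \<delta>)) * W t"
    if t: "0 < t" for t
  proof (cases "W t = top")
    case True
    then show ?thesis using cS t by (simp add: ennreal_mult_top)
  next
    case fin: False
    have trunc: "(\<integral>\<^sup>+s\<in>{\<eta><..<t}. ennreal (s powr (- q - \<delta>)) * u s \<partial>lborel) \<le> ennreal ((2 * cS) * t powr (- q - \<delta>)) * W t"
      if \<eta>: "0 < \<eta>" for \<eta>
    proof (cases "\<eta> < t")
      case False
      then have "(\<integral>\<^sup>+s\<in>{\<eta><..<t}. ennreal (s powr (- q - \<delta>)) * u s \<partial>lborel) = 0" by simp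
      then show ?thesis by simp
    next
      case True
      define U where "U s = u s * indicator {0<..<t} s" for s
      define \<phi> where "\<phi> x = ennreal (\<delta> * x powr (- \<delta> - 1)) * indicator {\<eta><..<t} x" for x
      define \<psi> where "\<psi> x = ennreal (x powr (- (q + \<delta>) - 1)) * indicator {\<eta><..<t} x" for x
      have [measurable]: "U \<in> borel_measurable borel" "\<phi> \<in> borel_measurable borel" "\<psi> \<in> borel_measurable borel"
        unfolding U_def[abs_def] \<phi>_def[abs_def] \<psi>_def[abs_def] by measurable
      let ?m = "\<lambda>s. max s \<eta> powr (- \<delta>)"
      let ?h = "\<lambda>s. ennreal (s powr (- q)) * U s"
      let ?X = "\<integral>\<^sup>+s. ennreal (?m s) * ?h s \<partial>lborel"
      have h_le: "(\<integral>\<^sup>+s\<in>{..<x}. ?h s \<partial>lborel) \<le> ennreal (cS * x powr (- q)) * W x" if "0 < x" for x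
        using BS[OF that] by (rule order_trans[rotated]) (auto intro!: nn_integral_mono simp: U_def indicator_def)
      have "integral\<^sup>N lborel ?h = (\<integral>\<^sup>+s\<in>{..<t}. ?h s \<partial>lborel)"
        by (intro nn_integral_cong) (auto simp: U_def indicator_def)
      then have h_t: "integral\<^sup>N lborel ?h \<le> ennreal (cS * t powr (- q)) * W t" using h_le[OF t] by simp
      have "?X \<le> (\<integral>\<^sup>+s. ennreal (\<eta> powr (- \<delta>)) * ?h s \<partial>lborel)"
        using \<eta> \<delta> by (intro nn_integral_mono mult_right_mono ennreal_leI powr_mono2') auto
      also have "\<dots> \<le> ennreal (\<eta> powr (- \<delta>)) * (ennreal (cS * t powr (- q)) * W t)"
        by (subst nn_integral_cmult, simp, intro mult_left_mono h_t) auto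
      also have "\<dots> < top" using fin by (simp add: ennreal_mult_less_top less_top)
      finally have X_fin: "?X < top" .
      have split: "ennreal (?m s) = ennreal (t powr (- \<delta>)) + (\<integral>\<^sup>+x\<in>{s<..}. \<phi> x \<partial>lborel)" if s: "s < t" for s
      proof -
        have "(\<integral>\<^sup>+x\<in>{s<..}. \<phi> x \<partial>lborel) = (\<integral>\<^sup>+x\<in>{max s \<eta><..<t}. ennreal (\<bar>- \<delta>\<bar> * x powr (- \<delta> - 1)) \<partial>lborel)"
          using \<delta> by (intro nn_integral_cong) (auto simp: \<phi>_def indicator_def)
        also have "\<dots> = ennreal \<bar>t powr (- \<delta>) - ?m s\<bar>"
          using True \<eta> \<delta> s by (intro nn_integral_powr_between) auto
        finally show ?thesis
          using True \<eta> \<delta> s powr_mono2'[of "- \<delta>" "max s \<eta>" t] by (simp add: ennreal_plus[symmetric] del: ennreal_plus)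
      qed
      have "?X = (\<integral>\<^sup>+s. ennreal (t powr (- \<delta>)) * ?h s + ?h s * (\<integral>\<^sup>+x\<in>{s<..}. \<phi> x \<partial>lborel) \<partial>lborel)"
      proof (intro nn_integral_cong)
        fix s show "ennreal (?m s) * ?h s = ennreal (t powr (- \<delta>)) * ?h s + ?h s * (\<integral>\<^sup>+x\<in>{s<..}. \<phi> x \<partial>lborel)"
        proof (cases "s < t")
          case True
          then show ?thesis unfolding split[OF True] distrib_right by (simp only: mult.commute)
        qed (simp add: U_def)
      qed
      also have "\<dots> = ennreal (t powr (- \<delta>)) * integral\<^sup>N lborel ?h + (\<integral>\<^sup>+s. ?h s * (\<integral>\<^sup>+x\<in>{s<..}. \<phi> x \<partial>lborel) \<partial>lborel)"
        by (subst nn_integral_add, simp, simp add: indicator_def[abs_def], subst nn_integral_cmult, simp, rule refl)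
      also have "(\<integral>\<^sup>+s. ?h s * (\<integral>\<^sup>+x\<in>{s<..}. \<phi> x \<partial>lborel) \<partial>lborel) = (\<integral>\<^sup>+x. (\<integral>\<^sup>+s\<in>{..<x}. ?h s \<partial>lborel) * \<phi> x \<partial>lborel)"
        by (rule nn_integral_triangle) auto
      also have "\<dots> \<le> (\<integral>\<^sup>+x. ennreal (\<delta> * cS) * ((\<integral>\<^sup>+s\<in>{..<x}. U s \<partial>lborel) * \<psi> x) \<partial>lborel)"
      proof (intro nn_integral_mono)
        fix x
        show "(\<integral>\<^sup>+s\<in>{..<x}. ?h s \<partial>lborel) * \<phi> x \<le> ennreal (\<delta> * cS) * ((\<integral>\<^sup>+s\<in>{..<x}. U s \<partial>lborel) * \<psi> x)"
        proof (cases "x \<in> {\<eta><..<t}")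
          case x: True
          have "(\<integral>\<^sup>+s\<in>{..<x}. ?h s \<partial>lborel) * \<phi> x \<le> ennreal (\<delta> * x powr (- \<delta> - 1)) * (ennreal (cS * x powr (- q)) * W x)"
            using x \<eta> h_le[of x] by (simp add: \<phi>_def mult.commute mult_left_mono)
          also have "\<dots> = ennreal (\<delta> * cS) * (W x * \<psi> x)"
            using x \<delta> cS ennreal_powr_mult2[of cS \<delta> x "- \<delta> - 1" "- q" "W x"] by (simp add: \<psi>_def algebra_simps)
          also have "W x = (\<integral>\<^sup>+s\<in>{..<x}. U s \<partial>lborel)"
            unfolding W_def using x by (intro nn_integral_cong) (auto simp: U_def indicator_def)
          finally show ?thesis .
        qed (simp add: \<phi>_def)
      qed
      also have "\<dots> = ennreal (\<delta> * cS) * (\<integral>\<^sup>+x. U x * (\<integral>\<^sup>+s\<in>{x<..}. \<psi> s \<partial>lborel) \<partial>lborel)"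
        by (subst nn_integral_cmult, simp add: indicator_def[abs_def], subst nn_integral_triangle, simp, simp, rule refl)
      also have "(\<integral>\<^sup>+x. U x * (\<integral>\<^sup>+s\<in>{x<..}. \<psi> s \<partial>lborel) \<partial>lborel) \<le> (\<integral>\<^sup>+x. ennreal (1 / (q + \<delta>)) * (ennreal (?m x) * ?h x) \<partial>lborel)"
      proof (intro nn_integral_mono)
        fix x
        have "(\<integral>\<^sup>+s\<in>{x<..}. \<psi> s \<partial>lborel) \<le> ennreal (1 / (q + \<delta>)) * (ennreal (?m x) * ennreal (x powr (- q)))" if x: "0 < x"
        proof -
          have "(\<integral>\<^sup>+s\<in>{x<..}. \<psi> s \<partial>lborel) \<le> (\<integral>\<^sup>+s\<in>{max x \<eta><..}. ennreal (s powr (- (q + \<delta>) - 1)) \<partial>lborel)"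
            by (intro nn_integral_mono) (auto simp: \<psi>_def indicator_def)
          also have "\<dots> = ennreal (max x \<eta> powr (- (q + \<delta>)) / (q + \<delta>))"
            using \<eta> q \<delta> by (intro nn_integral_powr_above) auto
          also have "\<dots> \<le> ennreal (1 / (q + \<delta>) * (?m x * x powr (- q)))"
          proof (rule ennreal_leI)
            have "max x \<eta> powr (- (q + \<delta>)) = ?m x * max x \<eta> powr (- q)"
              by (simp add: powr_add[symmetric] minus_diff_commute)
            also have "\<dots> \<le> ?m x * x powr (- q)" using x q by (intro mult_left_mono powr_mono2') auto
            finally show "max x \<eta> powr (- (q + \<delta>)) / (q + \<delta>) \<le> 1 / (q + \<delta>) * (?m x * x powr (- q))"
              using q \<delta> by (simp add: divide_right_mono)
          qed
          also have "\<dots> = ennreal (1 / (q + \<delta>)) * (ennreal (?m x) * ennreal (x powr (- q)))"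
            using q \<delta> by (simp add: ennreal_mult[symmetric])
          finally show ?thesis .
        qed
        from mult_left_mono[OF this, of "U x"]
        show "U x * (\<integral>\<^sup>+s\<in>{x<..}. \<psi> s \<partial>lborel) \<le> ennreal (1 / (q + \<delta>)) * (ennreal (?m x) * ?h x)"
          by (cases "0 < x") (simp_all add: U_def mult_ac)
      qed
      also have "\<dots> = ennreal (1 / (q + \<delta>)) * ?X" by (rule nn_integral_cmult) simp
      also have "ennreal (\<delta> * cS) * (ennreal (1 / (q + \<delta>)) * ?X) = ennreal \<theta> * ?X"
        using \<delta> cS q by (simp add: \<theta>_def mult.assoc[symmetric] ennreal_mult[symmetric])
      also have "ennreal (t powr (- \<delta>)) * integral\<^sup>N lborel ?h \<le> ennreal (cS * t powr (- q - \<delta>)) * W t"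
        using mult_left_mono[OF h_t, of "ennreal (t powr (- \<delta>))"] cS ennreal_powr_mult[of cS t "- \<delta>" "- q" "W t"]
        by (simp add: minus_diff_commute)
      finally have "?X \<le> ennreal (cS * t powr (- q - \<delta>)) * W t + ennreal \<theta> * ?X"
        by (simp add: add_right_mono add_left_mono mult_left_mono)
      then have "?X \<le> 2 * (ennreal (cS * t powr (- q - \<delta>)) * W t)"
        by (rule ennreal_absorb[OF X_fin _ \<theta>])
      also have "\<dots> = ennreal ((2 * cS) * t powr (- q - \<delta>)) * W t"
        using cS by (simp add: mult.assoc[symmetric] ennreal_mult)
      finally have *: "?X \<le> ennreal ((2 * cS) * t powr (- q - \<delta>)) * W t" .
      have "(\<integral>\<^sup>+s\<in>{\<eta><..<t}. ennreal (s powr (- q - \<delta>)) * u s \<partial>lborel) \<le> ?X"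
      proof (intro nn_integral_mono)
        fix s
        have "ennreal (s powr (- q - \<delta>)) = ennreal (?m s) * ennreal (s powr (- q))" if "\<eta> < s"
          using that by (simp add: ennreal_mult[symmetric] powr_add[symmetric] minus_diff_commute)
        then show "ennreal (s powr (- q - \<delta>)) * u s * indicator {\<eta><..<t} s \<le> ennreal (?m s) * ?h s"
          using \<eta> by (auto simp: U_def indicator_def mult.assoc)
      qed
      with * show ?thesis by simp
    qed
    have "(\<integral>\<^sup>+s\<in>(\<Union>n. {1 / real (Suc n)<..<t}). ennreal (s powr (- q - \<delta>)) * u s \<partial>lborel) \<le> ennreal ((2 * cS) * t powr (- q - \<delta>)) * W t"
    proof (rule nn_integral_le_exhaustion)
      show "incseq (\<lambda>n. {1 / real (Suc n)<..<t})"
      proof (intro monoI subsetI)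
        fix m n :: nat and x assume "m \<le> n" "x \<in> {1 / real (Suc m)<..<t}"
        moreover from \<open>m \<le> n\<close> have "1 / real (Suc n) \<le> 1 / real (Suc m)" by (intro frac_le) auto
        ultimately show "x \<in> {1 / real (Suc n)<..<t}" by (auto simp del: of_nat_Suc)
      qed
    qed (auto intro: trunc)
    moreover have "(\<Union>n. {1 / real (Suc n)<..<t}) = {0<..<t}"
    proof safe
      fix x assume "x \<in> {0<..<t}"
      then show "x \<in> (\<Union>n. {1 / real (Suc n)<..<t})"
        using reals_Archimedean[of x] by (auto simp: inverse_eq_divide)
    next
      fix x n assume "x \<in> {1 / real (Suc n)<..<t}"
      moreover have "0 < 1 / real (Suc n)" by simp
      ultimately show "x \<in> {0<..<t}" by (meson greaterThanLessThan_iff less_trans)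
    qed
    ultimately show ?thesis by simp
  qed
  then show ?thesis using \<delta> cS by (intro exI[of _ \<delta>] exI[of _ "2 * cS"]) auto
qed

end

section \<open>Hardy inequalities for decreasing functions\<close>

text \<open>Jensen's inequality for the quotient \<open>f / k\<close> and the density \<open>k\<close>.\<close>

lemma epowr_set_nn_integral_le:
  assumes [measurable]: "f \<in> borel_measurable M" "k \<in> borel_measurable M" "A \<in> sets M"
    and k: "\<And>x. x \<in> A \<Longrightarrow> 0 < k x" and 1: "(\<integral>\<^sup>+x\<in>A. ennreal (k x) \<partial>M) = 1" and r: "1 < r"
  shows "epowr (\<integral>\<^sup>+x\<in>A. f x \<partial>M) r \<le> (\<integral>\<^sup>+x\<in>A. epowr (f x) r * ennreal (k x powr (1 - r)) \<partial>M)"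
proof -
  have "(\<integral>\<^sup>+x\<in>A. f x \<partial>M) = (\<integral>\<^sup>+x. f x * ennreal (1 / k x) * (ennreal (k x) * indicator A x) \<partial>M)"
    using k by (intro nn_integral_cong)
      (auto simp: indicator_def mult.assoc ennreal_mult[symmetric] less_imp_neq[symmetric] less_imp_le)
  also have "epowr \<dots> r \<le> (\<integral>\<^sup>+x. epowr (f x * ennreal (1 / k x)) r * (ennreal (k x) * indicator A x) \<partial>M)"
    using 1 by (intro epowr_nn_integral_le r) auto
  also have "\<dots> = (\<integral>\<^sup>+x\<in>A. epowr (f x) r * ennreal (k x powr (1 - r)) \<partial>M)"
  proof (intro nn_integral_cong)
    fix x
    show "epowr (f x * ennreal (1 / k x)) r * (ennreal (k x) * indicator A x)
       = epowr (f x) r * ennreal (k x powr (1 - r)) * indicator A x"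
    proof (cases "x \<in> A")
      case True
      then have "0 < k x" by (rule k)
      then have "(1 / k x) powr r * k x = k x powr (1 - r)"
        by (simp add: powr_divide powr_diff)
      then show ?thesis using True r \<open>0 < k x\<close>
        by (simp add: epowr_mult mult.assoc ennreal_mult[symmetric])
    qed simp
  qed
  finally show ?thesis .
qed

context hardy_weight begin

text \<open>If the weight vanishes near the origin, then \<open>B\<^sub>r\<close> makes it vanish everywhere.\<close>

lemma W_pos: assumes "0 < t" shows "0 < W t"
proof (rule ccontr)
  assume "\<not> 0 < W t"
  then have 0: "W t = 0" by simp
  have "(\<integral>\<^sup>+s\<in>{t<..}. ennreal (s powr (- r)) * u s \<partial>lborel) = 0" using B[OF assms] 0 by simp
  then have "AE s in lborel. ennreal (s powr (- r)) * u s * indicator {t<..} s = 0"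
    by (subst (asm) nn_integral_0_iff_AE) auto
  moreover have "AE s in lborel. u s * indicator {0<..<t} s = 0"
    using 0 unfolding W_def by (subst (asm) nn_integral_0_iff_AE) auto
  ultimately have "AE s in lborel. u s * indicator {0<..} s = 0"
    using AE_lborel_singleton[of t]
    by eventually_elim (use assms in \<open>auto simp: indicator_def split: if_splits\<close>)
  then have "(\<integral>\<^sup>+s\<in>{0<..}. u s \<partial>lborel) = 0" by (subst nn_integral_0_iff_AE) auto
  with nonzero show False by simp
qed

text \<open>
  By \<open>B\<^sup>*\<^sub>q\<close> the integral \<open>W T\<close> grows at least like \<open>T powr q\<close>. This is what makes functions in
  \<open>\<Lambda>\<^sub>r(w)\<close> vanish at infinity.
\<close>

lemma W_unbounded: assumes "C < top" shows "\<exists>T>0. C < W T"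
proof (rule ccontr)
  assume "\<not> ?thesis"
  then have le: "W T \<le> C" if "0 < T" for T using that by (meson not_less)
  have W1: "W 1 < top" using le[of 1] assms by (auto intro: le_less_trans)
  then obtain w1 where w1: "W 1 = ennreal w1" "0 \<le> w1" by (cases "W 1") auto
  obtain c where c: "C = ennreal c" "0 \<le> c" using assms by (cases C) auto
  have "0 < w1" using W_pos[of 1] w1 by auto
  define T where "T = (cS * c / w1 + 1) powr (1 / q) + 1"
  have T: "1 \<le> T" by (simp add: T_def)
  have "W 1 \<le> (\<integral>\<^sup>+s\<in>{0<..<T}. ennreal (s powr (- q)) * u s \<partial>lborel)"
    unfolding W_def
  proof (intro nn_integral_mono)
    fix s :: real
    have "1 \<le> ennreal (s powr (- q))" if "0 < s" "s < 1"
      using that q powr_mono2'[of "- q" s 1] by auto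
    then show "u s * indicator {0<..<1} s \<le> ennreal (s powr (- q)) * u s * indicator {0<..<T} s"
      using T mult_right_mono[of 1 "ennreal (s powr (- q))" "u s"] by (auto simp: indicator_def)
  qed
  also have "\<dots> \<le> ennreal (cS * T powr (- q)) * W T" using T by (intro BS) auto
  also have "\<dots> \<le> ennreal (cS * T powr (- q)) * C" using T by (intro mult_left_mono le) auto
  finally have "w1 \<le> cS * T powr (- q) * c" using w1 c cS by (simp add: ennreal_mult[symmetric])
  then have "w1 * T powr q \<le> cS * c" using T by (simp add: powr_minus field_simps)
  moreover have "cS * c / w1 + 1 \<le> T powr q"
  proof -
    have nn: "0 \<le> cS * c / w1 + 1" using cS c \<open>0 < w1\<close> by (auto intro!: add_nonneg_nonneg divide_nonneg_nonneg)
    then have "cS * c / w1 + 1 = ((cS * c / w1 + 1) powr (1 / q)) powr q" using q by (simp add: powr_powr)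
    also have "\<dots> \<le> T powr q" using q by (intro powr_mono2) (auto simp: T_def)
    finally show ?thesis .
  qed
  then have "w1 * (cS * c / w1 + 1) \<le> w1 * T powr q" using \<open>0 < w1\<close> by (intro mult_left_mono) auto
  ultimately show False using \<open>0 < w1\<close> by (simp add: distrib_left)
qed

lemma integral_powr_times_W:
  assumes p: "0 < p"
  shows "(\<integral>\<^sup>+s\<in>{0<..<T}. ennreal (s powr (- p - 1)) * W s \<partial>lborel)
      \<le> ennreal (1 / p) * (\<integral>\<^sup>+s\<in>{0<..<T}. ennreal (s powr (- p)) * u s \<partial>lborel)"
proof -
  define k where "k x = ennreal (x powr (- p - 1)) * indicator {0<..<T} x" for x
  define U where "U s = u s * indicator {0<..} s" for s
  have [measurable]: "k \<in> borel_measurable borel" "U \<in> borel_measurable borel"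
    unfolding k_def[abs_def] U_def[abs_def] by measurable
  have W_eq: "W x = (\<integral>\<^sup>+s\<in>{..<x}. U s \<partial>lborel)" for x
    unfolding W_def by (intro nn_integral_cong) (auto simp: U_def indicator_def)
  have "(\<integral>\<^sup>+s\<in>{0<..<T}. ennreal (s powr (- p - 1)) * W s \<partial>lborel) = (\<integral>\<^sup>+x. (\<integral>\<^sup>+s\<in>{..<x}. U s \<partial>lborel) * k x \<partial>lborel)"
    by (simp add: W_eq k_def mult_ac)
  also have "\<dots> = (\<integral>\<^sup>+s. U s * (\<integral>\<^sup>+x\<in>{s<..}. k x \<partial>lborel) \<partial>lborel)"
    by (rule nn_integral_triangle[symmetric]) auto
  also have "\<dots> \<le> (\<integral>\<^sup>+s. ennreal (1 / p) * (ennreal (s powr (- p)) * u s * indicator {0<..<T} s) \<partial>lborel)"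
  proof (intro nn_integral_mono)
    fix s
    show "U s * (\<integral>\<^sup>+x\<in>{s<..}. k x \<partial>lborel) \<le> ennreal (1 / p) * (ennreal (s powr (- p)) * u s * indicator {0<..<T} s)"
    proof (cases "s \<in> {0<..<T}")
      case True
      have "(\<integral>\<^sup>+x\<in>{s<..}. k x \<partial>lborel) \<le> (\<integral>\<^sup>+x\<in>{s<..}. ennreal (x powr (- p - 1)) \<partial>lborel)"
        by (intro nn_integral_mono) (auto simp: k_def indicator_def)
      also have "\<dots> = ennreal (1 / p) * ennreal (s powr (- p))"
        using True p by (subst nn_integral_powr_above) (auto simp: ennreal_mult[symmetric])
      finally have "U s * (\<integral>\<^sup>+x\<in>{s<..}. k x \<partial>lborel) \<le> U s * (ennreal (1 / p) * ennreal (s powr (- p)))"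
        by (intro mult_left_mono) auto
      then show ?thesis using True by (simp add: U_def mult_ac)
    next
      case False
      then have "(\<integral>\<^sup>+x\<in>{s<..}. k x \<partial>lborel) = (\<integral>\<^sup>+x. 0 \<partial>(lborel :: real measure))" if "0 < s"
        using that by (intro nn_integral_cong) (auto simp: k_def indicator_def)
      then show ?thesis by (cases "0 < s") (simp_all add: U_def)
    qed
  qed
  also have "\<dots> = ennreal (1 / p) * (\<integral>\<^sup>+s\<in>{0<..<T}. ennreal (s powr (- p)) * u s \<partial>lborel)"
    by (rule nn_integral_cmult) simp
  finally show ?thesis .
qed

text \<open>
  For \<open>p > 0\<close> the primitive of \<open>s powr (- p - 1)\<close> supplies the power of \<open>s\<close>. For \<open>p = 0\<close> it
  would be a logarithm; on \<open>(0, T)\<close> one trades \<open>1/s\<close> for \<open>T powr q\<close> times \<open>s powr (- q - 1)\<close> and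
  recovers the loss from \<open>B\<^sup>*\<^sub>q\<close>.
\<close>

lemma decreasing_times_W:
  assumes p: "0 \<le> p"
  shows "\<exists>C>0. \<forall>\<phi>. \<phi> \<in> borel_measurable borel \<longrightarrow> (\<forall>s t. 0 < s \<longrightarrow> s \<le> t \<longrightarrow> \<phi> t \<le> \<phi> s) \<longrightarrow>
    (\<integral>\<^sup>+s\<in>{0<..}. \<phi> s * (ennreal (s powr (- p - 1)) * W s) \<partial>lborel)
      \<le> ennreal C * (\<integral>\<^sup>+s\<in>{0<..}. \<phi> s * (ennreal (s powr (- p)) * u s) \<partial>lborel)"
proof -
  define C where "C = (if p = 0 then cS / q else 1 / p)"
  have C: "0 < C" using p cS q by (auto simp: C_def)
  have step: "(\<integral>\<^sup>+s\<in>{0<..<T}. ennreal (s powr (- p - 1)) * W s \<partial>lborel)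
      \<le> ennreal C * (\<integral>\<^sup>+s\<in>{0<..<T}. ennreal (s powr (- p)) * u s \<partial>lborel)" if T: "0 < T" for T
  proof (cases "p = 0")
    case False
    then show ?thesis using integral_powr_times_W[of p T] p by (simp add: C_def)
  next
    case True
    have "(\<integral>\<^sup>+s\<in>{0<..<T}. ennreal (s powr (- p - 1)) * W s \<partial>lborel)
        \<le> (\<integral>\<^sup>+s. ennreal (T powr q) * (ennreal (s powr (- q - 1)) * W s * indicator {0<..<T} s) \<partial>lborel)"
    proof (intro nn_integral_mono)
      fix s
      have "ennreal (s powr (- p - 1)) \<le> ennreal (T powr q) * ennreal (s powr (- q - 1))" if "0 < s" "s < T"
      proof -
        have "s powr (- p - 1) = s powr q * s powr (- q - 1)" using True by (simp add: powr_add[symmetric])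
        also have "\<dots> \<le> T powr q * s powr (- q - 1)" using that q by (intro mult_right_mono powr_mono2) auto
        finally show ?thesis by (simp add: ennreal_mult[symmetric])
      qed
      then show "ennreal (s powr (- p - 1)) * W s * indicator {0<..<T} s
        \<le> ennreal (T powr q) * (ennreal (s powr (- q - 1)) * W s * indicator {0<..<T} s)"
        by (auto simp: indicator_def mult.assoc[symmetric] intro!: mult_right_mono)
    qed
    also have "\<dots> = ennreal (T powr q) * (\<integral>\<^sup>+s\<in>{0<..<T}. ennreal (s powr (- q - 1)) * W s \<partial>lborel)"
      by (rule nn_integral_cmult) simp
    also have "\<dots> \<le> ennreal (T powr q) * (ennreal (1 / q) * (ennreal (cS * T powr (- q)) * W T))"
      by (intro mult_left_mono order_trans[OF integral_powr_times_W[OF q]] BS T) auto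
    also have "\<dots> = ennreal C * W T"
    proof -
      have "T powr q * (1 / q * (cS * T powr (- q))) = C" using T q True by (simp add: C_def powr_minus)
      then show ?thesis using cS q by (simp add: mult.assoc[symmetric] ennreal_mult[symmetric])
    qed
    also have "W T = (\<integral>\<^sup>+s\<in>{0<..<T}. ennreal (s powr (- p)) * u s \<partial>lborel)"
      unfolding W_def using True by (intro nn_integral_cong) (auto simp: indicator_def)
    finally show ?thesis .
  qed
  show ?thesis
    using C by (intro exI[of _ C] conjI allI impI nn_integral_decreasing_le step) auto
qed

text \<open>
  Common core of the two Hardy inequalities: \<open>S\<close> is the region \<open>s < t\<close> or \<open>t < s\<close>. Jensen's
  inequality with the power density of exponent \<open>\<beta> - 1\<close> moves the power \<open>r\<close> inside the integral;
  after Tonelli, the improved weight condition \<open>u_le\<close> turns the integral in \<open>t\<close> into \<open>W\<close>, and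
  the monotonicity of \<open>D\<close> removes \<open>W\<close> in favour of the weight.
\<close>

lemma hardy_general:
  fixes S :: "(real \<times> real) set" and a b \<beta> c :: real
  assumes S [measurable]: "S \<in> sets (borel \<Otimes>\<^sub>M borel)" and S_pos: "\<And>s t. (s, t) \<in> S \<Longrightarrow> 0 < s \<and> 0 < t"
    and ab: "b \<le> a" and \<beta>: "\<beta> \<noteq> 0" and c: "0 < c"
    and prob: "\<And>t. 0 < t \<Longrightarrow> (\<integral>\<^sup>+s\<in>{s. (s, t) \<in> S}. ennreal (\<bar>\<beta>\<bar> * t powr (- \<beta>) * s powr (\<beta> - 1)) \<partial>lborel) = 1"
    and u_le: "\<And>s. 0 < s \<Longrightarrow> (\<integral>\<^sup>+t\<in>{t. (s, t) \<in> S}. ennreal (t powr (\<beta> * (r - 1) - a * r)) * u t \<partial>lborel)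
       \<le> ennreal (c * s powr (\<beta> * (r - 1) - a * r)) * W s"
  shows "\<exists>C>0. \<forall>D. D \<in> borel_measurable borel \<longrightarrow> (\<forall>s t. 0 < s \<longrightarrow> s \<le> t \<longrightarrow> D t \<le> D s) \<longrightarrow>
    (\<integral>\<^sup>+t\<in>{0<..}. epowr (ennreal (t powr (- a)) * (\<integral>\<^sup>+s\<in>{s. (s, t) \<in> S}. ennreal (s powr (b - 1)) * D s \<partial>lborel)) r * u t \<partial>lborel)
      \<le> ennreal C * (\<integral>\<^sup>+t\<in>{0<..}. epowr (ennreal (t powr (b - a)) * D t) r * u t \<partial>lborel)"
proof -
  define e where "e = \<beta> * (r - 1)"
  define p where "p = (a - b) * r"
  have p: "0 \<le> p" using ab r by (simp add: p_def)
  have [measurable]: "{s. (s, t) \<in> S} \<in> sets borel" "{t. (s, t) \<in> S} \<in> sets borel" for s t by measurable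
  obtain C0 where C0: "0 < C0" and dec: "\<And>\<phi>. \<phi> \<in> borel_measurable borel \<Longrightarrow> (\<And>s t. 0 < s \<Longrightarrow> s \<le> t \<Longrightarrow> \<phi> t \<le> \<phi> s) \<Longrightarrow>
    (\<integral>\<^sup>+s\<in>{0<..}. \<phi> s * (ennreal (s powr (- p - 1)) * W s) \<partial>lborel)
      \<le> ennreal C0 * (\<integral>\<^sup>+s\<in>{0<..}. \<phi> s * (ennreal (s powr (- p)) * u s) \<partial>lborel)"
    using decreasing_times_W[OF p] by (elim exE conjE) (rule that, assumption, simp)
  define C1 where "C1 = \<bar>\<beta>\<bar> powr (1 - r)"
  have C1: "0 < C1" using \<beta> by (simp add: C1_def)
  have "(\<integral>\<^sup>+t\<in>{0<..}. epowr (ennreal (t powr (- a)) * (\<integral>\<^sup>+s\<in>{s. (s, t) \<in> S}. ennreal (s powr (b - 1)) * D s \<partial>lborel)) r * u t \<partial>lborel)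
      \<le> ennreal (C1 * (c * C0)) * (\<integral>\<^sup>+t\<in>{0<..}. epowr (ennreal (t powr (b - a)) * D t) r * u t \<partial>lborel)"
    if [measurable]: "D \<in> borel_measurable borel" and anti: "\<And>s t. 0 < s \<Longrightarrow> s \<le> t \<Longrightarrow> D t \<le> D s" for D
  proof -
    let ?E = "\<lambda>s. epowr (D s) r * ennreal (s powr (b * r - 1 - e))"
    let ?U = "\<lambda>t. ennreal (t powr (e - a * r)) * u t"
    have jensen: "epowr (ennreal (t powr (- a)) * (\<integral>\<^sup>+s\<in>{s. (s, t) \<in> S}. ennreal (s powr (b - 1)) * D s \<partial>lborel)) r
        \<le> ennreal (C1 * t powr (e - a * r)) * (\<integral>\<^sup>+s\<in>{s. (s, t) \<in> S}. ?E s \<partial>lborel)" if t: "0 < t" for t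
    proof -
      let ?k = "\<lambda>s. \<bar>\<beta>\<bar> * t powr (- \<beta>) * s powr (\<beta> - 1)"
      have "epowr (\<integral>\<^sup>+s\<in>{s. (s, t) \<in> S}. ennreal (s powr (b - 1)) * D s \<partial>lborel) r
        \<le> (\<integral>\<^sup>+s\<in>{s. (s, t) \<in> S}. epowr (ennreal (s powr (b - 1)) * D s) r * ennreal (?k s powr (1 - r)) \<partial>lborel)"
        using \<beta> t prob[OF t] r by (intro epowr_set_nn_integral_le) (auto dest: S_pos)
      also have "\<dots> = (\<integral>\<^sup>+s. ennreal (C1 * t powr e) * (?E s * indicator {s. (s, t) \<in> S} s) \<partial>lborel)"
      proof (intro nn_integral_cong)
        fix s
        have "ennreal ((s powr (b - 1)) powr r) * ennreal (?k s powr (1 - r)) = ennreal (C1 * t powr e) * ennreal (s powr (b * r - 1 - e))" if "0 < s"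
        proof -
          have "?k s powr (1 - r) = C1 * t powr (- \<beta> * (1 - r)) * s powr ((\<beta> - 1) * (1 - r))"
            using t that by (simp add: powr_mult powr_powr C1_def)
          moreover have "- \<beta> * (1 - r) = e" by (simp add: e_def algebra_simps)
          moreover have "s powr ((b - 1) * r) * s powr ((\<beta> - 1) * (1 - r)) = s powr (b * r - 1 - e)"
            by (simp add: powr_add[symmetric] e_def algebra_simps)
          ultimately show ?thesis using C1 by (simp add: powr_powr ennreal_mult[symmetric])
        qed
        then show "epowr (ennreal (s powr (b - 1)) * D s) r * ennreal (?k s powr (1 - r)) * indicator {s. (s, t) \<in> S} s
          = ennreal (C1 * t powr e) * (?E s * indicator {s. (s, t) \<in> S} s)"
          using S_pos[of s t] r
          by (auto simp: indicator_def epowr_mult mult.assoc[symmetric]) (simp add: mult_ac)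
      qed
      also have "\<dots> = ennreal (C1 * t powr e) * (\<integral>\<^sup>+s\<in>{s. (s, t) \<in> S}. ?E s \<partial>lborel)"
        by (rule nn_integral_cmult) simp
      finally have "epowr (ennreal (t powr (- a))) r * epowr (\<integral>\<^sup>+s\<in>{s. (s, t) \<in> S}. ennreal (s powr (b - 1)) * D s \<partial>lborel) r
        \<le> ennreal (t powr (- a * r)) * (ennreal (C1 * t powr e) * (\<integral>\<^sup>+s\<in>{s. (s, t) \<in> S}. ?E s \<partial>lborel))"
        by (intro mult_mono) (auto simp: powr_powr)
      then show ?thesis using r C1 ennreal_powr_mult[of C1 t "- a * r" e] by (simp add: epowr_mult)
    qed
    have "(\<integral>\<^sup>+t\<in>{0<..}. epowr (ennreal (t powr (- a)) * (\<integral>\<^sup>+s\<in>{s. (s, t) \<in> S}. ennreal (s powr (b - 1)) * D s \<partial>lborel)) r * u t \<partial>lborel)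
       \<le> (\<integral>\<^sup>+t. (\<integral>\<^sup>+s. ennreal C1 * (?E s * ?U t * indicator S (s, t)) \<partial>lborel) \<partial>lborel)"
    proof (intro nn_integral_mono)
      fix t :: real
      have "(\<integral>\<^sup>+s. ennreal C1 * (?E s * ?U t * indicator S (s, t)) \<partial>lborel)
          = (\<integral>\<^sup>+s. ennreal (C1 * t powr (e - a * r)) * u t * (?E s * indicator {s. (s, t) \<in> S} s) \<partial>lborel)"
        using C1 by (intro nn_integral_cong) (simp add: indicator_def ennreal_mult mult_ac)
      also have "\<dots> = ennreal (C1 * t powr (e - a * r)) * u t * (\<integral>\<^sup>+s\<in>{s. (s, t) \<in> S}. ?E s \<partial>lborel)"
        by (rule nn_integral_cmult) simp
      finally show "epowr (ennreal (t powr (- a)) * (\<integral>\<^sup>+s\<in>{s. (s, t) \<in> S}. ennreal (s powr (b - 1)) * D s \<partial>lborel)) r * u t * indicator {0<..} t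
        \<le> (\<integral>\<^sup>+s. ennreal C1 * (?E s * ?U t * indicator S (s, t)) \<partial>lborel)"
        using mult_right_mono[OF jensen[of t], of "u t"] by (cases "0 < t") (auto simp: mult_ac)
    qed
    also have "\<dots> = (\<integral>\<^sup>+s. (\<integral>\<^sup>+t. ennreal C1 * (?E s * ?U t * indicator S (s, t)) \<partial>lborel) \<partial>lborel)"
      by (rule lborel_pair.Fubini') measurable
    also have "\<dots> \<le> (\<integral>\<^sup>+s. ennreal (C1 * c) * (epowr (D s) r * (ennreal (s powr (- p - 1)) * W s) * indicator {0<..} s) \<partial>lborel)"
    proof (intro nn_integral_mono)
      fix s :: real
      have "(\<integral>\<^sup>+t. ennreal C1 * (?E s * ?U t * indicator S (s, t)) \<partial>lborel)
          = (\<integral>\<^sup>+t. ennreal C1 * ?E s * (?U t * indicator {t. (s, t) \<in> S} t) \<partial>lborel)"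
        by (intro nn_integral_cong) (simp add: indicator_def mult_ac)
      also have "\<dots> = ennreal C1 * ?E s * (\<integral>\<^sup>+t\<in>{t. (s, t) \<in> S}. ?U t \<partial>lborel)" by (rule nn_integral_cmult) simp
      also have "\<dots> \<le> ennreal (C1 * c) * (epowr (D s) r * (ennreal (s powr (- p - 1)) * W s) * indicator {0<..} s)"
      proof (cases "0 < s")
        case True
        have "ennreal C1 * ?E s * (\<integral>\<^sup>+t\<in>{t. (s, t) \<in> S}. ?U t \<partial>lborel) \<le> ennreal C1 * ?E s * (ennreal (c * s powr (e - a * r)) * W s)"
          using u_le[OF True] by (intro mult_left_mono) (auto simp: e_def)
        also have "\<dots> = ennreal C1 * epowr (D s) r * (ennreal (s powr (b * r - 1 - e)) * (ennreal (c * s powr (e - a * r)) * W s))"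
          by (simp only: mult.assoc)
        also have "ennreal (s powr (b * r - 1 - e)) * (ennreal (c * s powr (e - a * r)) * W s) = ennreal (c * s powr (- p - 1)) * W s"
          using c by (subst ennreal_powr_mult) (auto simp: p_def algebra_simps)
        finally show ?thesis using True C1 c by (simp add: ennreal_mult mult_ac)
      next
        case False
        then have "{t. (s, t) \<in> S} = {}" using S_pos by auto
        then show ?thesis by simp
      qed
      finally show "(\<integral>\<^sup>+t. ennreal C1 * (?E s * ?U t * indicator S (s, t)) \<partial>lborel)
        \<le> ennreal (C1 * c) * (epowr (D s) r * (ennreal (s powr (- p - 1)) * W s) * indicator {0<..} s)" .
    qed
    also have "\<dots> = ennreal (C1 * c) * (\<integral>\<^sup>+s\<in>{0<..}. epowr (D s) r * (ennreal (s powr (- p - 1)) * W s) \<partial>lborel)"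
      by (rule nn_integral_cmult) simp
    also have "\<dots> \<le> ennreal (C1 * c) * (ennreal C0 * (\<integral>\<^sup>+s\<in>{0<..}. epowr (D s) r * (ennreal (s powr (- p)) * u s) \<partial>lborel))"
      using anti r by (intro mult_left_mono dec) (auto intro!: epowr_mono)
    also have "(\<integral>\<^sup>+s\<in>{0<..}. epowr (D s) r * (ennreal (s powr (- p)) * u s) \<partial>lborel)
        = (\<integral>\<^sup>+t\<in>{0<..}. epowr (ennreal (t powr (b - a)) * D t) r * u t \<partial>lborel)"
    proof (intro nn_integral_cong)
      fix s
      have "(b - a) * r = - p" by (simp add: p_def algebra_simps)
      then show "epowr (D s) r * (ennreal (s powr (- p)) * u s) * indicator {0<..} s
         = epowr (ennreal (s powr (b - a)) * D s) r * u s * indicator {0<..} s"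
        using r by (simp add: epowr_mult powr_powr mult_ac)
    qed
    finally show ?thesis using C1 C0 c by (simp add: ennreal_mult mult.assoc)
  qed
  then show ?thesis using C1 C0 c by (intro exI[of _ "C1 * (c * C0)"]) auto
qed

theorem hardy_average:
  "\<exists>C>0. \<forall>D. D \<in> borel_measurable borel \<longrightarrow> (\<forall>s t. 0 < s \<longrightarrow> s \<le> t \<longrightarrow> D t \<le> D s) \<longrightarrow>
    (\<integral>\<^sup>+t\<in>{0<..}. epowr (ennreal (1 / t) * (\<integral>\<^sup>+s\<in>{0<..<t}. D s \<partial>lborel)) r * u t \<partial>lborel)
      \<le> ennreal C * (\<integral>\<^sup>+t\<in>{0<..}. epowr (D t) r * u t \<partial>lborel)"
proof -
  obtain \<epsilon> c where \<epsilon>: "0 < \<epsilon>" "\<epsilon> < r - 1" "0 < c"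
    and imp: "\<And>t. 0 < t \<Longrightarrow> (\<integral>\<^sup>+s\<in>{t<..}. ennreal (s powr (\<epsilon> - r)) * u s \<partial>lborel) \<le> ennreal (c * t powr (\<epsilon> - r)) * W t"
    using B_self_improve by blast
  define \<beta> where "\<beta> = \<epsilon> / (r - 1)"
  have \<beta>: "0 < \<beta>" "\<beta> * (r - 1) = \<epsilon>" using \<epsilon> r by (auto simp: \<beta>_def)
  define S where "S = {(s, t). 0 < s \<and> s < (t::real)}"
  have sec: "{s. (s, t) \<in> S} = {0<..<t}" "0 < t \<Longrightarrow> {x. (t, x) \<in> S} = {t<..}" for t by (auto simp: S_def)
  have "\<exists>C>0. \<forall>D. D \<in> borel_measurable borel \<longrightarrow> (\<forall>s t. 0 < s \<longrightarrow> s \<le> t \<longrightarrow> D t \<le> D s) \<longrightarrow>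
    (\<integral>\<^sup>+t\<in>{0<..}. epowr (ennreal (t powr (- 1)) * (\<integral>\<^sup>+s\<in>{s. (s, t) \<in> S}. ennreal (s powr (1 - 1)) * D s \<partial>lborel)) r * u t \<partial>lborel)
      \<le> ennreal C * (\<integral>\<^sup>+t\<in>{0<..}. epowr (ennreal (t powr (1 - 1)) * D t) r * u t \<partial>lborel)"
  proof (rule hardy_general[where \<beta> = \<beta> and c = c])
    have "S = {p \<in> space (borel \<Otimes>\<^sub>M borel). 0 < fst p \<and> fst p < snd p}" by (auto simp: S_def space_pair_measure)
    also have "\<dots> \<in> sets (borel \<Otimes>\<^sub>M borel)" by measurable
    finally show "S \<in> sets (borel \<Otimes>\<^sub>M borel)" .
    show "(\<integral>\<^sup>+s\<in>{s. (s, t) \<in> S}. ennreal (\<bar>\<beta>\<bar> * t powr (- \<beta>) * s powr (\<beta> - 1)) \<partial>lborel) = 1" if t: "0 < t" for t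
    proof -
      have "(\<integral>\<^sup>+s\<in>{0<..<t}. ennreal (\<bar>\<beta>\<bar> * t powr (- \<beta>) * s powr (\<beta> - 1)) \<partial>lborel)
          = (\<integral>\<^sup>+s. ennreal (\<beta> * t powr (- \<beta>)) * (ennreal (s powr (\<beta> - 1)) * indicator {0<..<t} s) \<partial>lborel)"
        using \<beta> by (intro nn_integral_cong) (simp add: ennreal_mult mult_ac)
      also have "\<dots> = ennreal (\<beta> * t powr (- \<beta>)) * ennreal (t powr \<beta> / \<beta>)"
        using t \<beta> by (subst nn_integral_cmult) (auto simp: nn_integral_powr_below)
      also have "\<dots> = 1" using t \<beta> by (simp add: ennreal_mult[symmetric] powr_add[symmetric])
      finally show ?thesis by (simp add: sec)
    qed
    show "(\<integral>\<^sup>+t\<in>{t. (s, t) \<in> S}. ennreal (t powr (\<beta> * (r - 1) - 1 * r)) * u t \<partial>lborel)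
       \<le> ennreal (c * s powr (\<beta> * (r - 1) - 1 * r)) * W s" if "0 < s" for s
      using imp[OF that] that by (simp add: sec \<beta>)
  qed (use \<beta> \<epsilon> in \<open>auto simp: S_def\<close>)
  moreover have "(\<integral>\<^sup>+t\<in>{0<..}. epowr (ennreal (t powr (- 1)) * (\<integral>\<^sup>+s\<in>{s. (s, t) \<in> S}. ennreal (s powr (1 - 1)) * D s \<partial>lborel)) r * u t \<partial>lborel)
     = (\<integral>\<^sup>+t\<in>{0<..}. epowr (ennreal (1 / t) * (\<integral>\<^sup>+s\<in>{0<..<t}. D s \<partial>lborel)) r * u t \<partial>lborel)" for D
  proof (intro nn_integral_cong)
    fix t :: real
    have "(\<integral>\<^sup>+s\<in>{0<..<t}. ennreal (s powr (1 - 1)) * D s \<partial>lborel) = (\<integral>\<^sup>+s\<in>{0<..<t}. D s \<partial>lborel)"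
      by (intro nn_integral_cong) (auto simp: indicator_def)
    then show "epowr (ennreal (t powr (- 1)) * (\<integral>\<^sup>+s\<in>{s. (s, t) \<in> S}. ennreal (s powr (1 - 1)) * D s \<partial>lborel)) r * u t * indicator {0<..} t
      = epowr (ennreal (1 / t) * (\<integral>\<^sup>+s\<in>{0<..<t}. D s \<partial>lborel)) r * u t * indicator {0<..} t"
      unfolding sec by (cases "0 < t") (auto simp: powr_minus_divide)
  qed
  moreover have "(\<integral>\<^sup>+t\<in>{0<..}. epowr (ennreal (t powr (1 - 1)) * D t) r * u t \<partial>lborel) = (\<integral>\<^sup>+t\<in>{0<..}. epowr (D t) r * u t \<partial>lborel)" for D
    by (intro nn_integral_cong) (auto simp: indicator_def)
  ultimately show ?thesis by simp
qed

theorem hardy_tail: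
  assumes b: "b \<le> a" and a: "a * r \<le> q"
  shows "\<exists>C>0. \<forall>D. D \<in> borel_measurable borel \<longrightarrow> (\<forall>s t. 0 < s \<longrightarrow> s \<le> t \<longrightarrow> D t \<le> D s) \<longrightarrow>
    (\<integral>\<^sup>+t\<in>{0<..}. epowr (ennreal (t powr (- a)) * (\<integral>\<^sup>+s\<in>{t<..}. ennreal (s powr (b - 1)) * D s \<partial>lborel)) r * u t \<partial>lborel)
      \<le> ennreal C * (\<integral>\<^sup>+t\<in>{0<..}. epowr (ennreal (t powr (b - a)) * D t) r * u t \<partial>lborel)"
proof -
  obtain \<delta> c where \<delta>: "0 < \<delta>" "0 < c"
    and imp': "\<And>t. 0 < t \<Longrightarrow> (\<integral>\<^sup>+s\<in>{0<..<t}. ennreal (s powr (- q - \<delta>)) * u s \<partial>lborel) \<le> ennreal (c * t powr (- q - \<delta>)) * W t"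
    using BS_self_improve by blast
  have imp: "(\<integral>\<^sup>+s\<in>{0<..<t}. ennreal (s powr (- \<delta> - a * r)) * u s \<partial>lborel) \<le> ennreal (c * t powr (- \<delta> - a * r)) * W t"
    if t: "0 < t" for t
  proof -
    have "(\<integral>\<^sup>+s\<in>{0<..<t}. ennreal (s powr (- \<delta> - a * r)) * u s \<partial>lborel)
        \<le> (\<integral>\<^sup>+s. ennreal (t powr (q - a * r)) * (ennreal (s powr (- q - \<delta>)) * u s * indicator {0<..<t} s) \<partial>lborel)"
    proof (intro nn_integral_mono)
      fix s
      have "ennreal (s powr (- \<delta> - a * r)) \<le> ennreal (t powr (q - a * r)) * ennreal (s powr (- q - \<delta>))" if "0 < s" "s < t"
      proof -
        have "s powr (- \<delta> - a * r) = s powr (q - a * r) * s powr (- q - \<delta>)" by (simp add: powr_add[symmetric] algebra_simps)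
        also have "\<dots> \<le> t powr (q - a * r) * s powr (- q - \<delta>)" using that a by (intro mult_right_mono powr_mono2) auto
        finally show ?thesis by (simp add: ennreal_mult[symmetric])
      qed
      then show "ennreal (s powr (- \<delta> - a * r)) * u s * indicator {0<..<t} s
        \<le> ennreal (t powr (q - a * r)) * (ennreal (s powr (- q - \<delta>)) * u s * indicator {0<..<t} s)"
        by (auto simp: indicator_def mult.assoc[symmetric] intro!: mult_right_mono)
    qed
    also have "\<dots> = ennreal (t powr (q - a * r)) * (\<integral>\<^sup>+s\<in>{0<..<t}. ennreal (s powr (- q - \<delta>)) * u s \<partial>lborel)"
      by (rule nn_integral_cmult) simp
    also have "\<dots> \<le> ennreal (t powr (q - a * r)) * (ennreal (c * t powr (- q - \<delta>)) * W t)"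
      by (intro mult_left_mono imp' t) auto
    also have "\<dots> = ennreal (c * t powr (q - a * r + (- q - \<delta>))) * W t"
      using \<delta> by (intro ennreal_powr_mult) auto
    also have "q - a * r + (- q - \<delta>) = - \<delta> - a * r" by simp
    finally show ?thesis .
  qed
  define d where "d = \<delta> / (r - 1)"
  have d: "0 < d" "d * (r - 1) = \<delta>" using \<delta> r by (auto simp: d_def)
  define S where "S = {(s, t). 0 < t \<and> t < (s::real)}"
  have sec: "0 < t \<Longrightarrow> {s. (s, t) \<in> S} = {t<..}" "{x. (t, x) \<in> S} = {0<..<t}" for t by (auto simp: S_def)
  have "\<exists>C>0. \<forall>D. D \<in> borel_measurable borel \<longrightarrow> (\<forall>s t. 0 < s \<longrightarrow> s \<le> t \<longrightarrow> D t \<le> D s) \<longrightarrow>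
    (\<integral>\<^sup>+t\<in>{0<..}. epowr (ennreal (t powr (- a)) * (\<integral>\<^sup>+s\<in>{s. (s, t) \<in> S}. ennreal (s powr (b - 1)) * D s \<partial>lborel)) r * u t \<partial>lborel)
      \<le> ennreal C * (\<integral>\<^sup>+t\<in>{0<..}. epowr (ennreal (t powr (b - a)) * D t) r * u t \<partial>lborel)"
  proof (rule hardy_general[where \<beta> = "- d" and c = c])
    have "S = {p \<in> space (borel \<Otimes>\<^sub>M borel). 0 < snd p \<and> snd p < fst p}" by (auto simp: S_def space_pair_measure)
    also have "\<dots> \<in> sets (borel \<Otimes>\<^sub>M borel)" by measurable
    finally show "S \<in> sets (borel \<Otimes>\<^sub>M borel)" .
    show "(\<integral>\<^sup>+s\<in>{s. (s, t) \<in> S}. ennreal (\<bar>- d\<bar> * t powr (- (- d)) * s powr (- d - 1)) \<partial>lborel) = 1" if t: "0 < t" for t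
    proof -
      have "(\<integral>\<^sup>+s\<in>{t<..}. ennreal (\<bar>- d\<bar> * t powr (- (- d)) * s powr (- d - 1)) \<partial>lborel)
          = (\<integral>\<^sup>+s. ennreal (d * t powr d) * (ennreal (s powr (- d - 1)) * indicator {t<..} s) \<partial>lborel)"
        using d by (intro nn_integral_cong) (simp add: ennreal_mult mult_ac)
      also have "\<dots> = ennreal (d * t powr d) * ennreal (t powr (- d) / d)"
        using t d by (subst nn_integral_cmult) (auto simp: nn_integral_powr_above)
      also have "\<dots> = 1" using t d by (simp add: ennreal_mult[symmetric] powr_add[symmetric])
      finally show ?thesis using t by (simp add: sec)
    qed
    show "(\<integral>\<^sup>+t\<in>{t. (s, t) \<in> S}. ennreal (t powr (- d * (r - 1) - a * r)) * u t \<partial>lborel)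
       \<le> ennreal (c * s powr (- d * (r - 1) - a * r)) * W s" if "0 < s" for s
      using imp[OF that] by (simp add: sec d)
  qed (use d \<delta> b in \<open>auto simp: S_def\<close>)
  moreover have "(\<integral>\<^sup>+t\<in>{0<..}. epowr (ennreal (t powr (- a)) * (\<integral>\<^sup>+s\<in>{s. (s, t) \<in> S}. ennreal (s powr (b - 1)) * D s \<partial>lborel)) r * u t \<partial>lborel)
     = (\<integral>\<^sup>+t\<in>{0<..}. epowr (ennreal (t powr (- a)) * (\<integral>\<^sup>+s\<in>{t<..}. ennreal (s powr (b - 1)) * D s \<partial>lborel)) r * u t \<partial>lborel)" for D
  proof (intro nn_integral_cong)
    fix t :: real
    show "epowr (ennreal (t powr (- a)) * (\<integral>\<^sup>+s\<in>{s. (s, t) \<in> S}. ennreal (s powr (b - 1)) * D s \<partial>lborel)) r * u t * indicator {0<..} t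
      = epowr (ennreal (t powr (- a)) * (\<integral>\<^sup>+s\<in>{t<..}. ennreal (s powr (b - 1)) * D s \<partial>lborel)) r * u t * indicator {0<..} t"
      by (cases "0 < t") (simp_all add: sec)
  qed
  ultimately show ?thesis by simp
qed

end

section \<open>Rearrangements and their averages\<close>

definition distrib :: "(real ^ 'n::finite \<Rightarrow> real) \<Rightarrow> ennreal \<Rightarrow> ennreal" where
  "distrib f y = emeasure lebesgue {x. y < ennreal \<bar>f x\<bar>}"

lemma sets_superlevel [measurable]:
  fixes f :: "real ^ 'n::finite \<Rightarrow> real"
  assumes [measurable]: "f \<in> borel_measurable lebesgue"
  shows "{x. y < ennreal \<bar>f x\<bar>} \<in> sets lebesgue"
proof -
  have "{x \<in> space lebesgue. y < ennreal \<bar>f x\<bar>} \<in> sets lebesgue" by measurable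
  then show ?thesis by simp
qed

lemma distrib_antimono:
  assumes "f \<in> borel_measurable lebesgue" "y \<le> z"
  shows "distrib f z \<le> distrib f y"
  unfolding distrib_def using assms by (intro emeasure_mono sets_superlevel) auto

lemma rearr_alt: "rearr f t = Inf {y. distrib f y \<le> ennreal t}"
  unfolding rearr_def distrib_def ..

text \<open>
  The infimum that defines the rearrangement is attained: superlevel sets are continuous from
  below.
\<close>

lemma distrib_rearr_le:
  assumes f: "f \<in> borel_measurable lebesgue"
  shows "distrib f (rearr f t) \<le> ennreal t"
proof -
  define Y where "Y = {y. distrib f y \<le> ennreal t}"
  have "top \<in> Y" by (simp add: Y_def distrib_def)
  then have "Y \<noteq> {}" by auto
  then obtain g :: "nat \<Rightarrow> ennreal" where g: "decseq g" "range g \<subseteq> Y" "Inf Y = (INF n. g n)"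
    using ennreal_Inf_countable_INF[of Y] by auto
  have "{x. rearr f t < ennreal \<bar>f x\<bar>} = (\<Union>n. {x. g n < ennreal \<bar>f x\<bar>})"
    using g(3) by (auto simp: rearr_alt Y_def[symmetric] INF_less_iff)
  then have "distrib f (rearr f t) = emeasure lebesgue (\<Union>n. {x. g n < ennreal \<bar>f x\<bar>})"
    by (simp add: distrib_def)
  also have "\<dots> = (SUP n. emeasure lebesgue {x. g n < ennreal \<bar>f x\<bar>})"
  proof (rule SUP_emeasure_incseq[symmetric])
    show "range (\<lambda>n. {x. g n < ennreal \<bar>f x\<bar>}) \<subseteq> sets lebesgue" using f by auto
    show "incseq (\<lambda>n. {x. g n < ennreal \<bar>f x\<bar>})"
      using g(1) by (auto simp: incseq_def decseq_def intro: le_less_trans)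
  qed
  also have "\<dots> \<le> ennreal t"
    using g(2) by (intro SUP_least) (auto simp: Y_def distrib_def image_subset_iff)
  finally show ?thesis .
qed

lemma rearr_le_iff:
  assumes f: "f \<in> borel_measurable lebesgue"
  shows "rearr f t \<le> y \<longleftrightarrow> distrib f y \<le> ennreal t"
proof
  assume "rearr f t \<le> y"
  then show "distrib f y \<le> ennreal t"
    using distrib_antimono[OF f] distrib_rearr_le[OF f] order_trans by blast
next
  assume "distrib f y \<le> ennreal t"
  then show "rearr f t \<le> y" unfolding rearr_alt by (intro Inf_lower) auto
qed

lemma less_rearr_iff:
  assumes f: "f \<in> borel_measurable lebesgue"
  shows "y < rearr f t \<longleftrightarrow> ennreal t < distrib f y"
  using rearr_le_iff[OF f] by (meson not_le)

lemma rearr_antimono: "s \<le> t \<Longrightarrow> rearr f t \<le> rearr f s"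
  unfolding rearr_alt by (intro Inf_superset_mono) (auto intro: order_trans ennreal_leI)

lemma rearr_measurable [measurable]:
  assumes f: "f \<in> borel_measurable lebesgue"
  shows "rearr f \<in> borel_measurable borel"
proof (rule borel_measurableI_greater)
  fix y
  have "{t. y < rearr f t} = {t. ennreal t < distrib f y}" using less_rearr_iff[OF f] by auto
  also have "\<dots> \<in> sets borel" by measurable
  finally show "{x \<in> space borel. y < rearr f x} \<in> sets borel" by simp
qed

lemma distrib_cong_AE:
  assumes "AE x in lebesgue. \<bar>f x\<bar> = \<bar>g x\<bar>" and f: "f \<in> borel_measurable lebesgue" and g: "g \<in> borel_measurable lebesgue"
  shows "distrib f = distrib g"
  unfolding distrib_def using assms(1) sets_superlevel[OF f] sets_superlevel[OF g]
  by (intro ext emeasure_eq_AE) auto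

lemma rearr_cong_AE:
  assumes "AE x in lebesgue. \<bar>f x\<bar> = \<bar>g x\<bar>" and f: "f \<in> borel_measurable lebesgue" and g: "g \<in> borel_measurable lebesgue"
  shows "rearr f = rearr g"
  unfolding rearr_alt[abs_def] distrib_cong_AE[OF assms] ..

lemma rearr_add_le:
  assumes f [measurable]: "f \<in> borel_measurable lebesgue" and g [measurable]: "g \<in> borel_measurable lebesgue"
    and "0 \<le> s" "0 \<le> t"
  shows "rearr (\<lambda>x. f x + g x) (s + t) \<le> rearr f s + rearr g t"
proof -
  let ?y = "rearr f s" and ?z = "rearr g t"
  have "distrib (\<lambda>x. f x + g x) (?y + ?z) \<le> emeasure lebesgue ({x. ?y < ennreal \<bar>f x\<bar>} \<union> {x. ?z < ennreal \<bar>g x\<bar>})"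
    unfolding distrib_def
  proof (intro emeasure_mono subsetI)
    fix x assume "x \<in> {x. ?y + ?z < ennreal \<bar>f x + g x\<bar>}"
    moreover have "ennreal \<bar>f x + g x\<bar> \<le> ennreal \<bar>f x\<bar> + ennreal \<bar>g x\<bar>"
      by (simp add: ennreal_plus[symmetric] abs_triangle_ineq del: ennreal_plus)
    ultimately have "?y + ?z < ennreal \<bar>f x\<bar> + ennreal \<bar>g x\<bar>" by auto
    then have "?y < ennreal \<bar>f x\<bar> \<or> ?z < ennreal \<bar>g x\<bar>" by (meson add_mono leD not_le)
    then show "x \<in> {x. ?y < ennreal \<bar>f x\<bar>} \<union> {x. ?z < ennreal \<bar>g x\<bar>}" by auto
  qed measurable
  also have "\<dots> \<le> distrib f ?y + distrib g ?z"
    unfolding distrib_def by (intro emeasure_subadditive sets_superlevel f g)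
  also have "\<dots> \<le> ennreal s + ennreal t" by (intro add_mono distrib_rearr_le f g)
  also have "\<dots> = ennreal (s + t)" using assms by simp
  finally show ?thesis by (subst rearr_le_iff) auto
qed

lemma rearr_uminus: "rearr (\<lambda>x. - f x) = rearr f"
  unfolding rearr_def[abs_def] by simp

text \<open>
  The integral of the part of \<open>|f|\<close> above the height \<open>y\<close>. The expression \<open>excess f y + y t\<close>,
  minimised over \<open>y\<close>, is \<open>t f\<^sup>*\<^sup>*(t)\<close>; this variational form makes subadditivity of \<open>f\<^sup>*\<^sup>*\<close>
  visible.
\<close>

definition excess :: "(real ^ 'n::finite \<Rightarrow> real) \<Rightarrow> real \<Rightarrow> ennreal" where
  "excess f y = (\<integral>\<^sup>+x. ennreal (\<bar>f x\<bar> - y) \<partial>lebesgue)"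

lemma excess_eq:
  fixes f :: "real ^ 'n::finite \<Rightarrow> real"
  assumes f: "f \<in> borel_measurable lebesgue" and y: "0 \<le> y"
  shows "excess f y = (\<integral>\<^sup>+z\<in>{y<..}. distrib f (ennreal z) \<partial>lborel)"
proof -
  obtain g where g [measurable]: "g \<in> borel_measurable lborel" and fg: "AE x in lborel. f x = g x"
    using completion_ex_borel_measurable_real[of f lborel] f by auto
  have g' [measurable]: "g \<in> borel_measurable lebesgue" using g by (rule measurable_completion)
  have "distrib f = distrib g"
    using f g' AE_completion[OF fg] by (intro distrib_cong_AE) auto
  have "excess f y = (\<integral>\<^sup>+x. ennreal (\<bar>g x\<bar> - y) \<partial>lborel)"
    unfolding excess_def nn_integral_completion using fg by (intro nn_integral_cong_AE) auto
  also have "\<dots> = (\<integral>\<^sup>+x. (\<integral>\<^sup>+z. indicator {y<..} z * indicator {z. z < \<bar>g x\<bar>} z \<partial>lborel) \<partial>lborel)"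
  proof (intro nn_integral_cong)
    fix x
    have "(\<integral>\<^sup>+z. indicator {y<..} z * indicator {z. z < \<bar>g x\<bar>} z \<partial>lborel) = (\<integral>\<^sup>+z. indicator {y<..<\<bar>g x\<bar>} z \<partial>lborel)"
      by (intro nn_integral_cong) (auto simp: indicator_def)
    then show "ennreal (\<bar>g x\<bar> - y) = (\<integral>\<^sup>+z. indicator {y<..} z * indicator {z. z < \<bar>g x\<bar>} z \<partial>lborel)"
      by (cases "y \<le> \<bar>g x\<bar>") (auto simp: ennreal_neg)
  qed
  also have "\<dots> = (\<integral>\<^sup>+z. (\<integral>\<^sup>+x. indicator {y<..} z * indicator {z. z < \<bar>g x\<bar>} z \<partial>lborel) \<partial>lborel)"
    by (rule lborel_pair.Fubini') (simp add: indicator_def[abs_def])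
  also have "\<dots> = (\<integral>\<^sup>+z\<in>{y<..}. distrib g (ennreal z) \<partial>lborel)"
  proof (intro nn_integral_cong)
    fix z :: real
    have "(\<integral>\<^sup>+x. indicator {y<..} z * indicator {z. z < \<bar>g x\<bar>} z \<partial>lborel) = indicator {y<..} z * (\<integral>\<^sup>+x. indicator {x. z < \<bar>g x\<bar>} x \<partial>lborel)"
      by (subst nn_integral_cmult[symmetric]) (auto intro!: nn_integral_cong simp: indicator_def)
    also have "\<dots> = indicator {y<..} z * emeasure lebesgue {x. z < \<bar>g x\<bar>}"
      by simp
    also have "\<dots> = distrib g (ennreal z) * indicator {y<..} z"
      using y by (cases "y < z") (auto simp: distrib_def ennreal_less_iff)
    finally show "(\<integral>\<^sup>+x. indicator {y<..} z * indicator {z. z < \<bar>g x\<bar>} z \<partial>lborel) = distrib g (ennreal z) * indicator {y<..} z" .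
  qed
  finally show ?thesis using \<open>distrib f = distrib g\<close> by simp
qed

text \<open>
  Both sides are the area below the graph of the rearrangement over \<open>(0, t)\<close>: at height \<open>z\<close> it
  has width \<open>min t (distrib f z)\<close>.
\<close>

lemma nn_integral_rearr:
  fixes f :: "real ^ 'n::finite \<Rightarrow> real"
  assumes f [measurable]: "f \<in> borel_measurable lebesgue" and t: "0 < t"
  shows "(\<integral>\<^sup>+s\<in>{0<..<t}. rearr f s \<partial>lborel) = (\<integral>\<^sup>+z\<in>{0<..}. min (ennreal t) (distrib f (ennreal z)) \<partial>lborel)"
proof -
  have cake: "a = (\<integral>\<^sup>+z. indicator {z. 0 < z \<and> ennreal z < a} z \<partial>lborel)" for a
  proof (cases a)
    case (real b)
    then have "{z. 0 < z \<and> ennreal z < a} = {0<..<b}" by (auto simp: ennreal_less_iff)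
    then show ?thesis using real by simp
  next
    case top
    then have "{z::real. 0 < z \<and> ennreal z < a} = {0<..}" by auto
    then show ?thesis using top by (simp add: emeasure_lborel_greaterThan)
  qed
  have "(\<integral>\<^sup>+s\<in>{0<..<t}. rearr f s \<partial>lborel)
      = (\<integral>\<^sup>+s. (\<integral>\<^sup>+z. indicator {z. 0 < z \<and> ennreal z < rearr f s} z * indicator {0<..<t} s \<partial>lborel) \<partial>lborel)"
    by (intro nn_integral_cong, subst nn_integral_multc) (auto simp: cake[symmetric])
  also have "\<dots> = (\<integral>\<^sup>+z. (\<integral>\<^sup>+s. indicator {z. 0 < z \<and> ennreal z < rearr f s} z * indicator {0<..<t} s \<partial>lborel) \<partial>lborel)"
    by (rule lborel_pair.Fubini') (simp add: indicator_def[abs_def])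
  also have "\<dots> = (\<integral>\<^sup>+z\<in>{0<..}. min (ennreal t) (distrib f (ennreal z)) \<partial>lborel)"
  proof (intro nn_integral_cong)
    fix z :: real
    have "(\<integral>\<^sup>+s. indicator {z. 0 < z \<and> ennreal z < rearr f s} z * indicator {0<..<t} s \<partial>lborel)
       = (\<integral>\<^sup>+s. indicator {s. 0 < s \<and> s < t \<and> ennreal s < distrib f (ennreal z)} s * indicator {0<..} z \<partial>lborel)"
      by (intro nn_integral_cong) (auto simp: indicator_def less_rearr_iff)
    also have "\<dots> = min (ennreal t) (distrib f (ennreal z)) * indicator {0<..} z"
    proof (cases "distrib f (ennreal z)")
      case (real b)
      then have "{s. 0 < s \<and> s < t \<and> ennreal s < distrib f (ennreal z)} = {0<..<min t b}"
        by (auto simp: ennreal_less_iff)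
      then show ?thesis using real t by (simp add: nn_integral_multc min_def ennreal_le_iff)
    next
      case top
      then have "{s. 0 < s \<and> s < t \<and> ennreal s < distrib f (ennreal z)} = {0<..<t}" by auto
      then show ?thesis using top t by (simp add: nn_integral_multc)
    qed
    finally show "(\<integral>\<^sup>+s. indicator {z. 0 < z \<and> ennreal z < rearr f s} z * indicator {0<..<t} s \<partial>lborel)
      = min (ennreal t) (distrib f (ennreal z)) * indicator {0<..} z" .
  qed
  finally show ?thesis .
qed

text \<open>The set where \<open>distrib f\<close> exceeds \<open>t\<close> is an initial interval with end point \<open>rearr f t\<close>.\<close>

lemma distrib_measurable [measurable]:
  assumes f: "f \<in> borel_measurable lebesgue"
  shows "(\<lambda>z. distrib f (ennreal z)) \<in> borel_measurable borel"
proof (rule borel_measurableI_greater)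
  fix y
  show "{x \<in> space borel. y < distrib f (ennreal x)} \<in> sets borel"
  proof (cases y)
    case (real t)
    then have "{x \<in> space borel. y < distrib f (ennreal x)} = {z. ennreal z < rearr f t}"
      using less_rearr_iff[OF f] by auto
    also have "\<dots> \<in> sets borel" by measurable
    finally show ?thesis .
  qed simp
qed

lemma rearr_avg_le_excess:
  fixes f :: "real ^ 'n::finite \<Rightarrow> real"
  assumes f [measurable]: "f \<in> borel_measurable lebesgue" and t: "0 < t" and y: "0 \<le> y"
  shows "rearr_avg f t \<le> ennreal (1 / t) * excess f y + ennreal y"
proof -
  have "(\<integral>\<^sup>+s\<in>{0<..<t}. rearr f s \<partial>lborel) \<le> (\<integral>\<^sup>+z. ennreal t * indicator {0<..y} z + distrib f (ennreal z) * indicator {y<..} z \<partial>lborel)"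
    unfolding nn_integral_rearr[OF f t] by (intro nn_integral_mono) (auto simp: indicator_def)
  also have "\<dots> = ennreal t * ennreal y + excess f y"
    using y by (simp add: nn_integral_add nn_integral_cmult excess_eq[OF f])
  finally have "rearr_avg f t \<le> ennreal (1 / t) * (ennreal t * ennreal y + excess f y)"
    unfolding rearr_avg_def nn_integral_completion by (intro mult_left_mono) auto
  also have "\<dots> = ennreal (1 / t) * excess f y + ennreal y"
    using t y by (simp add: distrib_left mult.assoc[symmetric] ennreal_mult[symmetric] add.commute)
  finally show ?thesis .
qed

text \<open>
  At the height \<open>y = f\<^sup>*(t)\<close> the minimum is attained; consequently \<open>f\<^sup>*\<^sup>* - f\<^sup>*\<close> is the excess
  over \<open>f\<^sup>*\<close>, divided by \<open>t\<close>.
\<close>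

lemma rearr_avg_eq_excess:
  fixes f :: "real ^ 'n::finite \<Rightarrow> real"
  assumes f [measurable]: "f \<in> borel_measurable lebesgue" and t: "0 < t" and y: "rearr f t = ennreal y" "0 \<le> y"
  shows "rearr_avg f t = ennreal (1 / t) * excess f y + ennreal y"
proof -
  have "(\<integral>\<^sup>+s\<in>{0<..<t}. rearr f s \<partial>lborel) = (\<integral>\<^sup>+z. ennreal t * indicator {0<..<y} z + distrib f (ennreal z) * indicator {y<..} z \<partial>lborel)"
    unfolding nn_integral_rearr[OF f t]
  proof (intro nn_integral_cong_AE, use AE_lborel_singleton[of y] in eventually_elim)
    case (elim z)
    have "ennreal t < distrib f (ennreal z)" if "0 \<le> z" "z < y"
      using that y less_rearr_iff[OF f, of "ennreal z" t] by (simp add: ennreal_less_iff)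
    moreover have "distrib f (ennreal z) \<le> ennreal t" if "y < z"
      using that y rearr_le_iff[OF f, of t "ennreal z"] by simp
    ultimately show ?case using elim y(2) by (auto simp: indicator_def min_def)
  qed
  also have "\<dots> = ennreal t * ennreal y + excess f y"
    using y by (simp add: nn_integral_add nn_integral_cmult excess_eq[OF f])
  finally have "rearr_avg f t = ennreal (1 / t) * (ennreal t * ennreal y + excess f y)"
    unfolding rearr_avg_def nn_integral_completion by simp
  also have "\<dots> = ennreal (1 / t) * excess f y + ennreal y"
    using t y by (simp add: distrib_left mult.assoc[symmetric] ennreal_mult[symmetric] add.commute)
  finally show ?thesis .
qed

lemma rearr_le_rearr_avg:
  assumes t: "0 < t"
  shows "rearr f t \<le> rearr_avg f t"
proof -
  have "rearr f t = ennreal (1 / t) * (\<integral>\<^sup>+s\<in>{0<..<t}. rearr f t \<partial>lborel)"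
    using t by (simp add: nn_integral_cmult mult.left_commute ennreal_mult[symmetric])
  also have "\<dots> \<le> rearr_avg f t"
    unfolding rearr_avg_def nn_integral_completion
    by (intro mult_left_mono nn_integral_mono) (auto simp: indicator_def rearr_antimono)
  finally show ?thesis .
qed

lemma rearr_avg_cong_AE:
  assumes "AE x in lebesgue. \<bar>f x\<bar> = \<bar>g x\<bar>" and f: "f \<in> borel_measurable lebesgue" and g: "g \<in> borel_measurable lebesgue"
  shows "rearr_avg f = rearr_avg g"
  unfolding rearr_avg_def[abs_def] rearr_cong_AE[OF assms] ..

lemma rearr_avg_uminus: "rearr_avg (\<lambda>x. - f x) = rearr_avg f"
  unfolding rearr_avg_def[abs_def] rearr_uminus ..

lemma rearr_avg_measurable [measurable]:
  assumes [measurable]: "f \<in> borel_measurable lebesgue"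
  shows "rearr_avg f \<in> borel_measurable borel"
  unfolding rearr_avg_def[abs_def] nn_integral_completion
  by (simp add: indicator_def[abs_def])

lemma rearr_avg_antimono:
  assumes f [measurable]: "f \<in> borel_measurable lebesgue" and "0 < s" "s \<le> t"
  shows "rearr_avg f t \<le> rearr_avg f s"
proof (cases "rearr f s")
  case (real y)
  have t: "0 < t" using assms by simp
  have "rearr_avg f t \<le> ennreal (1 / t) * excess f y + ennreal y" using real t by (intro rearr_avg_le_excess) auto
  also have "\<dots> \<le> ennreal (1 / s) * excess f y + ennreal y"
    using assms by (intro add_mono mult_right_mono ennreal_leI) (auto simp: frac_le)
  also have "\<dots> = rearr_avg f s" using real assms by (intro rearr_avg_eq_excess[symmetric]) auto
  finally show ?thesis .
next
  case top
  then have "rearr_avg f s = top" using rearr_le_rearr_avg[OF \<open>0 < s\<close>, of f] by (simp add: top_unique)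
  then show ?thesis by simp
qed

lemma excess_add_le:
  fixes f g :: "real ^ 'n::finite \<Rightarrow> real"
  assumes [measurable]: "f \<in> borel_measurable lebesgue" "g \<in> borel_measurable lebesgue"
  shows "excess (\<lambda>x. f x + g x) (y + z) \<le> excess f y + excess g z"
proof -
  have "excess (\<lambda>x. f x + g x) (y + z) \<le> (\<integral>\<^sup>+x. ennreal (\<bar>f x\<bar> - y) + ennreal (\<bar>g x\<bar> - z) \<partial>lebesgue)"
    unfolding excess_def
  proof (intro nn_integral_mono)
    fix x
    have "\<bar>f x + g x\<bar> - (y + z) \<le> max 0 (\<bar>f x\<bar> - y) + max 0 (\<bar>g x\<bar> - z)" by (auto simp: max_def)
    then have "ennreal (\<bar>f x + g x\<bar> - (y + z)) \<le> ennreal (max 0 (\<bar>f x\<bar> - y) + max 0 (\<bar>g x\<bar> - z))" by (rule ennreal_leI)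
    also have "\<dots> = ennreal (\<bar>f x\<bar> - y) + ennreal (\<bar>g x\<bar> - z)" by (simp add: ennreal_max_0)
    finally show "ennreal (\<bar>f x + g x\<bar> - (y + z)) \<le> ennreal (\<bar>f x\<bar> - y) + ennreal (\<bar>g x\<bar> - z)" .
  qed
  also have "\<dots> = excess f y + excess g z" unfolding excess_def by (rule nn_integral_add) auto
  finally show ?thesis .
qed

text \<open>
  Heights add: the excess of a sum over \<open>y + z\<close> is at most the sum of the excesses over \<open>y\<close> and
  \<open>z\<close>.
\<close>

lemma rearr_avg_add_le:
  fixes f g :: "real ^ 'n::finite \<Rightarrow> real"
  assumes f [measurable]: "f \<in> borel_measurable lebesgue" and g [measurable]: "g \<in> borel_measurable lebesgue" and t: "0 < t"
  shows "rearr_avg (\<lambda>x. f x + g x) t \<le> rearr_avg f t + rearr_avg g t"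
proof (cases "rearr f t = top \<or> rearr g t = top")
  case True
  then show ?thesis using rearr_le_rearr_avg[OF t, of f] rearr_le_rearr_avg[OF t, of g] by (auto simp: top_unique)
next
  case False
  then obtain y z where yz: "rearr f t = ennreal y" "0 \<le> y" "rearr g t = ennreal z" "0 \<le> z"
    by (cases "rearr f t"; cases "rearr g t") auto
  have "rearr_avg (\<lambda>x. f x + g x) t \<le> ennreal (1 / t) * excess (\<lambda>x. f x + g x) (y + z) + ennreal (y + z)"
    using t yz by (intro rearr_avg_le_excess) auto
  also have "\<dots> \<le> ennreal (1 / t) * (excess f y + excess g z) + ennreal (y + z)"
    by (intro add_mono mult_left_mono excess_add_le) auto
  also have "\<dots> = (ennreal (1 / t) * excess f y + ennreal y) + (ennreal (1 / t) * excess g z + ennreal z)"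
    using yz by (simp add: distrib_left add_ac)
  also have "\<dots> = rearr_avg f t + rearr_avg g t" using yz t by (simp add: rearr_avg_eq_excess)
  finally show ?thesis .
qed

text \<open>
  The form of the Hardy--Littlewood inequality that suits test functions. Split \<open>|g|\<close> at the
  height \<open>y\<close>; the bound is affine in the \<open>L\<^sup>1\<close> norm of \<open>\<psi>\<close>, so it survives limits of test
  functions.
\<close>

lemma nn_integral_abs_mult_le_excess:
  fixes g \<psi> :: "real ^ 'n::finite \<Rightarrow> real"
  assumes [measurable]: "g \<in> borel_measurable lebesgue" "\<psi> \<in> borel_measurable lebesgue"
    and \<psi>: "\<And>x. \<bar>\<psi> x\<bar> \<le> 1" and y: "0 \<le> y"
  shows "(\<integral>\<^sup>+x. ennreal \<bar>g x * \<psi> x\<bar> \<partial>lebesgue) \<le> excess g y + ennreal y * (\<integral>\<^sup>+x. ennreal \<bar>\<psi> x\<bar> \<partial>lebesgue)"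
proof -
  have "(\<integral>\<^sup>+x. ennreal \<bar>g x * \<psi> x\<bar> \<partial>lebesgue) \<le> (\<integral>\<^sup>+x. ennreal (\<bar>g x\<bar> - y) + ennreal y * ennreal \<bar>\<psi> x\<bar> \<partial>lebesgue)"
  proof (intro nn_integral_mono)
    fix x
    have "\<bar>g x * \<psi> x\<bar> = (\<bar>g x\<bar> - y) * \<bar>\<psi> x\<bar> + y * \<bar>\<psi> x\<bar>" by (simp add: abs_mult algebra_simps)
    also have "(\<bar>g x\<bar> - y) * \<bar>\<psi> x\<bar> \<le> max 0 (\<bar>g x\<bar> - y) * 1"
      using \<psi>[of x] by (intro order_trans[OF mult_right_mono mult_left_mono]) auto
    finally have "ennreal \<bar>g x * \<psi> x\<bar> \<le> ennreal (max 0 (\<bar>g x\<bar> - y) + y * \<bar>\<psi> x\<bar>)" by (intro ennreal_leI) simp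
    also have "\<dots> = ennreal (\<bar>g x\<bar> - y) + ennreal y * ennreal \<bar>\<psi> x\<bar>"
      using y by (simp add: ennreal_max_0 ennreal_mult)
    finally show "ennreal \<bar>g x * \<psi> x\<bar> \<le> ennreal (\<bar>g x\<bar> - y) + ennreal y * ennreal \<bar>\<psi> x\<bar>" .
  qed
  also have "\<dots> = excess g y + ennreal y * (\<integral>\<^sup>+x. ennreal \<bar>\<psi> x\<bar> \<partial>lebesgue)"
    unfolding excess_def by (simp add: nn_integral_add nn_integral_cmult)
  finally show ?thesis .
qed

lemma rearr_avg_le_double:
  fixes f :: "real ^ 'n::finite \<Rightarrow> real"
  assumes f [measurable]: "f \<in> borel_measurable lebesgue" and t: "0 < t" and fin: "rearr f (2 * t) < top"
  shows "rearr_avg f t \<le> 2 * (rearr_avg f (2 * t) - rearr f (2 * t)) + rearr f (2 * t)"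
proof -
  obtain y where y: "rearr f (2 * t) = ennreal y" "0 \<le> y" using fin by (cases "rearr f (2 * t)") auto
  have "rearr_avg f t \<le> ennreal (1 / t) * excess f y + ennreal y" using t y by (intro rearr_avg_le_excess) auto
  also have "ennreal (1 / t) * excess f y = 2 * (ennreal (1 / (2 * t)) * excess f y)"
  proof -
    have "ennreal (1 / t) = ennreal 2 * ennreal (1 / (2 * t))" using t by (subst ennreal_mult[symmetric]) auto
    then show ?thesis by (simp add: mult.assoc)
  qed
  also have "ennreal (1 / (2 * t)) * excess f y = rearr_avg f (2 * t) - rearr f (2 * t)"
    using t y by (simp add: rearr_avg_eq_excess)
  finally show ?thesis using y by simp
qed

text \<open>
  The oscillation is not subadditive. Doubling the argument of one summand repairs this, because
  \<open>a\<^sup>*(2t) \<le> f\<^sup>*(t) + b\<^sup>*(t)\<close> for \<open>f = a + b\<close>, while \<open>a\<^sup>*\<^sup>*(t)\<close> exceeds \<open>a\<^sup>*(2t)\<close> by at most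
  twice the oscillation at \<open>2t\<close>.
\<close>

lemma oscillation_add_le:
  fixes a b :: "real ^ 'n::finite \<Rightarrow> real"
  assumes a [measurable]: "a \<in> borel_measurable lebesgue" and b [measurable]: "b \<in> borel_measurable lebesgue" and t: "0 < t"
    and fin: "\<And>t. 0 < t \<Longrightarrow> rearr a t < top" "\<And>t. 0 < t \<Longrightarrow> rearr b t < top"
  shows "rearr_avg (\<lambda>x. a x + b x) t - rearr (\<lambda>x. a x + b x) t
     \<le> 2 * (rearr_avg a (2 * t) - rearr a (2 * t)) + 2 * rearr_avg b t"
proof -
  let ?f = "\<lambda>x. a x + b x"
  have "rearr a (t + t) = rearr (\<lambda>x. ?f x + - b x) (t + t)" by simp
  also have "\<dots> \<le> rearr ?f t + rearr (\<lambda>x. - b x) t" using t by (intro rearr_add_le) auto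
  finally have *: "rearr a (2 * t) \<le> rearr ?f t + rearr b t" by (simp add: rearr_uminus)
  have "rearr ?f t \<le> rearr a (t / 2) + rearr b (t / 2)" using rearr_add_le[of a b "t/2" "t/2"] t by simp
  also have "\<dots> < top" using t fin by simp
  finally have f_fin: "rearr ?f t < top" .
  have "rearr_avg ?f t \<le> rearr_avg a t + rearr_avg b t" by (rule rearr_avg_add_le[OF a b t])
  also have "\<dots> \<le> (2 * (rearr_avg a (2 * t) - rearr a (2 * t)) + (rearr ?f t + rearr b t)) + rearr_avg b t"
    using rearr_avg_le_double[OF a t] fin t * by (intro add_right_mono) (auto intro: order_trans add_left_mono)
  also have "\<dots> \<le> (2 * (rearr_avg a (2 * t) - rearr a (2 * t)) + (rearr ?f t + rearr_avg b t)) + rearr_avg b t"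
    using rearr_le_rearr_avg[OF t, of b] by (intro add_mono) auto
  also have "\<dots> = rearr ?f t + (2 * (rearr_avg a (2 * t) - rearr a (2 * t)) + 2 * rearr_avg b t)"
    by (simp only: mult_2[of "rearr_avg b t"] add_ac)
  finally show ?thesis using f_fin by (auto simp: ennreal_minus_le_iff)
qed

section \<open>Smooth functions and test functions\<close>

lemma partial_eq:
  assumes "(f has_derivative D) (at x)"
  shows "partial i f x = D (axis i 1)"
  unfolding partial_def using frechet_derivative_at[OF assms] by simp

lemma Ck_continuous: "Ck k f \<Longrightarrow> continuous_on UNIV f"
  by (cases k) (auto simp: continuous_at_imp_continuous_on differentiable_imp_continuous_within)

lemma Ck_Suc_imp: "Ck (Suc k) f \<Longrightarrow> Ck k f"
proof (induction k arbitrary: f)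
  case 0
  then show ?case using Ck_continuous[of "Suc 0" f] by simp
qed auto

lemma Ck_const: "Ck k (\<lambda>x :: real ^ 'n::finite. c)"
proof (induction k arbitrary: c)
  case (Suc k)
  have "partial i (\<lambda>x. c) = (\<lambda>x. 0)" for i :: 'n and c :: real
    by (rule ext) (rule partial_eq[OF has_derivative_const])
  then show ?case using Suc by auto
qed auto

lemma Ck_linear: "bounded_linear f \<Longrightarrow> Ck k f"
proof (induction k)
  case 0
  then show ?case by (simp add: linear_continuous_on)
next
  case (Suc k)
  have "partial i f = (\<lambda>x. f (axis i 1))" for i
    by (rule ext) (rule partial_eq[OF bounded_linear_imp_has_derivative[OF Suc.prems]])
  then show ?case using Suc.prems by (auto simp: Ck_const bounded_linear_imp_differentiable)
qed

lemma partial_add: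
  assumes "\<And>x. f differentiable (at x)" "\<And>x. g differentiable (at x)"
  shows "partial i (\<lambda>x. f x + g x) = (\<lambda>x. partial i f x + partial i g x)"
proof
  fix x
  from assms obtain f' g' where "(f has_derivative f') (at x)" "(g has_derivative g') (at x)"
    unfolding differentiable_def by metis
  then show "partial i (\<lambda>x. f x + g x) x = partial i f x + partial i g x"
    by (simp add: partial_eq[OF has_derivative_add] partial_eq)
qed

lemma partial_mult:
  assumes "\<And>x. f differentiable (at x)" "\<And>x. g differentiable (at x)"
  shows "partial i (\<lambda>x. f x * g x) = (\<lambda>x. f x * partial i g x + partial i f x * g x)"
proof
  fix x
  from assms obtain f' g' where "(f has_derivative f') (at x)" "(g has_derivative g') (at x)"
    unfolding differentiable_def by metis
  then show "partial i (\<lambda>x. f x * g x) x = f x * partial i g x + partial i f x * g x"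
    by (simp add: partial_eq[OF has_derivative_mult] partial_eq)
qed

lemma Ck_add: "Ck k f \<Longrightarrow> Ck k g \<Longrightarrow> Ck k (\<lambda>x. f x + g x)"
proof (induction k arbitrary: f g)
  case 0
  then show ?case by (auto intro: continuous_intros)
next
  case (Suc k)
  then show ?case by (auto simp: partial_add)
qed

lemma Ck_mult: "Ck k f \<Longrightarrow> Ck k g \<Longrightarrow> Ck k (\<lambda>x. f x * g x)"
proof (induction k arbitrary: f g)
  case 0
  then show ?case by (auto intro: continuous_intros)
next
  case (Suc k)
  have "Ck k f" "Ck k g" using Suc.prems Ck_Suc_imp by blast+
  with Suc show ?case by (auto simp: partial_mult intro!: Ck_add)
qed

lemma Ck_prod: "finite I \<Longrightarrow> (\<And>j. j \<in> I \<Longrightarrow> Ck k (f j)) \<Longrightarrow> Ck k (\<lambda>x. \<Prod>j\<in>I. f j x)"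
  by (induction I rule: finite_induct) (auto simp: Ck_const intro: Ck_mult)

lemma Ck_power: "Ck k f \<Longrightarrow> Ck k (\<lambda>x. f x ^ m)"
  by (induction m) (auto simp: Ck_const intro: Ck_mult)

lemma Ck_polynomial: "real_polynomial_function p \<Longrightarrow> Ck k p"
  by (induction rule: real_polynomial_function.induct)
     (auto simp: Ck_linear Ck_const intro: Ck_add Ck_mult)

lemma partial_translate:
  assumes "\<And>x. f differentiable (at x)"
  shows "partial i (\<lambda>x. f (x + a)) = (\<lambda>x. partial i f (x + a))"
proof
  fix x
  from assms obtain f' where f': "(f has_derivative f') (at (x + a))"
    unfolding differentiable_def by metis
  have "((\<lambda>x. x + a) has_derivative (\<lambda>h. h)) (at x)" by (auto intro!: derivative_eq_intros)
  from diff_chain_at[OF this f'] have "((\<lambda>x. f (x + a)) has_derivative f') (at x)"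
    by (simp add: o_def)
  then show "partial i (\<lambda>x. f (x + a)) x = partial i f (x + a)"
    using f' by (simp add: partial_eq)
qed

lemma differentiable_translate:
  fixes f :: "real ^ 'n::finite \<Rightarrow> real"
  assumes "f differentiable (at (x + a))"
  shows "(\<lambda>x. f (x + a)) differentiable (at x)"
  using differentiable_chain_at[of "\<lambda>x. x + a" x f] assms by (simp add: o_def)

lemma Ck_translate: "Ck k f \<Longrightarrow> Ck k (\<lambda>x. f (x + a))"
proof (induction k arbitrary: f)
  case 0
  then show ?case by (auto intro!: continuous_on_compose2[of UNIV f] continuous_intros)
next
  case (Suc k)
  then show ?case by (auto simp: partial_translate intro: differentiable_translate)
qed

subsection \<open>Symmetry of partial derivatives\<close>

lemma has_derivative_along_axis:
  fixes f :: "real ^ 'n::finite \<Rightarrow> real"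
  assumes "\<And>x. f differentiable (at x)"
  shows "((\<lambda>s. f (x + s *\<^sub>R axis i 1)) has_real_derivative partial i f (x + s *\<^sub>R axis i 1)) (at s)"
proof -
  obtain f' where f': "(f has_derivative f') (at (x + s *\<^sub>R axis i 1))"
    using assms unfolding differentiable_def by metis
  have "((\<lambda>s. x + s *\<^sub>R axis i 1) has_derivative (\<lambda>h. h *\<^sub>R axis i (1::real))) (at s)"
    by (auto intro!: derivative_eq_intros)
  from diff_chain_at[OF this f']
  have "((\<lambda>s. f (x + s *\<^sub>R axis i 1)) has_derivative (\<lambda>h. f' (h *\<^sub>R axis i 1))) (at s)"
    by (simp add: o_def)
  moreover have "f' (h *\<^sub>R axis i 1) = partial i f (x + s *\<^sub>R axis i 1) * h" for h
    using linear_cmul[OF has_derivative_linear[OF f'], of h "axis i 1"] partial_eq[OF f', of i]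
    by (simp add: mult.commute)
  ultimately show ?thesis by (simp add: has_field_derivative_def)
qed

text \<open>Two applications of the mean value theorem to the second difference over a square.\<close>

lemma mixed_difference:
  assumes f: "Ck 2 f" and h: "0 < h"
  shows "\<exists>s t. 0 < s \<and> s < h \<and> 0 < t \<and> t < h \<and>
     f (x + h *\<^sub>R axis i 1 + h *\<^sub>R axis j 1) - f (x + h *\<^sub>R axis i 1) - f (x + h *\<^sub>R axis j 1) + f x
       = h * h * partial j (partial i f) (x + s *\<^sub>R axis i 1 + t *\<^sub>R axis j 1)"
proof -
  have d: "\<And>x. f differentiable (at x)" "\<And>x. partial i f differentiable (at x)"
    using f by (auto simp: numeral_2_eq_2)
  define u where "u s = f ((x + h *\<^sub>R axis j 1) + s *\<^sub>R axis i 1) - f (x + s *\<^sub>R axis i 1)" for s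
  have "(u has_real_derivative (partial i f ((x + h *\<^sub>R axis j 1) + s *\<^sub>R axis i 1) - partial i f (x + s *\<^sub>R axis i 1))) (at s)" for s
    unfolding u_def[abs_def] by (intro DERIV_diff has_derivative_along_axis d)
  from MVT2[OF h this] obtain s where s: "0 < s" "s < h"
    "u h - u 0 = h * (partial i f ((x + h *\<^sub>R axis j 1) + s *\<^sub>R axis i 1) - partial i f (x + s *\<^sub>R axis i 1))"
    by auto
  have "((\<lambda>t. partial i f ((x + s *\<^sub>R axis i 1) + t *\<^sub>R axis j 1)) has_real_derivative
      partial j (partial i f) ((x + s *\<^sub>R axis i 1) + t *\<^sub>R axis j 1)) (at t)" for t
    by (intro has_derivative_along_axis d)
  from MVT2[OF h this] obtain t where t: "0 < t" "t < h"
    "partial i f ((x + s *\<^sub>R axis i 1) + h *\<^sub>R axis j 1) - partial i f (x + s *\<^sub>R axis i 1)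
       = h * partial j (partial i f) (x + s *\<^sub>R axis i 1 + t *\<^sub>R axis j 1)" by auto
  have "u h - u 0 = h * (h * partial j (partial i f) (x + s *\<^sub>R axis i 1 + t *\<^sub>R axis j 1))"
    using s(3) t(3) by (simp add: add_ac)
  moreover have "f (x + h *\<^sub>R axis i 1 + h *\<^sub>R axis j 1) - f (x + h *\<^sub>R axis i 1) - f (x + h *\<^sub>R axis j 1) + f x = u h - u 0"
    by (simp add: u_def algebra_simps)
  ultimately show ?thesis using s t by (rule_tac exI[of _ s], rule_tac exI[of _ t]) (simp add: mult.assoc)
qed

text \<open>
  The second difference is symmetric in \<open>i\<close> and \<open>j\<close>; let the side of the square tend to \<open>0\<close>.
\<close>

lemma partial_commute:
  assumes f: "Ck 2 f"
  shows "partial i (partial j f) = partial j (partial i f)"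
proof
  fix x
  define h where "h n = 1 / real (Suc n)" for n
  have h: "0 < h n" for n by (simp add: h_def)
  have h0: "h \<longlonglongrightarrow> 0"
    unfolding h_def[abs_def] by (rule LIMSEQ_Suc[OF lim_1_over_n])
  obtain s t where st: "\<And>n. 0 < s n \<and> s n < h n \<and> 0 < t n \<and> t n < h n \<and>
     f (x + h n *\<^sub>R axis i 1 + h n *\<^sub>R axis j 1) - f (x + h n *\<^sub>R axis i 1) - f (x + h n *\<^sub>R axis j 1) + f x
       = h n * h n * partial j (partial i f) (x + s n *\<^sub>R axis i 1 + t n *\<^sub>R axis j 1)"
    using mixed_difference[OF f h, where x = x and i = i and j = j] by metis
  obtain s' t' where st': "\<And>n. 0 < s' n \<and> s' n < h n \<and> 0 < t' n \<and> t' n < h n \<and>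
     f (x + h n *\<^sub>R axis j 1 + h n *\<^sub>R axis i 1) - f (x + h n *\<^sub>R axis j 1) - f (x + h n *\<^sub>R axis i 1) + f x
       = h n * h n * partial i (partial j f) (x + s' n *\<^sub>R axis j 1 + t' n *\<^sub>R axis i 1)"
    using mixed_difference[OF f h, where x = x and i = j and j = i] by metis
  have eq: "partial j (partial i f) (x + s n *\<^sub>R axis i 1 + t n *\<^sub>R axis j 1)
      = partial i (partial j f) (x + s' n *\<^sub>R axis j 1 + t' n *\<^sub>R axis i 1)" for n
  proof -
    have *: "x + h n *\<^sub>R axis j 1 + h n *\<^sub>R axis i 1 = x + h n *\<^sub>R axis i 1 + h n *\<^sub>R axis j 1" by (simp add: add_ac)
    have "h n * h n * partial j (partial i f) (x + s n *\<^sub>R axis i 1 + t n *\<^sub>R axis j 1)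
        = f (x + h n *\<^sub>R axis i 1 + h n *\<^sub>R axis j 1) - f (x + h n *\<^sub>R axis i 1) - f (x + h n *\<^sub>R axis j 1) + f x"
      using st[of n] by (elim conjE) (rule sym)
    also have "\<dots> = f (x + h n *\<^sub>R axis j 1 + h n *\<^sub>R axis i 1) - f (x + h n *\<^sub>R axis j 1) - f (x + h n *\<^sub>R axis i 1) + f x"
      unfolding * by simp
    also have "\<dots> = h n * h n * partial i (partial j f) (x + s' n *\<^sub>R axis j 1 + t' n *\<^sub>R axis i 1)"
      using st'[of n] by (elim conjE)
    finally have "h n * h n * partial j (partial i f) (x + s n *\<^sub>R axis i 1 + t n *\<^sub>R axis j 1)
        = h n * h n * partial i (partial j f) (x + s' n *\<^sub>R axis j 1 + t' n *\<^sub>R axis i 1)" .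
    then show ?thesis using h[of n] by simp
  qed
  have sq: "a \<longlonglongrightarrow> 0" if "\<And>n. 0 < a n \<and> a n < h n" for a
    by (rule tendsto_sandwich[OF _ _ tendsto_const h0]) (use that in \<open>auto intro!: always_eventually less_imp_le\<close>)
  have cont: "isCont (partial j (partial i f)) x" "isCont (partial i (partial j f)) x"
    using f Ck_continuous by (auto simp: numeral_2_eq_2 continuous_on_eq_continuous_at)
  have lim: "(\<lambda>n. x + a n *\<^sub>R axis k 1 + b n *\<^sub>R axis l 1) \<longlonglongrightarrow> x + 0 *\<^sub>R axis k 1 + 0 *\<^sub>R axis l 1"
    if "a \<longlonglongrightarrow> 0" "b \<longlonglongrightarrow> 0" for a b :: "nat \<Rightarrow> real" and k l
    by (intro tendsto_intros that)
  have "(\<lambda>n. partial j (partial i f) (x + s n *\<^sub>R axis i 1 + t n *\<^sub>R axis j 1)) \<longlonglongrightarrow> partial j (partial i f) x"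
    using isCont_tendsto_compose[OF cont(1), of "\<lambda>n. x + s n *\<^sub>R axis i 1 + t n *\<^sub>R axis j 1" sequentially]
      lim[of s t i j] sq[of s] sq[of t] st by simp
  moreover have "(\<lambda>n. partial i (partial j f) (x + s' n *\<^sub>R axis j 1 + t' n *\<^sub>R axis i 1)) \<longlonglongrightarrow> partial i (partial j f) x"
    using isCont_tendsto_compose[OF cont(2), of "\<lambda>n. x + s' n *\<^sub>R axis j 1 + t' n *\<^sub>R axis i 1" sequentially]
      lim[of s' t' j i] sq[of s'] sq[of t'] st' by simp
  ultimately show "partial i (partial j f) x = partial j (partial i f) x"
    unfolding eq by (rule LIMSEQ_unique[symmetric])
qed

definition smooth :: "(real ^ 'n::finite \<Rightarrow> real) \<Rightarrow> bool" where
  "smooth f \<longleftrightarrow> (\<forall>k. Ck k f)"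

lemma smooth_partial: "smooth f \<Longrightarrow> smooth (partial i f)"
  unfolding smooth_def by (metis Ck.simps(2))

lemma smooth_partial_power: "smooth f \<Longrightarrow> smooth ((partial i ^^ m) f)"
  by (induction m) (auto intro: smooth_partial)

lemma smooth_foldr: "smooth f \<Longrightarrow> smooth (foldr (\<lambda>i. partial i ^^ \<alpha> i) xs f)"
  by (induction xs) (auto intro: smooth_partial_power)

lemma partial_power_commute: "smooth f \<Longrightarrow> partial i ((partial j ^^ m) f) = (partial j ^^ m) (partial i f)"
proof (induction m)
  case (Suc m)
  then have "Ck 2 ((partial j ^^ m) f)" using smooth_partial_power unfolding smooth_def by blast
  then show ?case using Suc partial_commute[of "(partial j ^^ m) f" i j] by simp
qed simp

lemma partial_foldr_commute:
  "smooth f \<Longrightarrow> partial i (foldr (\<lambda>j. partial j ^^ \<alpha> j) xs f) = foldr (\<lambda>j. partial j ^^ \<alpha> j) xs (partial i f)"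
  by (induction xs) (auto simp: partial_power_commute smooth_foldr)

lemma foldr_partial_Suc:
  assumes "smooth f" "distinct xs" "i \<in> set xs"
  shows "foldr (\<lambda>j. partial j ^^ (\<alpha>(i := Suc (\<alpha> i))) j) xs f = foldr (\<lambda>j. partial j ^^ \<alpha> j) xs (partial i f)"
  using assms(2,3)
proof (induction xs)
  case (Cons a xs)
  show ?case
  proof (cases "a = i")
    case True
    then have "i \<notin> set xs" using Cons.prems by simp
    then have "foldr (\<lambda>j. partial j ^^ (\<alpha>(i := Suc (\<alpha> i))) j) xs f = foldr (\<lambda>j. partial j ^^ \<alpha> j) xs f"
      by (intro foldr_cong) auto
    then show ?thesis
      using True assms(1) by (simp add: partial_power_commute smooth_foldr partial_foldr_commute)
  next
    case False
    then show ?thesis using Cons by simp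
  qed
qed simp

lemma coords: "distinct (coords :: 'n::finite list)" "set (coords :: 'n list) = UNIV"
proof -
  have "\<exists>xs :: 'n list. distinct xs \<and> set xs = UNIV"
    using finite_distinct_list[of "UNIV :: 'n set"] by auto
  from someI_ex[OF this] show "distinct (coords :: 'n list)" "set (coords :: 'n list) = UNIV"
    unfolding coords_def by auto
qed

text \<open>
  Differentiating once more in the direction \<open>i\<close> may be done first, whatever the enumeration of
  the coordinates.
\<close>

lemma mi_deriv_Suc: "smooth f \<Longrightarrow> mi_deriv (\<alpha>(i := Suc (\<alpha> i))) f = mi_deriv \<alpha> (partial i f)"
  unfolding mi_deriv_def by (rule foldr_partial_Suc) (auto simp: coords)

lemma mi_deriv_0: "mi_deriv (\<lambda>_. 0) f = f"
proof -
  have "foldr (\<lambda>i. partial i ^^ 0) xs f = f" for xs by (induction xs) auto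
  then show ?thesis unfolding mi_deriv_def by simp
qed

lemma mi_order_Suc: "mi_order (\<alpha>(i := Suc (\<alpha> i))) = Suc (mi_order \<alpha>)"
  unfolding mi_order_def by (simp add: sum.remove[of UNIV i])

lemma mi_order_0: "mi_order (\<lambda>_. 0) = 0"
  unfolding mi_order_def by simp

text \<open>Sums over multi-indices of a given order are therefore genuine sums.\<close>

lemma finite_mi_order: "finite {\<alpha> :: 'n::finite \<Rightarrow> nat. mi_order \<alpha> = k}"
proof (rule finite_subset)
  show "{\<alpha> :: 'n \<Rightarrow> nat. mi_order \<alpha> = k} \<subseteq> Pi\<^sub>E UNIV (\<lambda>_. {..k})"
  proof
    fix \<alpha> :: "'n \<Rightarrow> nat" assume "\<alpha> \<in> {\<alpha>. mi_order \<alpha> = k}"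
    then have "\<alpha> i \<le> k" for i
      using member_le_sum[of i UNIV \<alpha>] by (auto simp: mi_order_def)
    then show "\<alpha> \<in> Pi\<^sub>E UNIV (\<lambda>_. {..k})" by auto
  qed
qed (intro finite_PiE, auto)

subsection \<open>Test functions\<close>

lemma test_fun_smooth: "test_fun f \<Longrightarrow> smooth f"
  by (simp add: test_fun_def smooth_def)

lemma test_fun_partial:
  assumes "test_fun f" shows "test_fun (partial i f)"
proof -
  have "{x. partial i f x \<noteq> 0} \<subseteq> closure {x. f x \<noteq> 0}"
  proof (rule subsetI, rule ccontr)
    fix x assume x: "x \<in> {x. partial i f x \<noteq> 0}" "x \<notin> closure {x. f x \<noteq> 0}"
    let ?U = "- closure {x. f x \<noteq> 0}"
    have "((\<lambda>x. 0) has_derivative (\<lambda>h. 0)) (at x)" by simp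
    then have "(f has_derivative (\<lambda>h. 0)) (at x)"
      by (rule has_derivative_transform_within_open[of _ _ _ _ ?U])
         (use x closure_subset[of "{x. f x \<noteq> 0}"] in auto)
    then have "partial i f x = 0" by (simp add: partial_eq)
    with x show False by simp
  qed
  moreover have "bounded (closure {x. f x \<noteq> 0})" using assms by (simp add: test_fun_def compact_imp_bounded)
  ultimately have "compact (closure {x. partial i f x \<noteq> 0})" using bounded_subset compact_closure by blast
  then show ?thesis using smooth_partial[OF test_fun_smooth[OF assms]] by (simp add: test_fun_def smooth_def)
qed

lemma test_fun_translate:
  assumes "test_fun f" shows "test_fun (\<lambda>x. f (x + a))"
proof -
  have "{x. f (x + a) \<noteq> 0} = (\<lambda>x. x - a) ` {x. f x \<noteq> 0}"
    by (auto simp: image_iff intro!: exI[of _ "_ + a"])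
  then have "closure {x. f (x + a) \<noteq> 0} = (\<lambda>x. x - a) ` closure {x. f x \<noteq> 0}"
    using closure_translation_subtract[of a "{x. f x \<noteq> 0}"] by simp
  then show ?thesis using assms
    by (auto simp: test_fun_def Ck_translate intro!: compact_continuous_image continuous_intros)
qed

lemma test_fun_bounded:
  assumes "test_fun f" obtains M R where "0 < R" "\<And>x. \<bar>f x\<bar> \<le> M" "\<And>x. R < norm x \<Longrightarrow> f x = 0"
proof -
  let ?K = "closure {x. f x \<noteq> 0}"
  have c: "compact ?K" using assms by (simp add: test_fun_def)
  have "continuous_on ?K f" using assms Ck_continuous continuous_on_subset unfolding test_fun_def by blast
  then have "bounded (f ` ?K)" using c compact_continuous_image compact_imp_bounded by blast
  then obtain M where M: "\<And>x. x \<in> ?K \<Longrightarrow> \<bar>f x\<bar> \<le> M" unfolding bounded_iff by auto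
  obtain R where R: "0 < R" "\<And>x. x \<in> ?K \<Longrightarrow> norm x \<le> R" using c compact_imp_bounded bounded_pos by metis
  have out: "f x = 0" if "x \<notin> ?K" for x using that closure_subset[of "{x. f x \<noteq> 0}"] by auto
  have "\<bar>f x\<bar> \<le> max M 0" for x using M[of x] out[of x] by (cases "x \<in> ?K") auto
  moreover have "f x = 0" if "R < norm x" for x using R out[of x] that by fastforce
  ultimately show ?thesis using R that by blast
qed

subsection \<open>A smooth bump\<close>

text \<open>
  The functions \<open>x powr (-k) * exp (-1/x)\<close> on the positive axis, extended by \<open>0\<close>. Their span is
  closed under differentiation, which gives smoothness without computing higher derivatives.
\<close>

definition flat :: "nat \<Rightarrow> real \<Rightarrow> real" where
  "flat k x = (if 0 < x then (1 / x) ^ k * exp (- (1 / x)) else 0)"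

lemma flat_tendsto_0: "(flat k \<longlongrightarrow> 0) (at_right 0)"
proof -
  have "((\<lambda>y::real. y ^ k / exp y) \<longlongrightarrow> 0) at_top" for k :: nat by (rule tendsto_power_div_exp_0)
  then have "((\<lambda>x. inverse x ^ k / exp (inverse x)) \<longlongrightarrow> 0) (at_right (0::real))"
    by (rule filterlim_compose) (rule filterlim_inverse_at_top_right)
  then show ?thesis
    by (rule Lim_transform_eventually)
       (auto simp: flat_def eventually_at_filter exp_minus divide_simps)
qed

lemma flat_has_derivative: "(flat k has_real_derivative flat (k + 2) x - real k * flat (k + 1) x) (at x)"
proof -
  consider "0 < x" | "x < 0" | "x = 0" by linarith
  then show ?thesis
  proof cases
    case 1
    have "((\<lambda>x. (1 / x) ^ k * exp (- (1 / x))) has_real_derivative flat (k + 2) x - real k * flat (k + 1) x) (at x)"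
      using 1 by (cases k) (auto intro!: derivative_eq_intros simp: flat_def field_simps power2_eq_square, metis power_eq_if One_nat_def)
    then show ?thesis
      by (rule has_field_derivative_transform_within_open[of _ _ _ "{0<..}"]) (use 1 in \<open>auto simp: flat_def\<close>)
  next
    case 2
    have "((\<lambda>x. 0) has_real_derivative 0) (at x)" by simp
    then have "(flat k has_real_derivative 0) (at x)"
      by (rule has_field_derivative_transform_within_open[of _ _ _ "{..<0}"]) (use 2 in \<open>auto simp: flat_def\<close>)
    then show ?thesis using 2 by (simp add: flat_def)
  next
    case 3
    have "((\<lambda>h. flat k h / h) \<longlongrightarrow> 0) (at_right 0)"
      using flat_tendsto_0[of "k + 1"]
      by (rule Lim_transform_eventually) (auto simp: flat_def eventually_at_filter)
    moreover have "((\<lambda>h. flat k h / h) \<longlongrightarrow> 0) (at_left 0)"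
      by (rule tendsto_eventually) (auto simp: flat_def eventually_at_filter)
    ultimately have "((\<lambda>h. flat k h / h) \<longlongrightarrow> 0) (at 0)" by (simp add: filterlim_at_split)
    then show ?thesis using 3 by (simp add: has_field_derivative_iff flat_def)
  qed
qed

text \<open>
  The affine argument has the shape \<open>\<sigma> * x $ i + c\<close> so that the statement reproduces itself
  under differentiation.
\<close>

lemma partial_flat:
  fixes \<sigma> c :: real
  shows "partial j (\<lambda>x. flat k (\<sigma> * x $ i + c))
    = (\<lambda>x. \<sigma> * axis j 1 $ i * (flat (k + 2) (\<sigma> * x $ i + c) + - real k * flat (k + 1) (\<sigma> * x $ i + c)))"
    and "(\<lambda>x. flat k (\<sigma> * x $ i + c)) differentiable (at x)"
proof -
  have der: "((\<lambda>x. flat k (\<sigma> * x $ i + c)) has_derivative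
      (\<lambda>h. \<sigma> * h $ i * (flat (k + 2) (\<sigma> * x $ i + c) - real k * flat (k + 1) (\<sigma> * x $ i + c)))) (at x)" for x
  proof -
    have "((\<lambda>x. \<sigma> * x $ i + c) has_derivative (\<lambda>h. \<sigma> * h $ i)) (at x)"
      by (auto intro!: derivative_eq_intros bounded_linear.has_derivative[OF bounded_linear_vec_nth])
    from diff_chain_at[OF this flat_has_derivative[unfolded has_field_derivative_def]]
    show ?thesis by (simp add: o_def mult_ac)
  qed
  then show "(\<lambda>x. flat k (\<sigma> * x $ i + c)) differentiable (at x)" by (auto simp: differentiable_def)
  show "partial j (\<lambda>x. flat k (\<sigma> * x $ i + c))
    = (\<lambda>x. \<sigma> * axis j 1 $ i * (flat (k + 2) (\<sigma> * x $ i + c) + - real k * flat (k + 1) (\<sigma> * x $ i + c)))"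
    by (rule ext) (simp add: partial_eq[OF der])
qed

lemma Ck_flat: "Ck m (\<lambda>x :: real ^ 'n::finite. flat k (\<sigma> * x $ i + c))"
proof (induction m arbitrary: k)
  case 0
  show ?case using partial_flat(2)[of k \<sigma> i c]
    by (auto intro!: continuous_at_imp_continuous_on differentiable_imp_continuous_within)
next
  case (Suc m)
  show ?case
    unfolding Ck.simps partial_flat(1)
    by (intro conjI allI partial_flat(2) Ck_mult Ck_add Ck_const Suc.IH)
qed

text \<open>
  A smooth function that is positive exactly on an open cube. The factors \<open>1\<close> and \<open>- 1\<close> match
  the form of \<open>Ck_flat\<close>.
\<close>

definition bump :: "real \<Rightarrow> real ^ 'n::finite \<Rightarrow> real" where
  "bump R x = (\<Prod>i\<in>UNIV. flat 0 (1 * x $ i + R) * flat 0 (- 1 * x $ i + R))"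

lemma flat_0: "0 \<le> flat 0 x" "flat 0 x \<le> 1" "flat 0 x = 0 \<longleftrightarrow> x \<le> 0"
  by (auto simp: flat_def)

lemma Ck_bump: "Ck k (bump R)"
  unfolding bump_def[abs_def] by (intro Ck_prod Ck_mult Ck_flat) auto

lemma bump_bounds: "0 \<le> bump R x" "bump R x \<le> 1"
  unfolding bump_def using flat_0 by (auto intro!: prod_nonneg prod_le_1 mult_le_one)

lemma bump_eq_0_iff: "bump R x = 0 \<longleftrightarrow> (\<exists>i. R \<le> \<bar>x $ i\<bar>)"
proof -
  have "bump R x = 0 \<longleftrightarrow> (\<exists>i. flat 0 (1 * x $ i + R) * flat 0 (- 1 * x $ i + R) = 0)"
    unfolding bump_def by auto
  also have "\<dots> \<longleftrightarrow> (\<exists>i. R \<le> \<bar>x $ i\<bar>)"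
  proof (intro ex_cong1)
    fix i
    show "flat 0 (1 * x $ i + R) * flat 0 (- 1 * x $ i + R) = 0 \<longleftrightarrow> R \<le> \<bar>x $ i\<bar>"
      unfolding mult_eq_0_iff flat_0(3) by linarith
  qed
  finally show ?thesis .
qed

subsection \<open>Density of test functions\<close>

definition cube :: "real \<Rightarrow> (real ^ 'n::finite) set" where
  "cube R = {x. \<forall>i. \<bar>x $ i\<bar> \<le> R}"

lemma cube_cbox: "cube R = cbox (- (\<chi> i. R)) (\<chi> i. R)"
  by (auto simp: cube_def mem_box_cart abs_le_iff minus_le_iff)

text \<open>
  A measurable function is an almost everywhere limit of continuous ones. These are clipped to
  \<open>[-1, 1]\<close>, replaced by polynomials on the cube, and multiplied by the smooth cutoffs \<open>1 - (1 -
  bump)\<^sup>n\<close>, which increase to the indicator of the open cube; a final factor close to \<open>1\<close>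
  restores the bound by \<open>1\<close>.
\<close>

lemma test_fun_approx:
  fixes f :: "real ^ 'n::finite \<Rightarrow> real"
  assumes f [measurable]: "f \<in> borel_measurable lebesgue" and bd: "\<And>x. \<bar>f x\<bar> \<le> 1"
    and supp: "\<And>x i. R \<le> \<bar>x $ i\<bar> \<Longrightarrow> f x = 0"
  obtains \<psi> where "\<And>n. test_fun (\<psi> n)" "\<And>n x. \<bar>\<psi> n x\<bar> \<le> 1" "\<And>n x. x \<notin> cube R \<Longrightarrow> \<psi> n x = 0"
    "AE x in lebesgue. (\<lambda>n. \<psi> n x) \<longlonglongrightarrow> f x"
proof -
  have "f measurable_on UNIV" using f by (intro lebesgue_measurable_imp_measurable_on) auto
  then obtain N g where N: "negligible N" and g: "\<And>n. continuous_on UNIV (g n)"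
    and lim: "\<And>x. x \<notin> N \<Longrightarrow> (\<lambda>n. g n x) \<longlonglongrightarrow> f x"
    unfolding measurable_on_def by auto
  define c where "c n x = max (- 1) (min 1 (g n x))" for n x
  have "continuous_on (cube R) (c n)" for n
    unfolding c_def[abs_def] by (intro continuous_intros continuous_on_subset[OF g]) auto
  moreover have "compact (cube R :: (real ^ 'n) set)" unfolding cube_cbox by (rule compact_cbox)
  ultimately have "\<exists>p. real_polynomial_function p \<and> (\<forall>x \<in> cube R. \<bar>c n x - p x\<bar> < 1 / real (Suc n))" for n
    using Stone_Weierstrass_real_polynomial_function[of "cube R" "c n" "1 / real (Suc n)"]
    by (metis of_nat_0_less_iff zero_less_Suc zero_less_divide_1_iff)
  then obtain p where p: "\<And>n. real_polynomial_function (p n)"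
    and p_close: "\<And>n x. x \<in> cube R \<Longrightarrow> \<bar>c n x - p n x\<bar> < 1 / real (Suc n)"
    by metis
  define \<zeta> where "\<zeta> n x = 1 + - 1 * (1 + - 1 * bump R x) ^ n" for n and x :: "real ^ 'n"
  have \<zeta>: "0 \<le> \<zeta> n x" "\<zeta> n x \<le> 1" for n x
    using bump_bounds[of R x] by (auto simp: \<zeta>_def power_le_one)
  have \<zeta>_out: "\<zeta> n x = 0" if "R \<le> \<bar>x $ i\<bar>" for n x i
    using that bump_eq_0_iff[of R x] by (auto simp: \<zeta>_def)
  define e where "e n = 1 / (1 + 1 / real (Suc n))" for n
  have e: "0 < e n" "e n \<le> 1" for n by (auto simp: e_def divide_simps)
  define \<psi> where "\<psi> n x = e n * (\<zeta> n x * p n x)" for n x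
  show ?thesis
  proof
    have out: "\<psi> n x = 0" if "R \<le> \<bar>x $ i\<bar>" for n x i using \<zeta>_out[OF that] by (simp add: \<psi>_def)
    show "\<psi> n x = 0" if "x \<notin> cube R" for n x
      using that out[of x _ n] by (auto simp: cube_def not_le intro: less_imp_le)
    show "test_fun (\<psi> n)" for n
    proof -
      have "Ck k (\<psi> n)" for k
        unfolding \<psi>_def[abs_def] \<zeta>_def by (intro Ck_mult Ck_const Ck_add Ck_power Ck_bump Ck_polynomial p)
      moreover have "{x. \<psi> n x \<noteq> 0} \<subseteq> cube R" using \<open>\<And>n x. x \<notin> cube R \<Longrightarrow> \<psi> n x = 0\<close> by auto
      then have "bounded {x. \<psi> n x \<noteq> 0}" using bounded_subset[OF bounded_cbox] unfolding cube_cbox by blast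
      ultimately show ?thesis by (simp add: test_fun_def compact_closure)
    qed
    show "\<bar>\<psi> n x\<bar> \<le> 1" for n x
    proof (cases "x \<in> cube R")
      case True
      have "\<bar>p n x\<bar> \<le> 1 + 1 / real (Suc n)"
        using p_close[OF True, of n] by (auto simp: c_def max_def min_def split: if_splits)
      then have "\<bar>\<zeta> n x\<bar> * \<bar>p n x\<bar> \<le> 1 * (1 + 1 / real (Suc n))"
        using \<zeta>[of n x] by (intro mult_mono) auto
      then have "e n * (\<bar>\<zeta> n x\<bar> * \<bar>p n x\<bar>) \<le> e n * (1 + 1 / real (Suc n))"
        using e[of n] by (intro mult_left_mono) auto
      also have "\<dots> = 1" by (simp add: e_def add_nonneg_eq_0_iff)
      finally show ?thesis using e[of n] by (simp add: \<psi>_def abs_mult)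
    qed (simp add: \<open>\<And>n x. x \<notin> cube R \<Longrightarrow> \<psi> n x = 0\<close>)
    have "(\<lambda>n. \<psi> n x) \<longlonglongrightarrow> f x" if x: "x \<notin> N" for x
    proof (cases "\<exists>i. R \<le> \<bar>x $ i\<bar>")
      case True
      then show ?thesis using out supp by auto
    next
      case False
      then have "bump R x \<noteq> 0" using bump_eq_0_iff[of R x] by blast
      then have "0 < bump R x" using bump_bounds(1)[of R x] by simp
      then have "0 \<le> 1 + - 1 * bump R x" "1 + - 1 * bump R x < 1" using bump_bounds(2)[of R x] by auto
      then have "(\<lambda>n. (1 + - 1 * bump R x) ^ n) \<longlonglongrightarrow> 0" by (rule LIMSEQ_realpow_zero)
      then have "(\<lambda>n. \<zeta> n x) \<longlonglongrightarrow> 1 + - 1 * 0" unfolding \<zeta>_def by (intro tendsto_add tendsto_mult tendsto_const)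
      moreover have inv: "(\<lambda>n. 1 / real (Suc n)) \<longlonglongrightarrow> 0" by (rule LIMSEQ_Suc[OF lim_1_over_n])
      have "e \<longlonglongrightarrow> 1 / (1 + 0)" unfolding e_def[abs_def] by (intro tendsto_intros inv) auto
      moreover have "(\<lambda>n. p n x) \<longlonglongrightarrow> f x"
      proof -
        have "(\<lambda>n. c n x) \<longlonglongrightarrow> max (- 1) (min 1 (f x))"
          unfolding c_def by (intro tendsto_intros lim x)
        then have "(\<lambda>n. c n x) \<longlonglongrightarrow> f x" using bd[of x] by (simp add: abs_le_iff)
        moreover have "(\<lambda>n. c n x - p n x) \<longlonglongrightarrow> 0"
        proof (rule Lim_null_comparison[OF always_eventually inv], rule allI)
          fix n
          have "x \<in> cube R" using False by (auto simp: cube_def not_le intro: less_imp_le)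
          then show "norm (c n x - p n x) \<le> 1 / real (Suc n)" using p_close[of x n] by simp
        qed
        ultimately have "(\<lambda>n. c n x - (c n x - p n x)) \<longlonglongrightarrow> f x - 0" by (rule tendsto_diff)
        then show ?thesis by simp
      qed
      ultimately have "(\<lambda>n. \<psi> n x) \<longlonglongrightarrow> 1 / (1 + 0) * ((1 + - 1 * 0) * f x)"
        unfolding \<psi>_def by (intro tendsto_mult)
      then show ?thesis by simp
    qed
    then show "AE x in lebesgue. (\<lambda>n. \<psi> n x) \<longlonglongrightarrow> f x"
      using N by (intro AE_I'[of N]) (auto simp: negligible_iff_null_sets)
  qed
qed

lemma locally_integrable_measurable:
  fixes g :: "real ^ 'n::finite \<Rightarrow> real"
  assumes "locally_integrable g" shows "g \<in> borel_measurable lebesgue"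
proof (rule borel_measurable_LIMSEQ_real)
  fix n :: nat
  have "set_integrable lebesgue (cball 0 (real n)) g" using assms by (simp add: locally_integrable_def)
  then show "(\<lambda>x. indicator (cball 0 (real n)) x *\<^sub>R g x) \<in> borel_measurable lebesgue"
    unfolding set_integrable_def by auto
next
  fix x :: "real ^ 'n"
  obtain m where "norm x < real m" using reals_Archimedean2 by blast
  then have "\<forall>\<^sub>F n in sequentially. indicator (cball 0 (real n)) x *\<^sub>R g x = g x"
    by (intro eventually_sequentiallyI[of m]) (auto simp: indicator_def)
  then show "(\<lambda>n. indicator (cball 0 (real n)) x *\<^sub>R g x) \<longlonglongrightarrow> g x" by (rule tendsto_eventually)
qed

lemma test_fun_measurable: "test_fun \<psi> \<Longrightarrow> \<psi> \<in> borel_measurable borel"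
  unfolding test_fun_def using Ck_continuous by (intro borel_measurable_continuous_onI) blast

lemma locally_integrable_cmult:
  fixes g \<psi> :: "real ^ 'n::finite \<Rightarrow> real"
  assumes g: "locally_integrable g" and \<psi> [measurable]: "\<psi> \<in> borel_measurable lebesgue"
    and bd: "\<And>x. \<bar>\<psi> x\<bar> \<le> M" and out: "\<And>x. R < norm x \<Longrightarrow> \<psi> x = 0"
  shows "integrable lebesgue (\<lambda>x. g x * \<psi> x)"
proof (rule Bochner_Integration.integrable_bound)
  have [measurable]: "g \<in> borel_measurable lebesgue" by (rule locally_integrable_measurable[OF g])
  have "set_integrable lebesgue (cball 0 R) g" using g by (simp add: locally_integrable_def)
  then show "integrable lebesgue (\<lambda>x. M * (indicator (cball 0 R) x *\<^sub>R g x))"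
    unfolding set_integrable_def by (intro integrable_mult_right)
  show "(\<lambda>x. g x * \<psi> x) \<in> borel_measurable lebesgue" by measurable
  show "AE x in lebesgue. norm (g x * \<psi> x) \<le> norm (M * (indicator (cball 0 R) x *\<^sub>R g x))"
  proof (rule AE_I2)
    fix x
    have "\<bar>\<psi> x\<bar> \<le> \<bar>M\<bar>" using bd[of x] by linarith
    then show "norm (g x * \<psi> x) \<le> norm (M * (indicator (cball 0 R) x *\<^sub>R g x))"
      using out[of x] by (cases "R < norm x") (auto simp: abs_mult mult.commute intro: mult_right_mono)
  qed
qed

lemma test_fun_mult_integrable:
  assumes "locally_integrable g" "test_fun \<psi>"
  shows "integrable lebesgue (\<lambda>x. g x * \<psi> x)"
proof -
  obtain M R where "\<And>x. \<bar>\<psi> x\<bar> \<le> M" "\<And>x. R < norm x \<Longrightarrow> \<psi> x = 0" using test_fun_bounded[OF assms(2)] by metis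
  then show ?thesis
    using test_fun_measurable[OF assms(2)] by (intro locally_integrable_cmult[OF assms(1)] measurable_completion) auto
qed

lemma locally_integrable_const: "locally_integrable (\<lambda>x :: real ^ 'n::finite. c)"
  unfolding locally_integrable_def set_integrable_def
proof (intro allI impI)
  fix C :: "(real ^ 'n) set" assume "compact C"
  then have "C \<in> lmeasurable" by (rule lmeasurable_compact)
  then have "integrable lebesgue (indicator C :: _ \<Rightarrow> real)" by (intro integrable_real_indicator) (auto simp: fmeasurable_def)
  then show "integrable lebesgue (\<lambda>x. indicator C x *\<^sub>R c)" by simp
qed

lemma test_fun_abs_integrable:
  assumes "test_fun \<psi>" shows "integrable lebesgue (\<lambda>x. \<bar>\<psi> x\<bar>)"
  using test_fun_mult_integrable[OF locally_integrable_const[of 1] assms] by (intro integrable_abs) simp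

text \<open>
  If \<open>g\<close> acts on test functions with the bound \<open>a + b \<parallel>\<psi>\<parallel>\<^sub>1\<close>, then by dominated convergence the
  same bound holds for the sign of \<open>g\<close> restricted to a bounded measurable set. It is the bridge
  from distributions to rearrangements.
\<close>

lemma test_fun_bound_imp_set_bound:
  fixes g :: "real ^ 'n::finite \<Rightarrow> real"
  assumes g: "locally_integrable g" and ab: "0 \<le> a" "0 \<le> b"
    and bd: "\<And>\<psi>. test_fun \<psi> \<Longrightarrow> (\<And>x. \<bar>\<psi> x\<bar> \<le> 1) \<Longrightarrow> \<bar>LINT x|lebesgue. g x * \<psi> x\<bar> \<le> a + b * (LINT x|lebesgue. \<bar>\<psi> x\<bar>)"
    and E [measurable]: "E \<in> sets lebesgue"
  shows "(\<integral>\<^sup>+x\<in>E. ennreal \<bar>g x\<bar> \<partial>lebesgue) \<le> ennreal a + ennreal b * emeasure lebesgue E"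
proof -
  have [measurable]: "g \<in> borel_measurable lebesgue" by (rule locally_integrable_measurable[OF g])
  define Q where "Q n = {x :: real ^ 'n. \<forall>i. \<bar>x $ i\<bar> < real n}" for n
  have Q_box: "Q n = box (- (\<chi> i. real n)) (\<chi> i. real n)" for n
    by (auto simp: Q_def mem_box_cart abs_less_iff minus_less_iff)
  have [measurable]: "Q n \<in> sets lebesgue" for n unfolding Q_box by simp
  have main: "(\<integral>\<^sup>+x\<in>E \<inter> Q m. ennreal \<bar>g x\<bar> \<partial>lebesgue) \<le> ennreal a + ennreal b * emeasure lebesgue E" for m
  proof -
    define f where "f x = sgn (g x) * indicator (E \<inter> Q m) x" for x
    have [measurable]: "f \<in> borel_measurable lebesgue" unfolding f_def[abs_def] by measurable
    have "\<bar>f x\<bar> \<le> 1" for x by (auto simp: f_def indicator_def sgn_real_def)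
    moreover have "f x = 0" if "real m \<le> \<bar>x $ i\<bar>" for x i
    proof -
      have "x \<notin> Q m" using that by (auto simp: Q_def not_less)
      then show ?thesis by (simp add: f_def)
    qed
    ultimately obtain \<psi> where \<psi>: "\<And>n. test_fun (\<psi> n)" "\<And>n x. \<bar>\<psi> n x\<bar> \<le> 1" "\<And>n x. x \<notin> cube (real m) \<Longrightarrow> \<psi> n x = 0"
      and lim: "AE x in lebesgue. (\<lambda>n. \<psi> n x) \<longlonglongrightarrow> f x"
      using test_fun_approx[of f "real m" thesis] \<open>f \<in> borel_measurable lebesgue\<close> by blast
    have [measurable]: "\<psi> n \<in> borel_measurable lebesgue" for n
      using test_fun_measurable[OF \<psi>(1)] by (auto intro: measurable_completion)
    have K: "compact (cube (real m) :: (real ^ 'n) set)" unfolding cube_cbox by (rule compact_cbox)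
    have dom: "integrable lebesgue (\<lambda>x. indicator (cube (real m)) x * \<bar>h x\<bar>)" if "locally_integrable h" for h :: "real ^ 'n \<Rightarrow> real"
    proof -
      have "integrable lebesgue (\<lambda>x. \<bar>indicator (cube (real m)) x *\<^sub>R h x\<bar>)"
        using that K unfolding locally_integrable_def set_integrable_def by (intro integrable_abs) auto
      then show ?thesis by (simp add: abs_mult)
    qed
    have conv: "(\<lambda>n. LINT x|lebesgue. h x * \<psi> n x) \<longlonglongrightarrow> (LINT x|lebesgue. h x * f x)" if h: "locally_integrable h" for h :: "real ^ 'n \<Rightarrow> real"
    proof (rule integral_dominated_convergence[OF _ _ dom[OF h]])
      have [measurable]: "h \<in> borel_measurable lebesgue" by (rule locally_integrable_measurable[OF h])
      show "(\<lambda>x. h x * f x) \<in> borel_measurable lebesgue" "\<And>n. (\<lambda>x. h x * \<psi> n x) \<in> borel_measurable lebesgue" by measurable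
      show "AE x in lebesgue. (\<lambda>n. h x * \<psi> n x) \<longlonglongrightarrow> h x * f x"
        using lim by eventually_elim (intro tendsto_intros)
      show "AE x in lebesgue. norm (h x * \<psi> n x) \<le> indicator (cube (real m)) x * \<bar>h x\<bar>" for n
        using \<psi>(2)[of n] \<psi>(3)[of _ n] by (intro AE_I2) (auto simp: indicator_def abs_mult mult_left_le)
    qed
    have conv_abs: "(\<lambda>n. LINT x|lebesgue. \<bar>\<psi> n x\<bar>) \<longlonglongrightarrow> (LINT x|lebesgue. \<bar>f x\<bar>)"
    proof (rule integral_dominated_convergence[OF _ _ dom[OF locally_integrable_const[of 1]]])
      show "(\<lambda>x. \<bar>f x\<bar>) \<in> borel_measurable lebesgue" "\<And>n. (\<lambda>x. \<bar>\<psi> n x\<bar>) \<in> borel_measurable lebesgue" by measurable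
      show "AE x in lebesgue. (\<lambda>n. \<bar>\<psi> n x\<bar>) \<longlonglongrightarrow> \<bar>f x\<bar>"
        using lim by eventually_elim (intro tendsto_intros)
      show "AE x in lebesgue. norm \<bar>\<psi> n x\<bar> \<le> indicator (cube (real m)) x * \<bar>1::real\<bar>" for n
        using \<psi>(2)[of n] \<psi>(3)[of _ n] by (intro AE_I2) (auto simp: indicator_def)
    qed
    have le: "LINT x|lebesgue. g x * f x \<le> a + b * (LINT x|lebesgue. \<bar>f x\<bar>)"
    proof (rule LIMSEQ_le)
      show "(\<lambda>n. LINT x|lebesgue. g x * \<psi> n x) \<longlonglongrightarrow> (LINT x|lebesgue. g x * f x)" by (rule conv[OF g])
      show "(\<lambda>n. a + b * (LINT x|lebesgue. \<bar>\<psi> n x\<bar>)) \<longlonglongrightarrow> a + b * (LINT x|lebesgue. \<bar>f x\<bar>)"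
        by (intro tendsto_intros conv_abs)
      show "\<exists>N. \<forall>n\<ge>N. (LINT x|lebesgue. g x * \<psi> n x) \<le> a + b * (LINT x|lebesgue. \<bar>\<psi> n x\<bar>)"
        using bd[OF \<psi>(1) \<psi>(2)] abs_le_D1 by blast
    qed
    have gf: "g x * f x = \<bar>g x\<bar> * indicator (E \<inter> Q m) x" for x
      by (simp add: f_def abs_sgn mult.assoc)
    have gf_int: "integrable lebesgue (\<lambda>x. g x * f x)"
    proof (rule Bochner_Integration.integrable_bound[OF dom[OF g]])
      show "AE x in lebesgue. norm (g x * f x) \<le> norm (indicator (cube (real m)) x * \<bar>g x\<bar>)"
        unfolding gf by (intro AE_I2) (auto simp: indicator_def cube_def Q_def intro: less_imp_le)
    qed measurable
    have "(\<integral>\<^sup>+x\<in>E \<inter> Q m. ennreal \<bar>g x\<bar> \<partial>lebesgue) = (\<integral>\<^sup>+x. ennreal (g x * f x) \<partial>lebesgue)"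
      unfolding gf by (intro nn_integral_cong) (auto simp: indicator_def)
    also have "\<dots> = ennreal (LINT x|lebesgue. g x * f x)"
      using gf_int by (intro nn_integral_eq_integral) (auto simp: gf)
    finally have 1: "(\<integral>\<^sup>+x\<in>E \<inter> Q m. ennreal \<bar>g x\<bar> \<partial>lebesgue) \<le> ennreal (a + b * (LINT x|lebesgue. \<bar>f x\<bar>))"
      using le by (simp add: ennreal_leI)
    have "ennreal (LINT x|lebesgue. \<bar>f x\<bar>) \<le> (\<integral>\<^sup>+x. ennreal \<bar>f x\<bar> \<partial>lebesgue)"
    proof (cases "integrable lebesgue f")
      case True
      then show ?thesis by (subst nn_integral_eq_integral) auto
    next
      case False
      then have "\<not> integrable lebesgue (\<lambda>x. \<bar>f x\<bar>)" by (simp add: integrable_abs_iff)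
      then show ?thesis by (simp add: not_integrable_integral_eq)
    qed
    also have "\<dots> \<le> (\<integral>\<^sup>+x. indicator E x \<partial>lebesgue)"
      by (intro nn_integral_mono) (auto simp: f_def indicator_def sgn_real_def)
    finally have "ennreal (LINT x|lebesgue. \<bar>f x\<bar>) \<le> emeasure lebesgue E" by simp
    then have "ennreal b * ennreal (LINT x|lebesgue. \<bar>f x\<bar>) \<le> ennreal b * emeasure lebesgue E" by (intro mult_left_mono) auto
    then have 2: "ennreal a + ennreal b * ennreal (LINT x|lebesgue. \<bar>f x\<bar>) \<le> ennreal a + ennreal b * emeasure lebesgue E"
      by (intro add_left_mono)
    have "ennreal (a + b * (LINT x|lebesgue. \<bar>f x\<bar>)) = ennreal a + ennreal b * ennreal (LINT x|lebesgue. \<bar>f x\<bar>)"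
      using ab by (simp add: ennreal_mult)
    with 1 2 show ?thesis by (simp only: order_trans)
  qed
  have "(\<integral>\<^sup>+x\<in>(\<Union>n. E \<inter> Q n). ennreal \<bar>g x\<bar> \<partial>lebesgue) \<le> ennreal a + ennreal b * emeasure lebesgue E"
    by (rule nn_integral_le_exhaustion[OF _ _ _ main]) (auto simp: incseq_def Q_def intro: less_le_trans)
  moreover have "(\<Union>n. E \<inter> Q n) = E"
  proof -
    have "\<exists>n. x \<in> Q n" for x :: "real ^ 'n"
    proof -
      obtain n where "norm x < real n" using reals_Archimedean2 by blast
      then show ?thesis unfolding Q_def using component_le_norm_cart[of x] le_less_trans by blast
    qed
    then show ?thesis by auto
  qed
  ultimately show ?thesis by simp
qed

section \<open>Weak derivatives and oscillation\<close>

text \<open>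
  The difference annihilates all test functions, so test_fun_bound_imp_set_bound applies with \<open>a
  = b = 0\<close>.
\<close>

lemma weak_deriv_unique:
  fixes f :: "real ^ 'n::finite \<Rightarrow> real"
  assumes "weak_deriv \<alpha> f g" "weak_deriv \<alpha> f g'"
  shows "AE x in lebesgue. g x = g' x"
proof -
  have li: "locally_integrable g" "locally_integrable g'" using assms by (auto simp: weak_deriv_def)
  then have [measurable]: "g \<in> borel_measurable lebesgue" "g' \<in> borel_measurable lebesgue"
    using locally_integrable_measurable by auto
  have d: "locally_integrable (\<lambda>x. g x - g' x)"
    using li by (auto simp: locally_integrable_def intro: set_integral_diff)
  have "\<bar>LINT x|lebesgue. (g x - g' x) * \<psi> x\<bar> \<le> 0 + 0 * (LINT x|lebesgue. \<bar>\<psi> x\<bar>)" if "test_fun \<psi>" for \<psi>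
  proof -
    have "(-1) ^ mi_order \<alpha> * (LINT x|lebesgue. g x * \<psi> x) = (-1) ^ mi_order \<alpha> * (LINT x|lebesgue. g' x * \<psi> x)"
      using assms that unfolding weak_deriv_def by metis
    then have "(LINT x|lebesgue. g x * \<psi> x) = (LINT x|lebesgue. g' x * \<psi> x)" by simp
    then show ?thesis using li that by (simp add: left_diff_distrib test_fun_mult_integrable)
  qed
  from test_fun_bound_imp_set_bound[OF d order.refl order.refl this, of UNIV]
  have "(\<integral>\<^sup>+x. ennreal \<bar>g x - g' x\<bar> \<partial>lebesgue) = 0" by simp
  then have "AE x in lebesgue. ennreal \<bar>g x - g' x\<bar> = 0" by (subst (asm) nn_integral_0_iff_AE) auto
  then show ?thesis by eventually_elim (simp add: ennreal_eq_0_iff)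
qed

definition weak_partial :: "'n::finite \<Rightarrow> (real ^ 'n \<Rightarrow> real) \<Rightarrow> (real ^ 'n \<Rightarrow> real) \<Rightarrow> bool" where
  "weak_partial i f g \<longleftrightarrow> locally_integrable f \<and> locally_integrable g \<and>
     (\<forall>\<phi>. test_fun \<phi> \<longrightarrow> (LINT x|lebesgue. f x * partial i \<phi> x) = - (LINT x|lebesgue. g x * \<phi> x))"

text \<open>Test with \<open>\<partial>\<^sub>i \<phi>\<close> in the definition of \<open>D\<^sup>\<alpha> f\<close>.\<close>

lemma weak_deriv_chain:
  fixes f :: "real ^ 'n::finite \<Rightarrow> real"
  assumes "weak_deriv \<alpha> f g" "weak_deriv (\<alpha>(i := Suc (\<alpha> i))) f h"
  shows "weak_partial i g h"
  unfolding weak_partial_def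
proof (intro conjI allI impI)
  fix \<phi> :: "real ^ 'n \<Rightarrow> real" assume \<phi>: "test_fun \<phi>"
  have "(-1) ^ mi_order \<alpha> * (LINT x|lebesgue. g x * partial i \<phi> x) = (LINT x|lebesgue. f x * mi_deriv \<alpha> (partial i \<phi>) x)"
    using assms(1) test_fun_partial[OF \<phi>] by (simp add: weak_deriv_def)
  also have "\<dots> = (LINT x|lebesgue. f x * mi_deriv (\<alpha>(i := Suc (\<alpha> i))) \<phi> x)"
    by (simp add: mi_deriv_Suc[OF test_fun_smooth[OF \<phi>]])
  also have "\<dots> = (-1) ^ mi_order \<alpha> * - (LINT x|lebesgue. h x * \<phi> x)"
    using assms(2) \<phi> by (simp add: weak_deriv_def mi_order_Suc)
  finally show "(LINT x|lebesgue. g x * partial i \<phi> x) = - (LINT x|lebesgue. h x * \<phi> x)"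
    by (subst (asm) mult_left_cancel) auto
qed (use assms in \<open>auto simp: weak_deriv_def\<close>)

lemma weak_deriv_diff:
  fixes f :: "real ^ 'n::finite \<Rightarrow> real"
  assumes "weak_deriv \<alpha> f g" "weak_deriv \<alpha> f' g'"
  shows "weak_deriv \<alpha> (\<lambda>x. f x - f' x) (\<lambda>x. g x - g' x)"
  unfolding weak_deriv_def
proof (intro conjI allI impI)
  have li: "locally_integrable f" "locally_integrable f'" "locally_integrable g" "locally_integrable g'"
    using assms by (auto simp: weak_deriv_def)
  show "locally_integrable (\<lambda>x. f x - f' x)" "locally_integrable (\<lambda>x. g x - g' x)"
    using li by (auto simp: locally_integrable_def intro: set_integral_diff)
  fix \<phi> :: "real ^ 'n \<Rightarrow> real" assume \<phi>: "test_fun \<phi>"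
  have "test_fun (mi_deriv \<alpha> \<phi>)"
  proof -
    have pow: "test_fun ((partial i ^^ m) \<phi>)" if "test_fun \<phi>" for i m and \<phi> :: "real ^ 'n \<Rightarrow> real"
      using that by (induction m) (auto intro: test_fun_partial)
    have "test_fun (foldr (\<lambda>i. partial i ^^ \<alpha> i) xs \<phi>)" for xs
      using \<phi> by (induction xs) (auto intro: pow)
    then show ?thesis by (simp add: mi_deriv_def)
  qed
  then show "(LINT x|lebesgue. (f x - f' x) * mi_deriv \<alpha> \<phi> x) = (-1) ^ mi_order \<alpha> * (LINT x|lebesgue. (g x - g' x) * \<phi> x)"
    using assms li \<phi> by (simp add: left_diff_distrib test_fun_mult_integrable weak_deriv_def right_diff_distrib)
qed

lemma weak_partial_cong_AE:
  fixes f :: "real ^ 'n::finite \<Rightarrow> real"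
  assumes "weak_partial i f g" and eq: "AE x in lebesgue. f x = f' x" and [measurable]: "f' \<in> borel_measurable lebesgue"
  shows "weak_partial i f' g"
proof -
  have lf: "locally_integrable f" using assms by (simp add: weak_partial_def)
  then have [measurable]: "f \<in> borel_measurable lebesgue" by (rule locally_integrable_measurable)
  have "locally_integrable f'"
    unfolding locally_integrable_def set_integrable_def
  proof (intro allI impI)
    fix C :: "(real ^ 'n) set" assume "compact C"
    then have C: "C \<in> sets lebesgue" using lmeasurable_compact by blast
    have "integrable lebesgue (\<lambda>x. indicator C x *\<^sub>R f x)"
      using lf \<open>compact C\<close> by (simp add: locally_integrable_def set_integrable_def)
    then show "integrable lebesgue (\<lambda>x. indicator C x *\<^sub>R f' x)"
      by (rule integrable_cong_AE_imp) (use eq C in \<open>auto\<close>)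
  qed
  moreover have "(LINT x|lebesgue. f' x * partial i \<phi> x) = (LINT x|lebesgue. f x * partial i \<phi> x)" if "test_fun \<phi>" for \<phi>
  proof (rule integral_cong_AE)
    have [measurable]: "partial i \<phi> \<in> borel_measurable lebesgue"
      using test_fun_measurable[OF test_fun_partial[OF that]] by (auto intro: measurable_completion)
    show "(\<lambda>x. f' x * partial i \<phi> x) \<in> borel_measurable lebesgue" "(\<lambda>x. f x * partial i \<phi> x) \<in> borel_measurable lebesgue"
      by measurable
  qed (use eq in auto)
  ultimately show ?thesis using assms(1) by (simp add: weak_partial_def)
qed

subsection \<open>Translation estimate\<close>

lemma nn_integral_translate:
  fixes f :: "real ^ 'n::finite \<Rightarrow> ennreal"
  assumes [measurable]: "f \<in> borel_measurable borel"
  shows "(\<integral>\<^sup>+x. f (x + a) \<partial>lborel) = (\<integral>\<^sup>+x. f x \<partial>lborel)"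
proof -
  have "(\<integral>\<^sup>+x. f x \<partial>lborel) = (\<integral>\<^sup>+x. f x \<partial>(distr lborel borel ((+) a)))" by (simp add: lborel_distr_plus)
  also have "\<dots> = (\<integral>\<^sup>+x. f (x + a) \<partial>lborel)" by (simp add: nn_integral_distr add.commute)
  finally show ?thesis by simp
qed

lemma integral_translate:
  fixes f :: "real ^ 'n::finite \<Rightarrow> real"
  assumes [measurable]: "f \<in> borel_measurable borel"
  shows "(LINT x|lebesgue. f (x + a)) = (LINT x|lebesgue. f x)"
proof -
  have "(LINT x|lborel. f x) = (LINT x|(distr lborel borel ((+) a)). f x)" by (simp add: lborel_distr_plus)
  also have "\<dots> = (LINT x|lborel. f (x + a))" by (subst integral_distr) (auto simp: add.commute)
  finally show ?thesis by (simp add: integral_completion)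
qed

lemma locally_integrable_translate:
  fixes f :: "real ^ 'n::finite \<Rightarrow> real"
  assumes f: "locally_integrable f" and [measurable]: "f \<in> borel_measurable borel"
  shows "locally_integrable (\<lambda>x. f (x + a))"
  unfolding locally_integrable_def set_integrable_def
proof (intro allI impI)
  fix C :: "(real ^ 'n) set" assume C: "compact C"
  let ?C = "(\<lambda>x. x + a) ` C"
  have C': "compact ?C" using C by (intro compact_continuous_image continuous_intros)
  then have [measurable]: "?C \<in> sets borel" "C \<in> sets borel" using C by (auto intro: borel_compact)
  have "integrable lborel (\<lambda>x. indicator ?C x *\<^sub>R f x)"
  proof (subst integrable_completion[symmetric])
    show "integrable lebesgue (\<lambda>x. indicator ?C x *\<^sub>R f x)"
      using f C' unfolding locally_integrable_def set_integrable_def by blast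
  qed measurable
  then have "integrable (distr lborel borel ((+) a)) (\<lambda>x. indicator ?C x *\<^sub>R f x)" by (simp add: lborel_distr_plus)
  then have "integrable lborel (\<lambda>x. indicator ?C (a + x) *\<^sub>R f (a + x))" by (subst (asm) integrable_distr_eq) auto
  moreover have "indicator ?C (a + x) = (indicator C x :: real)" for x
    by (auto simp: indicator_def image_iff add.commute)
  ultimately show "integrable lebesgue (\<lambda>x. indicator C x *\<^sub>R f (x + a))"
    by (simp add: integrable_completion add.commute)
qed

lemma test_pairing_bound:
  fixes g \<psi> :: "real ^ 'n::finite \<Rightarrow> real"
  assumes g: "locally_integrable g" and \<psi>: "test_fun \<psi>" "\<And>x. \<bar>\<psi> x\<bar> \<le> 1" and y: "0 \<le> y" and a: "excess g y = ennreal a" "0 \<le> a"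
  shows "\<bar>LINT x|lebesgue. g x * \<psi> x\<bar> \<le> a + y * (LINT x|lebesgue. \<bar>\<psi> x\<bar>)"
proof -
  have [measurable]: "g \<in> borel_measurable lebesgue" by (rule locally_integrable_measurable[OF g])
  have [measurable]: "\<psi> \<in> borel_measurable lebesgue"
    using test_fun_measurable[OF \<psi>(1)] by (auto intro: measurable_completion)
  have int: "integrable lebesgue (\<lambda>x. g x * \<psi> x)" by (rule test_fun_mult_integrable[OF g \<psi>(1)])
  have int': "integrable lebesgue (\<lambda>x. \<bar>\<psi> x\<bar>)" by (rule test_fun_abs_integrable[OF \<psi>(1)])
  have "ennreal (LINT x|lebesgue. \<bar>g x * \<psi> x\<bar>) = (\<integral>\<^sup>+x. ennreal \<bar>g x * \<psi> x\<bar> \<partial>lebesgue)"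
    using int by (intro nn_integral_eq_integral[symmetric] integrable_abs) auto
  also have "\<dots> \<le> excess g y + ennreal y * (\<integral>\<^sup>+x. ennreal \<bar>\<psi> x\<bar> \<partial>lebesgue)"
    using \<psi> y by (intro nn_integral_abs_mult_le_excess) auto
  also have "(\<integral>\<^sup>+x. ennreal \<bar>\<psi> x\<bar> \<partial>lebesgue) = ennreal (LINT x|lebesgue. \<bar>\<psi> x\<bar>)"
    using int' by (intro nn_integral_eq_integral) auto
  also have "excess g y + ennreal y * ennreal (LINT x|lebesgue. \<bar>\<psi> x\<bar>) = ennreal (a + y * (LINT x|lebesgue. \<bar>\<psi> x\<bar>))"
    using a y by (simp add: ennreal_mult)
  finally have "(LINT x|lebesgue. \<bar>g x * \<psi> x\<bar>) \<le> a + y * (LINT x|lebesgue. \<bar>\<psi> x\<bar>)"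
    using a y by (subst (asm) ennreal_le_iff) auto
  then show ?thesis using integral_abs_bound[of lebesgue "\<lambda>x. g x * \<psi> x"] by linarith
qed

text \<open>
  Differentiation under the integral sign; the difference quotients of \<open>\<psi>\<close> are bounded by the
  maximum of its derivative and live in a fixed ball.
\<close>

lemma pairing_has_derivative:
  fixes h :: "real ^ 'n::finite \<Rightarrow> real"
  assumes h: "locally_integrable h" and \<psi>: "test_fun \<psi>"
  shows "((\<lambda>s. LINT y|lebesgue. h y * \<psi> (y + s *\<^sub>R axis i 1)) has_real_derivative
     (LINT y|lebesgue. h y * partial i \<psi> (y + s *\<^sub>R axis i 1))) (at s)"
proof -
  have [measurable]: "h \<in> borel_measurable lebesgue" by (rule locally_integrable_measurable[OF h])
  have [measurable]: "(\<lambda>y. \<psi> (y + a)) \<in> borel_measurable lebesgue" "(\<lambda>y. partial i \<psi> (y + a)) \<in> borel_measurable lebesgue" for a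
    using test_fun_measurable[OF test_fun_translate[OF \<psi>, of a]]
      test_fun_measurable[OF test_fun_translate[OF test_fun_partial[OF \<psi>], of i a]] by (auto intro: measurable_completion)
  obtain M0 R where R: "0 < R" and out: "\<And>x. R < norm x \<Longrightarrow> \<psi> x = 0" using test_fun_bounded[OF \<psi>] by metis
  obtain M where M: "\<And>x. \<bar>partial i \<psi> x\<bar> \<le> M" using test_fun_bounded[OF test_fun_partial[OF \<psi>]] by metis
  have diff: "\<And>x. \<psi> differentiable (at x)" using \<psi> unfolding test_fun_def by (metis Ck.simps(2))
  have der: "((\<lambda>s. \<psi> (y + s *\<^sub>R axis i 1)) has_real_derivative partial i \<psi> (y + s *\<^sub>R axis i 1)) (at s)" for y s
    by (rule has_derivative_along_axis[OF diff])
  have lip: "\<bar>\<psi> (y + s' *\<^sub>R axis i 1) - \<psi> (y + s *\<^sub>R axis i 1)\<bar> \<le> M * \<bar>s' - s\<bar>" for y s s'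
  proof -
    have "norm (\<psi> (y + s' *\<^sub>R axis i 1) - \<psi> (y + s *\<^sub>R axis i 1)) \<le> M * norm (s' - s)"
      by (rule field_differentiable_bound[of UNIV "\<lambda>s. \<psi> (y + s *\<^sub>R axis i 1)" "\<lambda>s. partial i \<psi> (y + s *\<^sub>R axis i 1)"])
         (use der M in \<open>auto\<close>)
    then show ?thesis by simp
  qed
  show ?thesis
    unfolding has_field_derivative_iff tendsto_at_iff_sequentially
  proof (intro allI impI)
    fix X :: "nat \<Rightarrow> real" assume X: "\<forall>n. X n \<in> UNIV - {s}" "X \<longlonglongrightarrow> s"
    obtain T where "\<forall>n. norm (X n) \<le> T" using convergent_imp_Bseq[OF convergentI[OF X(2)]] by (rule BseqE)
    then have T: "\<And>n. \<bar>X n\<bar> \<le> T" by simp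
    let ?q = "\<lambda>n y. (\<psi> (y + X n *\<^sub>R axis i 1) - \<psi> (y + s *\<^sub>R axis i 1)) / (X n - s)"
    have int: "integrable lebesgue (\<lambda>y. h y * \<psi> (y + a))" for a
      by (rule test_fun_mult_integrable[OF h test_fun_translate[OF \<psi>]])
    have eq: "((LINT y|lebesgue. h y * \<psi> (y + X n *\<^sub>R axis i 1)) - (LINT y|lebesgue. h y * \<psi> (y + s *\<^sub>R axis i 1))) / (X n - s)
        = (LINT y|lebesgue. h y * ?q n y)" for n
      using int by (simp add: right_diff_distrib diff_divide_distrib)
    have "(\<lambda>n. LINT y|lebesgue. h y * ?q n y) \<longlonglongrightarrow> (LINT y|lebesgue. h y * partial i \<psi> (y + s *\<^sub>R axis i 1))"
    proof (rule integral_dominated_convergence)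
      define B where "B = R + max T \<bar>s\<bar>"
      show "integrable lebesgue (\<lambda>y. \<bar>M * (indicator (cball 0 B) y *\<^sub>R h y)\<bar>)"
        using h unfolding locally_integrable_def set_integrable_def by (intro integrable_abs integrable_mult_right) auto
      show "AE y in lebesgue. (\<lambda>n. h y * ?q n y) \<longlonglongrightarrow> h y * partial i \<psi> (y + s *\<^sub>R axis i 1)"
      proof (rule AE_I2)
        fix y
        have "(\<lambda>n. ?q n y) \<longlonglongrightarrow> partial i \<psi> (y + s *\<^sub>R axis i 1)"
          using der[of y s] X
          unfolding has_field_derivative_iff tendsto_at_iff_sequentially by (auto simp: o_def)
        then show "(\<lambda>n. h y * ?q n y) \<longlonglongrightarrow> h y * partial i \<psi> (y + s *\<^sub>R axis i 1)" by (intro tendsto_intros)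
      qed
      show "AE y in lebesgue. norm (h y * ?q n y) \<le> \<bar>M * (indicator (cball 0 B) y *\<^sub>R h y)\<bar>" for n
      proof (rule AE_I2)
        fix y
        have M0: "0 \<le> M" using M[of 0] by linarith
        show "norm (h y * ?q n y) \<le> \<bar>M * (indicator (cball 0 B) y *\<^sub>R h y)\<bar>"
        proof (cases "norm y \<le> B")
          case True
          have "\<bar>?q n y\<bar> \<le> M" using lip[of y "X n" s] X(1) by (simp add: divide_le_eq)
          then have "\<bar>h y\<bar> * \<bar>?q n y\<bar> \<le> \<bar>h y\<bar> * M" by (intro mult_left_mono) auto
          then show ?thesis using True M0 by (simp add: abs_mult mult.commute)
        next
          case False
          have "R < norm (y + a *\<^sub>R axis i 1)" if "\<bar>a\<bar> \<le> max T \<bar>s\<bar>" for a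
          proof -
            have "norm y \<le> norm (y + a *\<^sub>R axis i 1) + norm (a *\<^sub>R axis i (1::real) :: real ^ 'n)"
              using norm_triangle_ineq4[of "y + a *\<^sub>R axis i 1" "a *\<^sub>R axis i 1"] by simp
            then show ?thesis using False that by (simp add: B_def)
          qed
          then have "\<psi> (y + X n *\<^sub>R axis i 1) = 0" "\<psi> (y + s *\<^sub>R axis i 1) = 0"
            using T[of n] by (auto intro!: out)
          then show ?thesis by simp
        qed
      qed
    qed measurable
    then show "((\<lambda>s'. ((LINT y|lebesgue. h y * \<psi> (y + s' *\<^sub>R axis i 1)) - (LINT y|lebesgue. h y * \<psi> (y + s *\<^sub>R axis i 1))) / (s' - s)) \<circ> X)
        \<longlonglongrightarrow> (LINT y|lebesgue. h y * partial i \<psi> (y + s *\<^sub>R axis i 1))"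
      by (simp add: o_def eq)
  qed
qed

text \<open>
  Move the translation to the test function. The pairing is then differentiable in the length of
  the translation, and its derivative is the pairing of \<open>- g\<close> with a translated test function;
  the mean value theorem and the density of test functions do the rest.
\<close>

lemma translate_axis_bound:
  fixes h g :: "real ^ 'n::finite \<Rightarrow> real"
  assumes wp: "weak_partial i h g" and hb [measurable]: "h \<in> borel_measurable borel"
    and y: "0 \<le> y" and a: "excess g y = ennreal a" "0 \<le> a" and c: "0 \<le> c" and E: "E \<in> sets lebesgue"
  shows "(\<integral>\<^sup>+x\<in>E. ennreal \<bar>h (x + c *\<^sub>R axis i 1) - h x\<bar> \<partial>lebesgue)
     \<le> ennreal (c * a) + ennreal (c * y) * emeasure lebesgue E"
proof (rule test_fun_bound_imp_set_bound)
  let ?v = "c *\<^sub>R axis i 1 :: real ^ 'n"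
  have h: "locally_integrable h" and g: "locally_integrable g" using wp by (auto simp: weak_partial_def)
  have ht: "locally_integrable (\<lambda>x. h (x + ?v))" by (rule locally_integrable_translate[OF h hb])
  show "locally_integrable (\<lambda>x. h (x + ?v) - h x)"
    using h ht by (auto simp: locally_integrable_def intro: set_integral_diff)
  fix \<psi> :: "real ^ 'n \<Rightarrow> real" assume \<psi>: "test_fun \<psi>" "\<And>x. \<bar>\<psi> x\<bar> \<le> 1"
  have [measurable]: "\<psi> \<in> borel_measurable borel" by (rule test_fun_measurable[OF \<psi>(1)])
  define \<Phi> where "\<Phi> s = (LINT y|lebesgue. h y * \<psi> (y + s *\<^sub>R axis i 1))" for s
  have der: "(\<Phi> has_real_derivative (LINT y|lebesgue. h y * partial i \<psi> (y + s *\<^sub>R axis i 1))) (at s)" for s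
    unfolding \<Phi>_def[abs_def] by (rule pairing_has_derivative[OF h \<psi>(1)])
  have bound: "\<bar>LINT y|lebesgue. h y * partial i \<psi> (y + s *\<^sub>R axis i 1)\<bar> \<le> a + y * (LINT x|lebesgue. \<bar>\<psi> x\<bar>)" for s
  proof -
    let ?\<psi> = "\<lambda>z. \<psi> (z + s *\<^sub>R axis i 1)"
    have t: "test_fun ?\<psi>" by (rule test_fun_translate[OF \<psi>(1)])
    have "partial i ?\<psi> = (\<lambda>z. partial i \<psi> (z + s *\<^sub>R axis i 1))"
      using \<psi>(1) unfolding test_fun_def by (intro partial_translate) (metis Ck.simps(2))
    then have "(LINT y|lebesgue. h y * partial i \<psi> (y + s *\<^sub>R axis i 1)) = - (LINT x|lebesgue. g x * ?\<psi> x)"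
      using wp t unfolding weak_partial_def by metis
    moreover have "\<bar>LINT x|lebesgue. g x * ?\<psi> x\<bar> \<le> a + y * (LINT x|lebesgue. \<bar>?\<psi> x\<bar>)"
      by (rule test_pairing_bound[OF g t \<psi>(2) y a])
    moreover have "(LINT x|lebesgue. \<bar>?\<psi> x\<bar>) = (LINT x|lebesgue. \<bar>\<psi> x\<bar>)"
      by (rule integral_translate) measurable
    ultimately show ?thesis by simp
  qed
  have "norm (\<Phi> (- c) - \<Phi> 0) \<le> (a + y * (LINT x|lebesgue. \<bar>\<psi> x\<bar>)) * norm (- c - 0)"
    by (rule field_differentiable_bound[of UNIV \<Phi> "\<lambda>s. LINT y|lebesgue. h y * partial i \<psi> (y + s *\<^sub>R axis i 1)"])
       (use der bound in \<open>auto\<close>)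
  moreover have "(LINT x|lebesgue. (h (x + ?v) - h x) * \<psi> x) = \<Phi> (- c) - \<Phi> 0"
  proof -
    have "(LINT x|lebesgue. (h (x + ?v) - h x) * \<psi> x) = (LINT x|lebesgue. h (x + ?v) * \<psi> x) - (LINT x|lebesgue. h x * \<psi> x)"
      using h ht \<psi>(1) by (simp add: left_diff_distrib test_fun_mult_integrable)
    also have "(LINT x|lebesgue. h (x + ?v) * \<psi> x) = (LINT x|lebesgue. (\<lambda>z. h z * \<psi> (z - ?v)) (x + ?v))" by simp
    also have "\<dots> = (LINT x|lebesgue. h x * \<psi> (x - ?v))" by (rule integral_translate) measurable
    finally show ?thesis by (simp add: \<Phi>_def)
  qed
  ultimately show "\<bar>LINT x|lebesgue. (h (x + ?v) - h x) * \<psi> x\<bar> \<le> c * a + c * y * (LINT x|lebesgue. \<bar>\<psi> x\<bar>)"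
    using c by (simp add: algebra_simps)
qed (use a y c E in auto)

text \<open>
  A translation in the direction of the cube \<open>[0, \<epsilon>]\<^sup>n\<close> is a composition of translations along
  the axes.
\<close>

lemma translate_bound:
  fixes h :: "real ^ 'n::finite \<Rightarrow> real"
  assumes wp: "\<And>i. weak_partial i h (g i)" and hb [measurable]: "h \<in> borel_measurable borel"
    and t: "0 < t" and E [measurable]: "E \<in> sets borel" and Et: "emeasure lborel E \<le> ennreal t"
    and v: "\<And>i. 0 \<le> v $ i" "\<And>i. v $ i \<le> \<epsilon>"
  shows "(\<integral>\<^sup>+x\<in>E. ennreal \<bar>h (x + v) - h x\<bar> \<partial>lborel) \<le> ennreal (\<epsilon> * t) * (\<Sum>i\<in>UNIV. rearr_avg (g i) t)"
proof -
  have \<epsilon>: "0 \<le> \<epsilon>" using v order_trans by blast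
  have step: "(\<integral>\<^sup>+x\<in>F. ennreal \<bar>h (x + c *\<^sub>R axis i 1) - h x\<bar> \<partial>lborel) \<le> ennreal (\<epsilon> * t) * rearr_avg (g i) t"
    if F [measurable]: "F \<in> sets borel" and Ft: "emeasure lborel F \<le> ennreal t" and c: "0 \<le> c" "c \<le> \<epsilon>" for i c F
  proof (cases "\<epsilon> = 0 \<or> rearr_avg (g i) t = top")
    case True
    then show ?thesis using c t \<epsilon> by (cases "\<epsilon> = 0") (auto simp: ennreal_mult_top)
  next
    case False
    have gm [measurable]: "g i \<in> borel_measurable lebesgue"
      using wp[of i] by (auto simp: weak_partial_def intro: locally_integrable_measurable)
    have "rearr (g i) t \<noteq> top" using False rearr_le_rearr_avg[OF t, of "g i"] by (auto simp: top_unique)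
    then obtain y where y: "rearr (g i) t = ennreal y" "0 \<le> y" by (cases "rearr (g i) t") auto
    have avg: "rearr_avg (g i) t = ennreal (1 / t) * excess (g i) y + ennreal y"
      by (rule rearr_avg_eq_excess[OF gm t y])
    then have "excess (g i) y \<noteq> top" using False t by (auto simp: ennreal_mult_top)
    then obtain a where a: "excess (g i) y = ennreal a" "0 \<le> a" by (cases "excess (g i) y") auto
    have "(\<integral>\<^sup>+x\<in>F. ennreal \<bar>h (x + c *\<^sub>R axis i 1) - h x\<bar> \<partial>lborel) \<le> ennreal (c * a) + ennreal (c * y) * emeasure lebesgue F"
      using translate_axis_bound[OF wp hb y(2) a c(1), of F] F by (simp add: nn_integral_completion)
    also have "\<dots> \<le> ennreal (c * a) + ennreal (c * y) * ennreal t"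
      using Ft by (intro add_left_mono mult_left_mono) auto
    also have "\<dots> = ennreal (c * (a + y * t))"
      using a y c t by (simp add: ennreal_mult[symmetric] ennreal_plus[symmetric] algebra_simps del: ennreal_plus)
    also have "\<dots> \<le> ennreal (\<epsilon> * (a + y * t))"
      using a y c t by (intro ennreal_leI mult_right_mono) auto
    also have "\<dots> = ennreal (\<epsilon> * t) * rearr_avg (g i) t"
      using a y t \<epsilon> by (simp add: avg ennreal_mult[symmetric] ennreal_plus[symmetric] field_simps del: ennreal_plus)
    finally show ?thesis .
  qed
  have "(\<integral>\<^sup>+x\<in>E. ennreal \<bar>h (x + (\<Sum>i\<in>S. (v $ i) *\<^sub>R axis i 1)) - h x\<bar> \<partial>lborel) \<le> ennreal (\<epsilon> * t) * (\<Sum>i\<in>S. rearr_avg (g i) t)"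
    if "finite S" for S :: "'n set"
    using that
  proof (induction S rule: finite_induct)
    case empty
    then show ?case by simp
  next
    case (insert i S)
    let ?w = "\<Sum>i\<in>S. (v $ i) *\<^sub>R axis i (1::real)" and ?e = "(v $ i) *\<^sub>R axis i (1::real)"
    have "(\<integral>\<^sup>+x\<in>E. ennreal \<bar>h (x + (\<Sum>i\<in>insert i S. (v $ i) *\<^sub>R axis i 1)) - h x\<bar> \<partial>lborel)
      \<le> (\<integral>\<^sup>+x. ennreal \<bar>h (x + ?w + ?e) - h (x + ?w)\<bar> * indicator E x + ennreal \<bar>h (x + ?w) - h x\<bar> * indicator E x \<partial>lborel)"
    proof (intro nn_integral_mono)
      fix x
      have 1: "x + (\<Sum>i\<in>insert i S. (v $ i) *\<^sub>R axis i 1) = x + ?w + ?e" using insert by (simp add: add_ac)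
      have 2: "ennreal \<bar>h (x + ?w + ?e) - h x\<bar> \<le> ennreal \<bar>h (x + ?w + ?e) - h (x + ?w)\<bar> + ennreal \<bar>h (x + ?w) - h x\<bar>"
        by (simp add: ennreal_plus[symmetric] del: ennreal_plus)
      show "ennreal \<bar>h (x + (\<Sum>i\<in>insert i S. (v $ i) *\<^sub>R axis i 1)) - h x\<bar> * indicator E x
        \<le> ennreal \<bar>h (x + ?w + ?e) - h (x + ?w)\<bar> * indicator E x + ennreal \<bar>h (x + ?w) - h x\<bar> * indicator E x"
        unfolding 1 distrib_right[symmetric] by (intro mult_right_mono 2) auto
    qed
    also have "\<dots> = (\<integral>\<^sup>+x\<in>E. ennreal \<bar>h (x + ?w + ?e) - h (x + ?w)\<bar> \<partial>lborel) + (\<integral>\<^sup>+x\<in>E. ennreal \<bar>h (x + ?w) - h x\<bar> \<partial>lborel)"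
      by (rule nn_integral_add) measurable
    also have "(\<integral>\<^sup>+x\<in>E. ennreal \<bar>h (x + ?w) - h x\<bar> \<partial>lborel) \<le> ennreal (\<epsilon> * t) * (\<Sum>i\<in>S. rearr_avg (g i) t)" by (rule insert.IH)
    also have "(\<integral>\<^sup>+x\<in>E. ennreal \<bar>h (x + ?w + ?e) - h (x + ?w)\<bar> \<partial>lborel) \<le> ennreal (\<epsilon> * t) * rearr_avg (g i) t"
    proof -
      let ?F = "(\<lambda>x. x - ?w) -` E"
      have F [measurable]: "?F \<in> sets borel" by (rule measurable_sets_borel[OF _ E]) measurable
      have "(\<integral>\<^sup>+x\<in>E. ennreal \<bar>h (x + ?w + ?e) - h (x + ?w)\<bar> \<partial>lborel)
          = (\<integral>\<^sup>+x. (\<lambda>z. ennreal \<bar>h (z + ?e) - h z\<bar> * indicator ?F z) (x + ?w) \<partial>lborel)"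
        by (intro nn_integral_cong) (auto simp: indicator_def)
      also have "\<dots> = (\<integral>\<^sup>+x\<in>?F. ennreal \<bar>h (x + ?e) - h x\<bar> \<partial>lborel)"
        by (rule nn_integral_translate) measurable
      also have "\<dots> \<le> ennreal (\<epsilon> * t) * rearr_avg (g i) t"
      proof (rule step[OF F])
        have "emeasure lborel ?F = (\<integral>\<^sup>+x. indicator ?F x \<partial>lborel)" using F by simp
        also have "\<dots> = (\<integral>\<^sup>+x. indicator ?F (x + ?w) \<partial>lborel)" by (rule nn_integral_translate[symmetric]) measurable
        also have "\<dots> = (\<integral>\<^sup>+x. indicator E x \<partial>lborel)" by (intro nn_integral_cong) (auto simp: indicator_def)
        finally show "emeasure lborel ?F \<le> ennreal t" using Et by simp
      qed (use v in auto)
      finally show ?thesis .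
    qed
    finally show ?case using insert by (simp add: distrib_left add_mono)
  qed
  from this[of UNIV] show ?thesis
    by (simp add: basis_expansion[of v, unfolded scalar_mult_eq_scaleR])
qed

text \<open>
  Put \<open>y = h\<^sup>*(t)\<close> and let \<open>Q\<close> be a cube of measure \<open>2t\<close>. Since \<open>|h| > y\<close> holds on a set of
  measure at most \<open>t\<close>, in each translate \<open>x + Q\<close> at least measure \<open>t\<close> is left where \<open>|h| \<le> y\<close>.
  Hence \<open>t (|h x| - y)\<close> is at most the integral of \<open>|h (x + v) - h x|\<close> over \<open>v\<close> in \<open>Q\<close>.
  Integrating over the set where \<open>|h| > y\<close> and applying the translation bound for each \<open>v\<close> gives
  the claim.
\<close>

lemma oscillation_le_gradient:
  fixes h :: "real ^ 'n::finite \<Rightarrow> real"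
  assumes wp: "\<And>i. weak_partial i h (g i)" and t: "0 < t" and fin: "rearr h t < top"
  shows "rearr_avg h t - rearr h t
    \<le> ennreal (2 * (2 * t) powr (1 / real CARD('n))) * (\<Sum>i\<in>UNIV. rearr_avg (g i) t)"
proof -
  have hm: "h \<in> borel_measurable lebesgue"
    using wp by (auto simp: weak_partial_def intro: locally_integrable_measurable)
  obtain k where k [measurable]: "k \<in> borel_measurable lborel" and hk: "AE x in lborel. h x = k x"
    using completion_ex_borel_measurable_real[of h lborel] hm by auto
  have k': "k \<in> borel_measurable borel" using k by simp
  have km: "k \<in> borel_measurable lebesgue" using k by (rule measurable_completion)
  have hk': "AE x in lebesgue. h x = k x" using hk by (rule AE_completion)
  have wpk: "weak_partial i k (g i)" for i by (rule weak_partial_cong_AE[OF wp hk' km])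
  have same: "rearr h = rearr k" "rearr_avg h = rearr_avg k"
    using hk' hm km by (auto intro!: rearr_cong_AE rearr_avg_cong_AE)
  obtain y where y: "rearr k t = ennreal y" "0 \<le> y" using fin same by (cases "rearr k t") auto
  define \<epsilon> where "\<epsilon> = (2 * t) powr (1 / real CARD('n))"
  have \<epsilon>: "0 < \<epsilon>" using t by (simp add: \<epsilon>_def)
  let ?D = "\<Sum>i\<in>UNIV. rearr_avg (g i) t"
  define Q where "Q = cbox (0 :: real ^ 'n) (\<chi> i. \<epsilon>)"
  have [measurable]: "Q \<in> sets borel" by (simp add: Q_def)
  have Q_meas: "emeasure lborel Q = ennreal (2 * t)"
  proof -
    have "emeasure lborel Q = ennreal (\<Prod>b\<in>Basis. ((\<chi> i. \<epsilon>) - (0 :: real ^ 'n)) \<bullet> b)"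
      unfolding Q_def using \<epsilon> by (intro emeasure_lborel_cbox) (auto simp: Basis_vec_def inner_axis)
    also have "(\<Prod>b\<in>Basis. ((\<chi> i. \<epsilon>) - (0 :: real ^ 'n)) \<bullet> b) = (\<Prod>b\<in>(Basis :: (real ^ 'n) set). \<epsilon>)"
      by (intro prod.cong) (auto simp: Basis_vec_def inner_axis)
    also have "\<dots> = \<epsilon> ^ CARD('n)" by simp
    also have "\<dots> = 2 * t" using t by (simp add: \<epsilon>_def powr_realpow[symmetric] powr_powr)
    finally show ?thesis .
  qed
  define E where "E = {x. y < \<bar>k x\<bar>}"
  have E [measurable]: "E \<in> sets borel" unfolding E_def by measurable
  have Et: "emeasure lborel E \<le> ennreal t"
  proof -
    have "distrib k (ennreal y) \<le> ennreal t" using rearr_le_iff[OF km, of t "ennreal y"] y by simp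
    then show ?thesis using y E by (simp add: distrib_def ennreal_less_iff E_def[symmetric])
  qed
  have point: "ennreal t * ennreal (\<bar>k x\<bar> - y) \<le> (\<integral>\<^sup>+u\<in>Q. ennreal \<bar>k (x + u) - k x\<bar> \<partial>lborel)" for x
  proof -
    let ?P = "Q - ((+) x) -` E"
    have P [measurable]: "((+) x) -` E \<in> sets borel" by (rule measurable_sets_borel[OF _ E]) measurable
    have Pt: "emeasure lborel (((+) x) -` E) \<le> ennreal t"
    proof -
      have "emeasure lborel (((+) x) -` E) = (\<integral>\<^sup>+u. indicator (((+) x) -` E) u \<partial>lborel)" using P by simp
      also have "\<dots> = (\<integral>\<^sup>+u. indicator E (u + x) \<partial>lborel)" by (intro nn_integral_cong) (auto simp: indicator_def add.commute)
      also have "\<dots> = (\<integral>\<^sup>+u. indicator E u \<partial>lborel)" by (rule nn_integral_translate) measurable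
      finally show ?thesis using Et by simp
    qed
    have "ennreal (2 * t) \<le> emeasure lborel (?P \<union> ((+) x) -` E)"
      unfolding Q_meas[symmetric] by (intro emeasure_mono) auto
    also have "\<dots> \<le> emeasure lborel ?P + emeasure lborel (((+) x) -` E)" by (intro emeasure_subadditive) auto
    also have "\<dots> \<le> emeasure lborel ?P + ennreal t" using Pt by (intro add_left_mono)
    finally have "ennreal t + ennreal t \<le> ennreal t + emeasure lborel ?P"
      using t by (simp add: ennreal_plus[symmetric] add.commute del: ennreal_plus)
    then have Pt': "ennreal t \<le> emeasure lborel ?P" by (subst (asm) ennreal_add_left_cancel_le) auto
    have "ennreal t * ennreal (\<bar>k x\<bar> - y) \<le> emeasure lborel ?P * ennreal (\<bar>k x\<bar> - y)"
      by (intro mult_right_mono Pt') auto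
    also have "\<dots> = (\<integral>\<^sup>+u. ennreal (\<bar>k x\<bar> - y) * indicator ?P u \<partial>lborel)"
      by (simp add: nn_integral_cmult mult.commute)
    also have "\<dots> \<le> (\<integral>\<^sup>+u\<in>Q. ennreal \<bar>k (x + u) - k x\<bar> \<partial>lborel)"
    proof (intro nn_integral_mono)
      fix u
      show "ennreal (\<bar>k x\<bar> - y) * indicator ?P u \<le> ennreal \<bar>k (x + u) - k x\<bar> * indicator Q u"
        by (cases "u \<in> ?P") (auto simp: E_def not_less intro!: ennreal_leI)
    qed
    finally show ?thesis .
  qed
  have "ennreal t * excess k y = (\<integral>\<^sup>+x. ennreal t * ennreal (\<bar>k x\<bar> - y) \<partial>lborel)"
    unfolding excess_def nn_integral_completion by (rule nn_integral_cmult[symmetric]) measurable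
  also have "\<dots> \<le> (\<integral>\<^sup>+x. (\<integral>\<^sup>+u. ennreal \<bar>k (x + u) - k x\<bar> * indicator Q u * indicator E x \<partial>lborel) \<partial>lborel)"
  proof (intro nn_integral_mono)
    fix x
    show "ennreal t * ennreal (\<bar>k x\<bar> - y) \<le> (\<integral>\<^sup>+u. ennreal \<bar>k (x + u) - k x\<bar> * indicator Q u * indicator E x \<partial>lborel)"
      using point[of x] by (cases "x \<in> E") (auto simp: E_def ennreal_neg)
  qed
  also have "\<dots> = (\<integral>\<^sup>+u. (\<integral>\<^sup>+x. ennreal \<bar>k (x + u) - k x\<bar> * indicator Q u * indicator E x \<partial>lborel) \<partial>lborel)"
    by (rule lborel_pair.Fubini') measurable
  also have "\<dots> \<le> (\<integral>\<^sup>+u. ennreal (\<epsilon> * t) * ?D * indicator Q u \<partial>lborel)"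
  proof (intro nn_integral_mono)
    fix u
    show "(\<integral>\<^sup>+x. ennreal \<bar>k (x + u) - k x\<bar> * indicator Q u * indicator E x \<partial>lborel) \<le> ennreal (\<epsilon> * t) * ?D * indicator Q u"
    proof (cases "u \<in> Q")
      case True
      then have "0 \<le> u $ i" "u $ i \<le> \<epsilon>" for i by (auto simp: Q_def mem_box_cart)
      then show ?thesis using True translate_bound[OF wpk k' t E Et, of u \<epsilon>] by simp
    qed simp
  qed
  also have "\<dots> = ennreal (\<epsilon> * t) * ?D * ennreal (2 * t)" by (simp add: nn_integral_cmult Q_meas)
  finally have main: "ennreal t * excess k y \<le> ennreal (\<epsilon> * t) * ?D * ennreal (2 * t)" .
  have "rearr_avg k t - rearr k t = ennreal (1 / t) * excess k y"
    unfolding y(1) rearr_avg_eq_excess[OF km t y] by simp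
  also have "\<dots> = ennreal (1 / (t * t)) * (ennreal t * excess k y)"
    using t by (simp add: mult.assoc[symmetric] ennreal_mult[symmetric])
  also have "\<dots> \<le> ennreal (1 / (t * t)) * (ennreal (\<epsilon> * t) * ?D * ennreal (2 * t))"
    by (intro mult_left_mono main) auto
  also have "\<dots> = ennreal (1 / (t * t)) * ennreal (\<epsilon> * t) * ennreal (2 * t) * ?D" by (simp only: mult_ac)
  also have "ennreal (1 / (t * t)) * ennreal (\<epsilon> * t) * ennreal (2 * t) = ennreal (2 * \<epsilon>)"
    using t \<epsilon> by (simp add: ennreal_mult[symmetric])
  finally show ?thesis unfolding same \<epsilon>_def .
qed

section \<open>Weighted energies and Sobolev inequalities\<close>

definition osc :: "(real ^ 'n::finite \<Rightarrow> real) \<Rightarrow> real \<Rightarrow> ennreal" where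
  "osc f t = rearr_avg f t - rearr f t"

lemma osc_le_avg: "osc f t \<le> rearr_avg f t"
  unfolding osc_def by (rule diff_le_self_ennreal)

lemma osc_measurable [measurable]:
  assumes [measurable]: "f \<in> borel_measurable lebesgue"
  shows "osc f \<in> borel_measurable borel"
  unfolding osc_def[abs_def] by measurable

context hardy_weight begin

text \<open>
  The \<open>r\<close>-th power of the functional of \<open>\<Lambda>\<^sub>r(w)\<close>. Powers are kept throughout, because then
  constants may be lost in sums.
\<close>

definition lam :: "(real ^ 'n::finite \<Rightarrow> real) \<Rightarrow> ennreal" where
  "lam f = (\<integral>\<^sup>+s\<in>{0<..}. epowr (rearr f s) r * u s \<partial>lborel)"

text \<open>
  For \<open>a = 0\<close> this is equivalent to \<open>lam\<close>, but subadditive up to a constant; the exponent \<open>a\<close> is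
  \<open>l/n\<close> in the iteration over the order \<open>l\<close> of differentiation.
\<close>

definition avg_energy :: "real \<Rightarrow> (real ^ 'n::finite \<Rightarrow> real) \<Rightarrow> ennreal" where
  "avg_energy a f = (\<integral>\<^sup>+s\<in>{0<..}. epowr (ennreal (s powr (- a)) * rearr_avg f s) r * u s \<partial>lborel)"

text \<open>
  For \<open>c = 1\<close> and \<open>a = m/n\<close> this is the \<open>r\<close>-th power of the functional of the oscillation class
  with weight \<open>w v\<close>. The dilation \<open>c = 2\<close> is needed because the oscillation of a sum is
  controlled at doubled argument.
\<close>

definition osc_energy :: "real \<Rightarrow> real \<Rightarrow> (real ^ 'n::finite \<Rightarrow> real) \<Rightarrow> ennreal" where
  "osc_energy c a f = (\<integral>\<^sup>+s\<in>{0<..}. epowr (ennreal (s powr (- a)) * osc f (c * s)) r * u s \<partial>lborel)"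

lemma avg_energy_0: "avg_energy 0 f = (\<integral>\<^sup>+s\<in>{0<..}. epowr (rearr_avg f s) r * u s \<partial>lborel)"
  unfolding avg_energy_def by (intro nn_integral_cong) (auto simp: indicator_def)

lemma avg_energy_le_lam:
  "\<exists>C>0. \<forall>f :: real ^ 'n::finite \<Rightarrow> real. f \<in> borel_measurable lebesgue \<longrightarrow> avg_energy 0 f \<le> ennreal C * lam f"
proof -
  obtain C where C: "C > 0" "\<And>D. D \<in> borel_measurable borel \<Longrightarrow> (\<forall>s t. 0 < s \<longrightarrow> s \<le> t \<longrightarrow> D t \<le> D s) \<Longrightarrow>
    (\<integral>\<^sup>+t\<in>{0<..}. epowr (ennreal (1 / t) * (\<integral>\<^sup>+s\<in>{0<..<t}. D s \<partial>lborel)) r * u t \<partial>lborel)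
      \<le> ennreal C * (\<integral>\<^sup>+t\<in>{0<..}. epowr (D t) r * u t \<partial>lborel)"
    using hardy_average by blast
  have "avg_energy 0 f \<le> ennreal C * lam f" if [measurable]: "f \<in> borel_measurable lebesgue" for f :: "real ^ 'n \<Rightarrow> real"
    unfolding avg_energy_0 lam_def rearr_avg_def nn_integral_completion
    by (rule C(2)) (auto intro: rearr_antimono)
  then show ?thesis using C(1) by blast
qed

lemma lam_le_avg_energy: "lam f \<le> avg_energy 0 f"
  unfolding avg_energy_0 lam_def
proof (intro nn_integral_mono)
  fix s show "epowr (rearr f s) r * u s * indicator {0<..} s \<le> epowr (rearr_avg f s) r * u s * indicator {0<..} s"
    using r by (cases "0 < s") (auto intro!: mult_right_mono epowr_mono rearr_le_rearr_avg)
qed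

lemma lam_finite_imp:
  assumes f [measurable]: "f \<in> borel_measurable lebesgue" and fin: "lam f < top"
  shows lam_finite_imp_avg_energy: "avg_energy 0 f < top"
    and lam_finite_imp_avg: "0 < t \<Longrightarrow> rearr_avg f t < top"
    and lam_finite_imp_small: "0 < e \<Longrightarrow> \<exists>T>0. rearr_avg f T < ennreal e"
proof -
  obtain C where "avg_energy 0 f \<le> ennreal C * lam f" using avg_energy_le_lam f by blast
  then show J: "avg_energy 0 f < top" using fin by (auto simp: ennreal_mult_less_top intro: le_less_trans)
  have le: "epowr (rearr_avg f t) r * W t \<le> avg_energy 0 f" if "0 < t" for t
  proof -
    have "epowr (rearr_avg f t) r * W t = (\<integral>\<^sup>+s. epowr (rearr_avg f t) r * (u s * indicator {0<..<t} s) \<partial>lborel)"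
      unfolding W_def by (rule nn_integral_cmult[symmetric]) simp
    also have "\<dots> \<le> avg_energy 0 f"
      unfolding avg_energy_0
    proof (intro nn_integral_mono)
      fix s
      show "epowr (rearr_avg f t) r * (u s * indicator {0<..<t} s) \<le> epowr (rearr_avg f s) r * u s * indicator {0<..} s"
        using r rearr_avg_antimono[OF f, of s t] that
        by (cases "s \<in> {0<..<t}") (auto intro!: mult_right_mono epowr_mono)
    qed
    finally show ?thesis .
  qed
  show "rearr_avg f t < top" if t: "0 < t" for t
  proof (rule ccontr)
    assume "\<not> ?thesis"
    then have "rearr_avg f t = top" using top.not_eq_extremum by blast
    then have "top \<le> avg_energy 0 f" using le[OF t] W_pos[OF t] by (auto simp: ennreal_top_mult split: if_splits)
    with J show False by simp
  qed
  show "\<exists>T>0. rearr_avg f T < ennreal e" if e: "0 < e"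
  proof (rule ccontr)
    assume "\<not> ?thesis"
    then have ge: "ennreal e \<le> rearr_avg f T" if "0 < T" for T using that by (meson not_le)
    have "ennreal (e powr r) * W T \<le> avg_energy 0 f" if T: "0 < T" for T
    proof -
      have "epowr (ennreal e) r * W T \<le> epowr (rearr_avg f T) r * W T"
        using r by (intro mult_right_mono epowr_mono ge T) auto
      then show ?thesis using le[OF T] e by (auto intro: order_trans)
    qed
    moreover obtain T where T: "0 < T" "ennreal (1 / e powr r) * avg_energy 0 f < W T"
      using W_unbounded[of "ennreal (1 / e powr r) * avg_energy 0 f"] J by (auto simp: ennreal_mult_less_top)
    ultimately have "ennreal (1 / e powr r) * (ennreal (e powr r) * W T) \<le> ennreal (1 / e powr r) * avg_energy 0 f"
      by (intro mult_left_mono) auto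
    moreover have "ennreal (1 / e powr r) * (ennreal (e powr r) * W T) = W T"
      using e by (simp add: mult.assoc[symmetric] ennreal_mult[symmetric])
    ultimately show False using T(2) by simp
  qed
qed

lemma lam_finite_imp_rearr:
  assumes "f \<in> borel_measurable lebesgue" "lam f < top" "0 < t" shows "rearr f t < top"
  using lam_finite_imp_avg[OF assms] rearr_le_rearr_avg[OF assms(3), of f] by (rule le_less_trans[rotated])

lemma lam_finite_imp_tendsto:
  assumes f: "f \<in> borel_measurable lebesgue" and fin: "lam f < top"
  shows "(rearr f \<longlongrightarrow> 0) at_top"
proof (rule order_tendstoI)
  fix a :: ennreal assume "0 < a"
  obtain e where e: "0 < e" "ennreal e < a"
  proof (cases a)
    case (real x)
    then show ?thesis using that[of "x / 2"] \<open>0 < a\<close> by (auto simp: ennreal_less_iff)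
  next
    case top
    then show ?thesis using that[of 1] by simp
  qed
  obtain T where T: "0 < T" "rearr_avg f T < ennreal e" using lam_finite_imp_small[OF f fin e(1)] by auto
  have "rearr f t < a" if "T \<le> t" for t
    using rearr_antimono[OF that, of f] rearr_le_rearr_avg[OF T(1), of f] T(2) e(2) by (meson le_less_trans less_trans)
  then show "\<forall>\<^sub>F t in at_top. rearr f t < a" by (auto simp: eventually_at_top_linorder)
qed simp

lemma avg_energy_add:
  assumes [measurable]: "f \<in> borel_measurable lebesgue" "g \<in> borel_measurable lebesgue"
  shows "avg_energy 0 (\<lambda>x. f x + g x) \<le> ennreal (2 powr r) * (avg_energy 0 f + avg_energy 0 g)"
proof -
  have "avg_energy 0 (\<lambda>x. f x + g x) \<le> (\<integral>\<^sup>+s. ennreal (2 powr r) * (epowr (rearr_avg f s) r * u s * indicator {0<..} s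
      + epowr (rearr_avg g s) r * u s * indicator {0<..} s) \<partial>lborel)"
    unfolding avg_energy_0
  proof (intro nn_integral_mono)
    fix s
    show "epowr (rearr_avg (\<lambda>x. f x + g x) s) r * u s * indicator {0<..} s
      \<le> ennreal (2 powr r) * (epowr (rearr_avg f s) r * u s * indicator {0<..} s + epowr (rearr_avg g s) r * u s * indicator {0<..} s)"
    proof (cases "0 < s")
      case True
      have "epowr (rearr_avg (\<lambda>x. f x + g x) s) r \<le> epowr (rearr_avg f s + rearr_avg g s) r"
        using True r by (intro epowr_mono rearr_avg_add_le) auto
      also have "\<dots> \<le> ennreal (2 powr r) * (epowr (rearr_avg f s) r + epowr (rearr_avg g s) r)"
        using r by (intro epowr_add_le) auto
      finally have "epowr (rearr_avg (\<lambda>x. f x + g x) s) r * u s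
         \<le> ennreal (2 powr r) * (epowr (rearr_avg f s) r + epowr (rearr_avg g s) r) * u s" by (intro mult_right_mono) auto
      then show ?thesis using True by (simp add: distrib_left distrib_right mult.assoc)
    qed simp
  qed
  also have "\<dots> = ennreal (2 powr r) * (avg_energy 0 f + avg_energy 0 g)"
    unfolding avg_energy_0 by (subst nn_integral_cmult, simp, subst nn_integral_add) auto
  finally show ?thesis .
qed

lemma avg_energy_uminus: "avg_energy a (\<lambda>x. - f x) = avg_energy a f"
  unfolding avg_energy_def rearr_avg_uminus ..

lemma lam_diff:
  "\<exists>C>0. \<forall>f g :: real ^ 'n::finite \<Rightarrow> real. f \<in> borel_measurable lebesgue \<longrightarrow> g \<in> borel_measurable lebesgue \<longrightarrow>
     avg_energy 0 (\<lambda>x. f x - g x) \<le> ennreal C * (lam f + lam g)"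
proof -
  obtain C where C: "C > 0" "\<And>f :: real ^ 'n \<Rightarrow> real. f \<in> borel_measurable lebesgue \<Longrightarrow> avg_energy 0 f \<le> ennreal C * lam f"
    using avg_energy_le_lam by blast
  have "avg_energy 0 (\<lambda>x. f x - g x) \<le> ennreal (2 powr r * C) * (lam f + lam g)"
    if [measurable]: "f \<in> borel_measurable lebesgue" "g \<in> borel_measurable lebesgue" for f g :: "real ^ 'n \<Rightarrow> real"
  proof -
    have "avg_energy 0 (\<lambda>x. f x + - g x) \<le> ennreal (2 powr r) * (avg_energy 0 f + avg_energy 0 (\<lambda>x. - g x))"
      by (rule avg_energy_add) auto
    also have "\<dots> \<le> ennreal (2 powr r) * (ennreal C * lam f + ennreal C * lam g)"
      unfolding avg_energy_uminus by (intro mult_left_mono add_mono C(2)) auto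
    finally show ?thesis using C(1) by (simp add: ennreal_mult distrib_left mult.assoc)
  qed
  then show ?thesis using C(1) by (intro exI[of _ "2 powr r * C"]) auto
qed

subsection \<open>Sobolev inequalities\<close>

text \<open>The constant absorbs the dilation.\<close>

lemma osc_le_gradient:
  fixes h :: "real ^ 'n::finite \<Rightarrow> real"
  assumes wp: "\<And>i. weak_partial i h (g i)" and fin: "lam h < top" and s: "0 < s" and c: "1 \<le> c" "c \<le> 2"
  shows "osc h (c * s) \<le> ennreal (8 * s powr (1 / real CARD('n))) * (\<Sum>i\<in>UNIV. rearr_avg (g i) s)"
proof -
  let ?b = "1 / real CARD('n)"
  have hm: "h \<in> borel_measurable lebesgue" and gm: "g i \<in> borel_measurable lebesgue" for i
    using wp by (auto simp: weak_partial_def intro: locally_integrable_measurable)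
  have cs: "0 < c * s" "s \<le> c * s" using s c by auto
  have "osc h (c * s) \<le> ennreal (2 * (2 * (c * s)) powr ?b) * (\<Sum>i\<in>UNIV. rearr_avg (g i) (c * s))"
    unfolding osc_def by (rule oscillation_le_gradient[OF wp cs(1) lam_finite_imp_rearr[OF hm fin cs(1)]])
  also have "\<dots> \<le> ennreal (8 * s powr ?b) * (\<Sum>i\<in>UNIV. rearr_avg (g i) s)"
  proof (rule mult_mono[OF ennreal_leI sum_mono[OF rearr_avg_antimono[OF gm s cs(2)]]])
    have "(2 * (c * s)) powr ?b \<le> (4 * s) powr ?b" using s c by (intro powr_mono2) auto
    also have "\<dots> = 4 powr ?b * s powr ?b" using s by (simp add: powr_mult)
    also have "\<dots> \<le> 4 powr 1 * s powr ?b" by (intro mult_right_mono powr_mono) (auto simp: Suc_leI)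
    finally show "2 * (2 * (c * s)) powr ?b \<le> 8 * s powr ?b" by simp
  qed auto
  finally show ?thesis .
qed

text \<open>
  Since \<open>h\<^sup>*\<^sup>*(s) \<le> 2 (h\<^sup>*\<^sup>* - h\<^sup>*)(2s) + h\<^sup>*\<^sup>*(2s)\<close>, doubling \<open>s\<close> repeatedly sums the
  oscillations over a dyadic sequence, and \<open>h\<^sup>*\<^sup>*\<close> vanishes at infinity. Each oscillation is
  bounded by the gradient and spread over a dyadic interval, on which the average of the
  gradient is larger.
\<close>

lemma avg_le_potential:
  fixes h :: "real ^ 'n::finite \<Rightarrow> real"
  assumes wp: "\<And>i. weak_partial i h (g i)" and fin: "lam h < top" and s: "0 < s"
  shows "rearr_avg h s \<le> ennreal 64 * (\<integral>\<^sup>+x\<in>{s<..}. ennreal (x powr (1 / real CARD('n) - 1)) * (\<Sum>i\<in>UNIV. rearr_avg (g i) x) \<partial>lborel)"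
proof -
  let ?b = "1 / real CARD('n)"
  let ?D = "\<lambda>x. \<Sum>i\<in>UNIV. rearr_avg (g i) x"
  let ?F = "\<lambda>x. ennreal (x powr (?b - 1)) * ?D x"
  have hm: "h \<in> borel_measurable lebesgue" and gm [measurable]: "g i \<in> borel_measurable lebesgue" for i
    using wp by (auto simp: weak_partial_def intro: locally_integrable_measurable)
  have b: "?b \<le> 1" by (simp add: Suc_leI)
  have step: "rearr_avg h s \<le> ennreal 64 * (\<integral>\<^sup>+x\<in>{s<..<2 * s}. ?F x \<partial>lborel) + rearr_avg h (2 * s)" if s: "0 < s" for s
  proof -
    have "ennreal s * (ennreal ((2 * s) powr (?b - 1)) * ?D (2 * s)) = (\<integral>\<^sup>+x\<in>{s<..<2 * s}. ennreal ((2 * s) powr (?b - 1)) * ?D (2 * s) \<partial>lborel)"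
      using s by (subst nn_integral_cmult_indicator) (auto simp: mult.commute)
    also have "\<dots> \<le> (\<integral>\<^sup>+x\<in>{s<..<2 * s}. ?F x \<partial>lborel)"
    proof (intro nn_integral_mono)
      fix x
      have "ennreal ((2 * s) powr (?b - 1)) * ?D (2 * s) \<le> ?F x" if "s < x" "x < 2 * s"
        using s that b by (intro mult_mono ennreal_leI powr_mono2' sum_mono rearr_avg_antimono gm) auto
      then show "ennreal ((2 * s) powr (?b - 1)) * ?D (2 * s) * indicator {s<..<2 * s} x \<le> ?F x * indicator {s<..<2 * s} x"
        by (auto simp: indicator_def)
    qed
    finally have I: "ennreal s * (ennreal ((2 * s) powr (?b - 1)) * ?D (2 * s)) \<le> (\<integral>\<^sup>+x\<in>{s<..<2 * s}. ?F x \<partial>lborel)" .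
    have "osc h (2 * s) \<le> ennreal (8 * (2 * s) powr ?b) * ?D (2 * s)"
      using osc_le_gradient[OF wp fin, of "2 * s" 1] s by simp
    also have "8 * (2 * s) powr ?b = 16 * s * (2 * s) powr (?b - 1)"
      using s by (simp add: powr_diff)
    also have "ennreal (16 * s * (2 * s) powr (?b - 1)) * ?D (2 * s) = ennreal 16 * (ennreal s * (ennreal ((2 * s) powr (?b - 1)) * ?D (2 * s)))"
      using s by (simp only: mult.assoc[symmetric] ennreal_mult[symmetric] mult_nonneg_nonneg powr_ge_zero less_imp_le zero_le_numeral)
    also have "\<dots> \<le> ennreal 16 * (\<integral>\<^sup>+x\<in>{s<..<2 * s}. ?F x \<partial>lborel)" by (intro mult_left_mono I) auto
    finally have o: "osc h (2 * s) \<le> ennreal 16 * (\<integral>\<^sup>+x\<in>{s<..<2 * s}. ?F x \<partial>lborel)" .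
    have "rearr_avg h s \<le> 2 * osc h (2 * s) + rearr h (2 * s)"
      unfolding osc_def by (rule rearr_avg_le_double[OF hm s lam_finite_imp_rearr[OF hm fin]]) (use s in simp)
    also have "\<dots> \<le> 2 * (ennreal 16 * (\<integral>\<^sup>+x\<in>{s<..<2 * s}. ?F x \<partial>lborel)) + rearr_avg h (2 * s)"
      using s by (intro add_mono mult_left_mono o rearr_le_rearr_avg) auto
    also have "2 * (ennreal 16 * (\<integral>\<^sup>+x\<in>{s<..<2 * s}. ?F x \<partial>lborel)) \<le> ennreal 64 * (\<integral>\<^sup>+x\<in>{s<..<2 * s}. ?F x \<partial>lborel)"
      by (simp add: mult.assoc[symmetric] mult_right_mono)
    finally show ?thesis by (simp add: add_right_mono)
  qed
  have iter: "rearr_avg h s \<le> ennreal 64 * (\<integral>\<^sup>+x\<in>{s<..<2 ^ N * s}. ?F x \<partial>lborel) + rearr_avg h (2 ^ N * s)" for N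
  proof (induction N)
    case (Suc N)
    have le: "s \<le> 2 ^ N * s" using s by simp
    have "rearr_avg h s \<le> ennreal 64 * (\<integral>\<^sup>+x\<in>{s<..<2 ^ N * s}. ?F x \<partial>lborel) + rearr_avg h (2 ^ N * s)" by (rule Suc)
    also have "\<dots> \<le> ennreal 64 * (\<integral>\<^sup>+x\<in>{s<..<2 ^ N * s}. ?F x \<partial>lborel)
       + (ennreal 64 * (\<integral>\<^sup>+x\<in>{2 ^ N * s<..<2 * (2 ^ N * s)}. ?F x \<partial>lborel) + rearr_avg h (2 * (2 ^ N * s)))"
      using s by (intro add_left_mono step) auto
    also have "\<dots> = ennreal 64 * ((\<integral>\<^sup>+x\<in>{s<..<2 ^ N * s}. ?F x \<partial>lborel) + (\<integral>\<^sup>+x\<in>{2 ^ N * s<..<2 * (2 ^ N * s)}. ?F x \<partial>lborel)) + rearr_avg h (2 * (2 ^ N * s))"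
      by (simp add: distrib_left add.assoc)
    also have "(\<integral>\<^sup>+x\<in>{s<..<2 ^ N * s}. ?F x \<partial>lborel) + (\<integral>\<^sup>+x\<in>{2 ^ N * s<..<2 * (2 ^ N * s)}. ?F x \<partial>lborel)
       = (\<integral>\<^sup>+x. ?F x * indicator {s<..<2 ^ N * s} x + ?F x * indicator {2 ^ N * s<..<2 * (2 ^ N * s)} x \<partial>lborel)"
      by (rule nn_integral_add[symmetric]) auto
    also have "\<dots> \<le> (\<integral>\<^sup>+x\<in>{s<..<2 * (2 ^ N * s)}. ?F x \<partial>lborel)"
    proof (intro nn_integral_mono)
      fix x
      have "?F x * indicator {s<..<p} x + ?F x * indicator {p<..<2 * p} x \<le> ?F x * indicator {s<..<2 * p} x" if "s \<le> p" for p :: real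
        using that s by (auto simp: indicator_def)
      from this[OF le] show "?F x * indicator {s<..<2 ^ N * s} x + ?F x * indicator {2 ^ N * s<..<2 * (2 ^ N * s)} x \<le> ?F x * indicator {s<..<2 * (2 ^ N * s)} x" .
    qed
    finally show ?case by (simp add: mult_left_mono add_right_mono mult.assoc)
  qed simp
  show ?thesis
  proof (rule ennreal_le_epsilon)
    fix e :: real assume e: "0 < e"
    obtain T where T: "0 < T" "rearr_avg h T < ennreal e" using lam_finite_imp_small[OF hm fin e] by auto
    obtain N where N: "T / s < 2 ^ N" using real_arch_pow[of 2 "T / s"] by auto
    then have "T \<le> 2 ^ N * s" using s by (simp add: field_simps)
    then have "rearr_avg h (2 ^ N * s) \<le> ennreal e"
      using rearr_avg_antimono[OF hm T(1), of "2 ^ N * s"] T(2) by auto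
    moreover have "(\<integral>\<^sup>+x\<in>{s<..<2 ^ N * s}. ?F x \<partial>lborel) \<le> (\<integral>\<^sup>+x\<in>{s<..}. ?F x \<partial>lborel)"
      by (intro nn_integral_mono) (auto simp: indicator_def)
    ultimately show "rearr_avg h s \<le> ennreal 64 * (\<integral>\<^sup>+x\<in>{s<..}. ?F x \<partial>lborel) + ennreal e"
      using iter[of N] by (meson add_mono mult_left_mono order_trans zero_le)
  qed
qed

lemma epowr_sum_energy:
  fixes g :: "'n::finite \<Rightarrow> real ^ 'n \<Rightarrow> real"
  assumes [measurable]: "\<And>i. g i \<in> borel_measurable lebesgue"
  shows "(\<integral>\<^sup>+s\<in>{0<..}. epowr (ennreal (s powr (- a)) * (\<Sum>i\<in>UNIV. rearr_avg (g i) s)) r * u s \<partial>lborel)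
     \<le> ennreal (real CARD('n) powr r) * (\<Sum>i\<in>UNIV. avg_energy a (g i))"
proof -
  have "(\<integral>\<^sup>+s\<in>{0<..}. epowr (ennreal (s powr (- a)) * (\<Sum>i\<in>UNIV. rearr_avg (g i) s)) r * u s \<partial>lborel)
     \<le> (\<integral>\<^sup>+s. ennreal (real CARD('n) powr r) * (\<Sum>i\<in>UNIV. epowr (ennreal (s powr (- a)) * rearr_avg (g i) s) r * u s * indicator {0<..} s) \<partial>lborel)"
  proof (intro nn_integral_mono)
    fix s
    have "epowr (ennreal (s powr (- a)) * (\<Sum>i\<in>UNIV. rearr_avg (g i) s)) r
       \<le> ennreal (real CARD('n) powr r) * (\<Sum>i\<in>UNIV. epowr (ennreal (s powr (- a)) * rearr_avg (g i) s) r)"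
      using r by (subst sum_distrib_left) (intro epowr_sum_le, auto)
    then have "epowr (ennreal (s powr (- a)) * (\<Sum>i\<in>UNIV. rearr_avg (g i) s)) r * (u s * indicator {0<..} s)
       \<le> ennreal (real CARD('n) powr r) * (\<Sum>i\<in>UNIV. epowr (ennreal (s powr (- a)) * rearr_avg (g i) s) r) * (u s * indicator {0<..} s)"
      by (intro mult_right_mono) auto
    then show "epowr (ennreal (s powr (- a)) * (\<Sum>i\<in>UNIV. rearr_avg (g i) s)) r * u s * indicator {0<..} s
       \<le> ennreal (real CARD('n) powr r) * (\<Sum>i\<in>UNIV. epowr (ennreal (s powr (- a)) * rearr_avg (g i) s) r * u s * indicator {0<..} s)"
      by (simp add: sum_distrib_right mult.assoc)
  qed
  also have "\<dots> = ennreal (real CARD('n) powr r) * (\<Sum>i\<in>UNIV. avg_energy a (g i))"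
    unfolding avg_energy_def by (subst nn_integral_cmult, simp, subst nn_integral_sum) auto
  finally show ?thesis .
qed

text \<open>
  One derivative is exchanged for the power \<open>1/n\<close>: the potential bound followed by the Hardy
  inequality for tails.
\<close>

lemma avg_energy_step:
  assumes a: "1 / real CARD('n::finite) \<le> a" "a * r \<le> q"
  shows "\<exists>C>0. \<forall>(h :: real ^ 'n \<Rightarrow> real) g. (\<forall>i. weak_partial i h (g i)) \<longrightarrow> lam h < top \<longrightarrow>
     avg_energy a h \<le> ennreal C * (\<Sum>i\<in>UNIV. avg_energy (a - 1 / real CARD('n)) (g i))"
proof -
  let ?b = "1 / real CARD('n)"
  obtain C where C: "C > 0" "\<And>D. D \<in> borel_measurable borel \<Longrightarrow> (\<forall>s t. 0 < s \<longrightarrow> s \<le> t \<longrightarrow> D t \<le> D s) \<Longrightarrow>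
    (\<integral>\<^sup>+t\<in>{0<..}. epowr (ennreal (t powr (- a)) * (\<integral>\<^sup>+s\<in>{t<..}. ennreal (s powr (?b - 1)) * D s \<partial>lborel)) r * u t \<partial>lborel)
      \<le> ennreal C * (\<integral>\<^sup>+t\<in>{0<..}. epowr (ennreal (t powr (?b - a)) * D t) r * u t \<partial>lborel)"
    using hardy_tail[OF a] by blast
  define C' where "C' = 64 powr r * (C * real CARD('n) powr r)"
  have "avg_energy a h \<le> ennreal C' * (\<Sum>i\<in>UNIV. avg_energy (a - ?b) (g i))"
    if wp: "\<forall>i. weak_partial i h (g i)" and fin: "lam h < top" for h :: "real ^ 'n \<Rightarrow> real" and g
  proof -
    have gm [measurable]: "g i \<in> borel_measurable lebesgue" for i
      using wp by (auto simp: weak_partial_def intro: locally_integrable_measurable)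
    let ?D = "\<lambda>x. \<Sum>i\<in>UNIV. rearr_avg (g i) x"
    let ?I = "\<lambda>t. \<integral>\<^sup>+x\<in>{t<..}. ennreal (x powr (?b - 1)) * ?D x \<partial>lborel"
    have [measurable]: "?I \<in> borel_measurable borel" by (simp add: indicator_def[abs_def])
    have "avg_energy a h \<le> (\<integral>\<^sup>+t. ennreal (64 powr r) * (epowr (ennreal (t powr (- a)) * ?I t) r * u t * indicator {0<..} t) \<partial>lborel)"
      unfolding avg_energy_def
    proof (intro nn_integral_mono)
      fix t :: real
      show "epowr (ennreal (t powr (- a)) * rearr_avg h t) r * u t * indicator {0<..} t
         \<le> ennreal (64 powr r) * (epowr (ennreal (t powr (- a)) * ?I t) r * u t * indicator {0<..} t)"
      proof (cases "0 < t")
        case True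
        have "epowr (ennreal (t powr (- a)) * rearr_avg h t) r \<le> epowr (ennreal (t powr (- a)) * (ennreal 64 * ?I t)) r"
          using r avg_le_potential[of h g t] wp fin True by (intro epowr_mono mult_left_mono) auto
        also have "\<dots> = ennreal (64 powr r) * epowr (ennreal (t powr (- a)) * ?I t) r"
          using r by (simp add: epowr_mult mult_ac flip: ennreal_numeral)
        finally show ?thesis using True by (simp add: mult_right_mono mult.assoc[symmetric])
      qed simp
    qed
    also have "\<dots> = ennreal (64 powr r) * (\<integral>\<^sup>+t\<in>{0<..}. epowr (ennreal (t powr (- a)) * ?I t) r * u t \<partial>lborel)"
      by (rule nn_integral_cmult) measurable
    also have "\<dots> \<le> ennreal (64 powr r) * (ennreal C * (\<integral>\<^sup>+t\<in>{0<..}. epowr (ennreal (t powr (?b - a)) * ?D t) r * u t \<partial>lborel))"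
      by (intro mult_left_mono C(2)) (auto intro!: sum_mono rearr_avg_antimono gm)
    also have "?b - a = - (a - ?b)" by simp
    also have "ennreal (64 powr r) * (ennreal C * (\<integral>\<^sup>+t\<in>{0<..}. epowr (ennreal (t powr (- (a - ?b))) * ?D t) r * u t \<partial>lborel))
       \<le> ennreal (64 powr r) * (ennreal C * (ennreal (real CARD('n) powr r) * (\<Sum>i\<in>UNIV. avg_energy (a - ?b) (g i))))"
      by (intro mult_left_mono epowr_sum_energy gm) auto
    also have "\<dots> = ennreal C' * (\<Sum>i\<in>UNIV. avg_energy (a - ?b) (g i))"
      using C(1) by (simp add: C'_def ennreal_mult mult.assoc)
    finally show ?thesis .
  qed
  moreover have "0 < C'" using C(1) by (simp add: C'_def)
  ultimately show ?thesis by blast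
qed

lemma osc_energy_step:
  fixes h :: "real ^ 'n::finite \<Rightarrow> real"
  assumes wp: "\<And>i. weak_partial i h (g i)" and fin: "lam h < top" and c: "1 \<le> c" "c \<le> 2"
  shows "osc_energy c a h \<le> ennreal (8 powr r * real CARD('n) powr r) * (\<Sum>i\<in>UNIV. avg_energy (a - 1 / real CARD('n)) (g i))"
proof -
  let ?b = "1 / real CARD('n)"
  let ?D = "\<lambda>x. \<Sum>i\<in>UNIV. rearr_avg (g i) x"
  have gm [measurable]: "g i \<in> borel_measurable lebesgue" for i
    using wp by (auto simp: weak_partial_def intro: locally_integrable_measurable)
  have "osc_energy c a h \<le> (\<integral>\<^sup>+t. ennreal (8 powr r) * (epowr (ennreal (t powr (- (a - ?b))) * ?D t) r * u t * indicator {0<..} t) \<partial>lborel)"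
    unfolding osc_energy_def
  proof (intro nn_integral_mono)
    fix t :: real
    show "epowr (ennreal (t powr (- a)) * osc h (c * t)) r * u t * indicator {0<..} t
       \<le> ennreal (8 powr r) * (epowr (ennreal (t powr (- (a - ?b))) * ?D t) r * u t * indicator {0<..} t)"
    proof (cases "0 < t")
      case True
      have "epowr (ennreal (t powr (- a)) * osc h (c * t)) r \<le> epowr (ennreal (t powr (- a)) * (ennreal (8 * t powr ?b) * ?D t)) r"
        using r osc_le_gradient[OF wp fin True c] by (intro epowr_mono mult_left_mono) auto
      also have "ennreal (t powr (- a)) * (ennreal (8 * t powr ?b) * ?D t) = ennreal 8 * (ennreal (t powr (- (a - ?b))) * ?D t)"
        using ennreal_powr_mult[of 8 t "- a" ?b "?D t"] by (simp add: ennreal_mult mult.assoc)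
      also have "epowr \<dots> r = ennreal (8 powr r) * epowr (ennreal (t powr (- (a - ?b))) * ?D t) r"
        using r epowr_ennreal[of 8 r] by (subst epowr_mult) auto
      finally show ?thesis using True by (simp add: mult_right_mono mult.assoc[symmetric])
    qed simp
  qed
  also have "\<dots> = ennreal (8 powr r) * (\<integral>\<^sup>+t\<in>{0<..}. epowr (ennreal (t powr (- (a - ?b))) * ?D t) r * u t \<partial>lborel)"
    by (rule nn_integral_cmult) measurable
  also have "\<dots> \<le> ennreal (8 powr r) * (ennreal (real CARD('n) powr r) * (\<Sum>i\<in>UNIV. avg_energy (a - ?b) (g i)))"
    by (intro mult_left_mono epowr_sum_energy gm) auto
  finally show ?thesis by (simp add: ennreal_mult mult.assoc)
qed

text \<open>
  Representatives of all weak derivatives up to order \<open>K\<close>. A free family rather than \<open>wderiv\<close>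
  lets differences of functions be treated by differences of their families.
\<close>

definition sobolev_family :: "nat \<Rightarrow> (real ^ 'n::finite \<Rightarrow> real) \<Rightarrow> (('n \<Rightarrow> nat) \<Rightarrow> real ^ 'n \<Rightarrow> real) \<Rightarrow> bool" where
  "sobolev_family K h D \<longleftrightarrow> (\<forall>\<alpha>. mi_order \<alpha> \<le> K \<longrightarrow> weak_deriv \<alpha> h (D \<alpha>) \<and> lam (D \<alpha>) < top)"

lemma sobolev_family_weak_partial:
  assumes "sobolev_family K h D" "mi_order \<beta> < K"
  shows "weak_partial i (D \<beta>) (D (\<beta>(i := Suc (\<beta> i))))"
  using assms by (intro weak_deriv_chain[of \<beta> h]) (auto simp: sobolev_family_def mi_order_Suc)

lemma avg_energy_le_top_order:
  assumes "real l / real CARD('n::finite) * r \<le> q"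
  shows "\<exists>C>0. \<forall>(h :: real ^ 'n \<Rightarrow> real) D K \<beta>. sobolev_family K h D \<longrightarrow> mi_order \<beta> + l \<le> K \<longrightarrow>
     avg_energy (real l / real CARD('n)) (D \<beta>) \<le> ennreal C * (\<Sum>\<alpha> | mi_order \<alpha> = mi_order \<beta> + l. avg_energy 0 (D \<alpha>))"
  using assms
proof (induction l)
  case 0
  have "avg_energy 0 (D \<beta>) \<le> (\<Sum>\<alpha> | mi_order \<alpha> = mi_order \<beta>. avg_energy 0 (D \<alpha>))" for D :: "('n \<Rightarrow> nat) \<Rightarrow> real ^ 'n \<Rightarrow> real" and \<beta>
    by (rule member_le_sum) (auto simp: finite_mi_order)
  then show ?case by (intro exI[of _ 1]) auto
next
  case (Suc l)
  let ?n = "real CARD('n)"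
  have "real l / ?n * r \<le> real (Suc l) / ?n * r" using r by (intro mult_right_mono divide_right_mono) auto
  then obtain C where C: "C > 0" "\<And>(h :: real ^ 'n \<Rightarrow> real) D K \<beta>. sobolev_family K h D \<Longrightarrow> mi_order \<beta> + l \<le> K \<Longrightarrow>
     avg_energy (real l / ?n) (D \<beta>) \<le> ennreal C * (\<Sum>\<alpha> | mi_order \<alpha> = mi_order \<beta> + l. avg_energy 0 (D \<alpha>))"
    using Suc.IH Suc.prems by force
  have "1 / ?n \<le> real (Suc l) / ?n" by (intro divide_right_mono) auto
  from avg_energy_step[OF this Suc.prems]
  obtain C' where C': "C' > 0" "\<And>(h :: real ^ 'n \<Rightarrow> real) g. (\<forall>i. weak_partial i h (g i)) \<Longrightarrow> lam h < top \<Longrightarrow>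
     avg_energy (real (Suc l) / ?n) h \<le> ennreal C' * (\<Sum>i\<in>UNIV. avg_energy (real (Suc l) / ?n - 1 / ?n) (g i))"
    by blast
  have eq: "real (Suc l) / ?n - 1 / ?n = real l / ?n" by (simp add: diff_divide_distrib[symmetric])
  have "avg_energy (real (Suc l) / ?n) (D \<beta>) \<le> ennreal (C' * (?n * C)) * (\<Sum>\<alpha> | mi_order \<alpha> = mi_order \<beta> + Suc l. avg_energy 0 (D \<alpha>))"
    if sf: "sobolev_family K h D" and ord: "mi_order \<beta> + Suc l \<le> K" for h :: "real ^ 'n \<Rightarrow> real" and D K \<beta>
  proof -
    let ?S = "\<Sum>\<alpha> | mi_order \<alpha> = mi_order \<beta> + Suc l. avg_energy 0 (D \<alpha>)"
    have "avg_energy (real (Suc l) / ?n) (D \<beta>) \<le> ennreal C' * (\<Sum>i\<in>UNIV. avg_energy (real l / ?n) (D (\<beta>(i := Suc (\<beta> i)))))"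
      unfolding eq[symmetric] using sf ord by (intro C'(2)) (auto simp: sobolev_family_def intro: sobolev_family_weak_partial[OF sf])
    also have "\<dots> \<le> ennreal C' * (\<Sum>i\<in>(UNIV :: 'n set). ennreal C * ?S)"
      using C(2)[OF sf, of "\<beta>(i := Suc (\<beta> i))" for i] ord by (intro mult_left_mono sum_mono) (auto simp: mi_order_Suc)
    also have "\<dots> = ennreal (C' * (?n * C)) * ?S"
      using C(1) C'(1) by (simp add: ennreal_mult mult.assoc ennreal_of_nat_eq_real_of_nat)
    finally show ?thesis .
  qed
  then show ?case using C(1) C'(1) by (intro exI[of _ "C' * (?n * C)"]) auto
qed

text \<open>
  The first derivative comes from the oscillation inequality; the other \<open>l - 1\<close> use the Hardy
  inequality, whence the condition on \<open>l - 1\<close>.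
\<close>

lemma osc_energy_le_top_order:
  assumes l: "1 \<le> l" "real (l - 1) / real CARD('n::finite) * r \<le> q"
  shows "\<exists>C>0. \<forall>(h :: real ^ 'n \<Rightarrow> real) D K \<beta> c. sobolev_family K h D \<longrightarrow> mi_order \<beta> + l \<le> K \<longrightarrow> 1 \<le> c \<longrightarrow> c \<le> 2 \<longrightarrow>
     osc_energy c (real l / real CARD('n)) (D \<beta>) \<le> ennreal C * (\<Sum>\<alpha> | mi_order \<alpha> = mi_order \<beta> + l. avg_energy 0 (D \<alpha>))"
proof -
  let ?n = "real CARD('n)"
  obtain C where C: "C > 0" "\<And>(h :: real ^ 'n \<Rightarrow> real) D K \<beta>. sobolev_family K h D \<Longrightarrow> mi_order \<beta> + (l - 1) \<le> K \<Longrightarrow>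
     avg_energy (real (l - 1) / ?n) (D \<beta>) \<le> ennreal C * (\<Sum>\<alpha> | mi_order \<alpha> = mi_order \<beta> + (l - 1). avg_energy 0 (D \<alpha>))"
    using avg_energy_le_top_order[OF l(2)] by blast
  have eq: "real l / ?n - 1 / ?n = real (l - 1) / ?n" using l by (simp add: diff_divide_distrib[symmetric] of_nat_diff)
  let ?C = "8 powr r * ?n powr r * (?n * C)"
  have "osc_energy c (real l / ?n) (D \<beta>) \<le> ennreal ?C * (\<Sum>\<alpha> | mi_order \<alpha> = mi_order \<beta> + l. avg_energy 0 (D \<alpha>))"
    if sf: "sobolev_family K h D" and ord: "mi_order \<beta> + l \<le> K" and c: "1 \<le> c" "c \<le> 2" for h :: "real ^ 'n \<Rightarrow> real" and D K \<beta> c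
  proof -
    let ?S = "\<Sum>\<alpha> | mi_order \<alpha> = mi_order \<beta> + l. avg_energy 0 (D \<alpha>)"
    have "osc_energy c (real l / ?n) (D \<beta>) \<le> ennreal (8 powr r * ?n powr r) * (\<Sum>i\<in>UNIV. avg_energy (real (l - 1) / ?n) (D (\<beta>(i := Suc (\<beta> i)))))"
      unfolding eq[symmetric] using sf ord l c
      by (intro osc_energy_step) (auto simp: sobolev_family_def intro: sobolev_family_weak_partial[OF sf])
    also have "\<dots> \<le> ennreal (8 powr r * ?n powr r) * (\<Sum>i\<in>(UNIV :: 'n set). ennreal C * ?S)"
      using C(2)[OF sf, of "\<beta>(i := Suc (\<beta> i))" for i] ord l by (intro mult_left_mono sum_mono) (auto simp: mi_order_Suc)
    also have "\<dots> = ennreal ?C * ?S"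
      using C(1) by (simp add: ennreal_mult mult.assoc ennreal_of_nat_eq_real_of_nat)
    finally show ?thesis .
  qed
  then show ?thesis using C(1) by (intro exI[of _ ?C]) auto
qed

end

section \<open>The function classes\<close>

lemma epowr_root_le:
  assumes "X \<le> ennreal M * epowr Z r" "0 < M" "0 < r"
  shows "epowr X (1 / r) \<le> ennreal (M powr (1 / r)) * Z"
proof -
  have "ennreal M * epowr Z r = epowr (ennreal (M powr (1 / r)) * Z) r"
    using assms by (simp add: epowr_mult powr_powr)
  then show ?thesis using assms by (simp add: epowr_inverse_le_iff)
qed

lemma epowr_cmult: "0 \<le> a \<Longrightarrow> 0 < r \<Longrightarrow> epowr (ennreal a * x) r = ennreal (a powr r) * epowr x r"
  by (simp add: epowr_mult)

lemma suminf_half: "(\<Sum>j. ennreal ((1 / 2) ^ j)) = 2"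
proof -
  have sums: "(\<lambda>j. (1 / 2 :: real) ^ j) sums 2" using geometric_sums[of "1 / 2 :: real"] by simp
  show ?thesis unfolding ennreal_numeral[symmetric] by (rule suminf_ennreal_eq[OF _ sums]) simp
qed

lemma le_suminf_ennreal: "f i \<le> (\<Sum>i. f i :: ennreal)"
  using sum_le_suminf[OF summableI, of "{i}" f] by simp

locale sobolev_setting = hardy_weight u r q cB cS W
  for u :: "real \<Rightarrow> ennreal" and r q cB cS :: real and W :: "real \<Rightarrow> ennreal" +
  fixes w v :: "real \<Rightarrow> real" and k m :: nat and dim :: "'n::finite itself"
  assumes w_u: "AE s in lborel. 0 < s \<longrightarrow> u s = ennreal (w s)"
    and w_nonneg: "\<And>s. 0 < s \<Longrightarrow> 0 \<le> w s"
    and v_def: "v = (\<lambda>t. t powr (- (real m * r / real CARD('n))))"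
    and k: "1 \<le> k" and m: "1 \<le> m"
    and q_eq: "q = r * (real k + real m - 1) / real CARD('n)"
begin

abbreviation "X \<equiv> Lambda_class r w :: 'n fclass"
abbreviation "Y \<equiv> S_class r (\<lambda>s. w s * v s) :: 'n fclass"
abbreviation "WX \<equiv> W_class (k + m) X"
abbreviation "WY \<equiv> W_class k Y"

lemma Lambda_norm_eq: "Lambda_norm r w f = epowr (lam f) (1 / r)"
proof -
  have "(\<integral>\<^sup>+s\<in>{0<..}. epowr (rearr f s) r * ennreal (w s) \<partial>lebesgue) = lam f"
    unfolding lam_def nn_integral_completion
    by (intro nn_integral_cong_AE, use w_u in eventually_elim) (auto simp: indicator_def)
  then show ?thesis by (simp add: Lambda_norm_def)
qed

lemma S_norm_eq: "S_norm r (\<lambda>s. w s * v s) f = epowr (osc_energy 1 (real m / real CARD('n)) f) (1 / r)"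
proof -
  have "(\<integral>\<^sup>+s\<in>{0<..}. epowr (rearr_avg f s - rearr f s) r * ennreal (w s * v s) \<partial>lebesgue) = osc_energy 1 (real m / real CARD('n)) f"
    unfolding osc_energy_def nn_integral_completion
  proof (intro nn_integral_cong_AE, use w_u in eventually_elim)
    case (elim s)
    show ?case
    proof (cases "0 < s")
      case True
      have "epowr (ennreal (s powr (- (real m / real CARD('n)))) * osc f s) r = ennreal (v s) * epowr (osc f s) r"
        using r by (simp add: epowr_mult powr_powr v_def)
      then show ?thesis using True elim w_nonneg[OF True] by (simp add: osc_def ennreal_mult v_def mult_ac)
    qed simp
  qed
  then show ?thesis by (simp add: S_norm_def)
qed

lemma X_iff: "f \<in> fst X \<longleftrightarrow> f \<in> borel_measurable lebesgue \<and> lam f < top"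
  by (auto simp: Lambda_class_def Lambda_norm_eq)

lemma snd_X: "snd X f = epowr (lam f) (1 / r)"
  by (simp add: Lambda_class_def Lambda_norm_eq)

lemma snd_Y: "snd Y f = epowr (osc_energy 1 (real m / real CARD('n)) f) (1 / r)"
  by (simp add: S_class_def S_norm_eq)

lemma Y_I:
  assumes "f \<in> borel_measurable lebesgue" "lam f < top" "osc_energy 1 (real m / real CARD('n)) f < top"
  shows "f \<in> fst Y"
  using assms lam_finite_imp_tendsto[OF assms(1,2)] by (simp add: S_class_def S_norm_eq)

lemma order_condition:
  assumes "l \<le> k + m" shows "real (l - 1) / real CARD('n) * r \<le> q"
proof -
  have "real (l - 1) \<le> real k + real m - 1" using assms k by linarith
  then have "r * real (l - 1) / real CARD('n) \<le> r * (real k + real m - 1) / real CARD('n)"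
    using r by (intro divide_right_mono mult_left_mono) auto
  then show ?thesis unfolding q_eq by (simp add: mult.commute)
qed

lemma lam_cong_AE:
  assumes "AE x in lebesgue. f x = g x" "f \<in> borel_measurable lebesgue" "g \<in> borel_measurable lebesgue"
  shows "lam f = lam g"
proof -
  have "AE x in lebesgue. \<bar>f x\<bar> = \<bar>g x\<bar>" using assms(1) by eventually_elim simp
  then show ?thesis unfolding lam_def using rearr_cong_AE[of f g] assms(2,3) by simp
qed

text \<open>
  At order \<open>0\<close> the function itself replaces \<open>wderiv\<close>, which would only be equal to it almost
  everywhere.
\<close>

definition derivs :: "(real ^ 'n \<Rightarrow> real) \<Rightarrow> ('n \<Rightarrow> nat) \<Rightarrow> real ^ 'n \<Rightarrow> real" where
  "derivs h \<alpha> = (if \<alpha> = (\<lambda>_. 0) then h else wderiv \<alpha> h)"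

text \<open>
  Membership provides some representative in \<open>\<Lambda>\<^sub>r(w)\<close>; the chosen one agrees with it almost
  everywhere and hence has the same rearrangement.
\<close>

lemma derivs_family:
  assumes h: "h \<in> fst WX"
  shows "sobolev_family (k + m) h (derivs h)"
  unfolding sobolev_family_def
proof (intro allI impI)
  have ex: "\<exists>g. weak_deriv \<alpha> h g \<and> g \<in> fst X" if "mi_order \<alpha> \<le> k + m" for \<alpha>
    using h that by (auto simp: W_class_def)
  fix \<alpha> :: "'n \<Rightarrow> nat" assume \<alpha>: "mi_order \<alpha> \<le> k + m"
  obtain g where g: "weak_deriv \<alpha> h g" "g \<in> fst X" using ex[OF \<alpha>] by auto
  have "weak_deriv \<alpha> h (derivs h \<alpha>)"
  proof (cases "\<alpha> = (\<lambda>_. 0)")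
    case True
    then show ?thesis using g(1) by (simp add: weak_deriv_def derivs_def mi_deriv_0 mi_order_0)
  next
    case False
    have "weak_deriv \<alpha> h (wderiv \<alpha> h)" unfolding wderiv_def by (rule someI[of "weak_deriv \<alpha> h", OF g(1)])
    then show ?thesis using False by (simp add: derivs_def)
  qed
  moreover from this have "AE x in lebesgue. g x = derivs h \<alpha> x" by (rule weak_deriv_unique[OF g(1)])
  then have "lam g = lam (derivs h \<alpha>)"
    using g(1) \<open>weak_deriv \<alpha> h (derivs h \<alpha>)\<close>
    by (intro lam_cong_AE) (auto simp: weak_deriv_def intro: locally_integrable_measurable)
  ultimately show "weak_deriv \<alpha> h (derivs h \<alpha>) \<and> lam (derivs h \<alpha>) < top" using g(2) by (simp add: X_iff)
qed

lemma family_measurable: "sobolev_family K h D \<Longrightarrow> mi_order \<alpha> \<le> K \<Longrightarrow> D \<alpha> \<in> borel_measurable lebesgue"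
  by (auto simp: sobolev_family_def weak_deriv_def intro: locally_integrable_measurable)

lemma derivs_0: "derivs h (\<lambda>_. 0) = h"
  by (simp add: derivs_def)

lemma derivs_eq_wderiv: "mi_order \<alpha> \<noteq> 0 \<Longrightarrow> derivs h \<alpha> = wderiv \<alpha> h"
  by (auto simp: derivs_def mi_order_0)

lemma lam_le_WX:
  shows "lam h \<le> epowr (snd WX h) r"
    and "mi_order \<alpha> = k + m \<Longrightarrow> lam (derivs h \<alpha>) \<le> epowr (snd WX h) r"
proof -
  have r0: "0 < r" using r by simp
  show "lam h \<le> epowr (snd WX h) r"
    unfolding epowr_inverse_le_iff[OF r0, symmetric] by (simp add: W_class_def snd_X)
  assume \<alpha>: "mi_order \<alpha> = k + m"
  have "epowr (lam (wderiv \<alpha> h)) (1 / r) \<le> (\<Sum>\<alpha> | mi_order \<alpha> = k + m. snd X (wderiv \<alpha> h))"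
    using \<alpha> finite_mi_order[of "k + m"] unfolding snd_X
    by (intro member_le_sum[of \<alpha> _ "\<lambda>\<alpha>. epowr (lam (wderiv \<alpha> h)) (1 / r)"]) auto
  also have "\<dots> \<le> snd WX h" by (simp add: W_class_def)
  finally show "lam (derivs h \<alpha>) \<le> epowr (snd WX h) r"
    using \<alpha> k unfolding epowr_inverse_le_iff[OF r0, symmetric] by (simp add: derivs_eq_wderiv)
qed

text \<open>
  For \<open>s \<le> 1\<close> the larger exponent \<open>l/n\<close> gives the larger weight; for \<open>s > 1\<close> the weight is at
  most \<open>1\<close> and the oscillation at most the average. This replaces an interpolation inequality
  for intermediate derivatives.
\<close>

lemma osc_energy_lower_order:
  assumes [measurable]: "f \<in> borel_measurable lebesgue" and l: "m \<le> l"
  shows "osc_energy 1 (real m / real CARD('n)) f \<le> osc_energy 1 (real l / real CARD('n)) f + avg_energy 0 f"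
proof -
  have "osc_energy 1 (real m / real CARD('n)) f \<le> (\<integral>\<^sup>+s. epowr (ennreal (s powr (- (real l / real CARD('n)))) * osc f (1 * s)) r * u s * indicator {0<..} s
      + epowr (rearr_avg f s) r * u s * indicator {0<..} s \<partial>lborel)"
    unfolding osc_energy_def
  proof (intro nn_integral_mono)
    fix s :: real
    show "epowr (ennreal (s powr (- (real m / real CARD('n)))) * osc f (1 * s)) r * u s * indicator {0<..} s
      \<le> epowr (ennreal (s powr (- (real l / real CARD('n)))) * osc f (1 * s)) r * u s * indicator {0<..} s
        + epowr (rearr_avg f s) r * u s * indicator {0<..} s"
    proof (cases "0 < s")
      case True
      show ?thesis
      proof (cases "s \<le> 1")
        case le: True
        have "s powr (- (real m / real CARD('n))) \<le> s powr (- (real l / real CARD('n)))"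
          using True le l by (intro powr_mono') (auto simp: divide_right_mono)
        then have "epowr (ennreal (s powr (- (real m / real CARD('n)))) * osc f (1 * s)) r * u s \<le> epowr (ennreal (s powr (- (real l / real CARD('n)))) * osc f (1 * s)) r * u s"
          using r by (intro mult_right_mono epowr_mono ennreal_leI) auto
        then show ?thesis using True by (simp add: add_increasing2)
      next
        case False
        have "s powr (- (real m / real CARD('n))) \<le> 1" using False powr_mono2'[of "- (real m / real CARD('n))" 1 s] by simp
        then have "ennreal (s powr (- (real m / real CARD('n)))) * osc f (1 * s) \<le> 1 * rearr_avg f s"
          using osc_le_avg[of f s] by (intro mult_mono) auto
        then have "epowr (ennreal (s powr (- (real m / real CARD('n)))) * osc f (1 * s)) r * u s \<le> epowr (rearr_avg f s) r * u s"
          using r by (intro mult_right_mono epowr_mono) auto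
        then show ?thesis using True by (simp add: add_increasing)
      qed
    qed simp
  qed
  also have "\<dots> = osc_energy 1 (real l / real CARD('n)) f + avg_energy 0 f"
    unfolding osc_energy_def avg_energy_0 by (rule nn_integral_add) auto
  finally show ?thesis .
qed

lemma sum_avg_energy_le:
  assumes C: "\<And>f :: real ^ 'n \<Rightarrow> real. f \<in> borel_measurable lebesgue \<Longrightarrow> avg_energy 0 f \<le> ennreal C * lam f"
    and h: "h \<in> fst WX"
  shows "(\<Sum>\<alpha> | mi_order \<alpha> = k + m. avg_energy 0 (derivs h \<alpha>))
     \<le> ennreal (real (card {\<alpha> :: 'n \<Rightarrow> nat. mi_order \<alpha> = k + m})) * (ennreal C * epowr (snd WX h) r)"
proof -
  have "(\<Sum>\<alpha> | mi_order \<alpha> = k + m. avg_energy 0 (derivs h \<alpha>)) \<le> (\<Sum>\<alpha> :: 'n \<Rightarrow> nat | mi_order \<alpha> = k + m. ennreal C * epowr (snd WX h) r)"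
  proof (intro sum_mono)
    fix \<alpha> :: "'n \<Rightarrow> nat" assume \<alpha>: "\<alpha> \<in> {\<alpha>. mi_order \<alpha> = k + m}"
    have "avg_energy 0 (derivs h \<alpha>) \<le> ennreal C * lam (derivs h \<alpha>)"
      using \<alpha> by (intro C family_measurable[OF derivs_family[OF h]]) auto
    also have "\<dots> \<le> ennreal C * epowr (snd WX h) r" using \<alpha> by (intro mult_left_mono lam_le_WX) auto
    finally show "avg_energy 0 (derivs h \<alpha>) \<le> ennreal C * epowr (snd WX h) r" .
  qed
  then show ?thesis by (simp add: ennreal_of_nat_eq_real_of_nat)
qed

text \<open>
  A derivative of order \<open>j \<le> k\<close> still has \<open>k + m - j \<ge> m\<close> derivatives in \<open>\<Lambda>\<^sub>r(w)\<close>. For \<open>j = k\<close>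
  the Sobolev inequality applies directly, for \<open>j < k\<close> after passing to the exponent \<open>(k + m -
  j)/n\<close>.
\<close>

lemma WX_imp_WY:
  "\<exists>C>0. \<forall>h. h \<in> fst WX \<longrightarrow> h \<in> fst WY \<and> snd WY h \<le> ennreal C * snd WX h"
proof -
  obtain C0 where C0: "C0 > 0" "\<And>f :: real ^ 'n \<Rightarrow> real. f \<in> borel_measurable lebesgue \<Longrightarrow> avg_energy 0 f \<le> ennreal C0 * lam f"
    using avg_energy_le_lam by blast
  let ?c = "real (card {\<alpha> :: 'n \<Rightarrow> nat. mi_order \<alpha> = k + m})"
  have main: "\<exists>C>0. \<forall>(h :: real ^ 'n \<Rightarrow> real) D (\<beta> :: 'n \<Rightarrow> nat). sobolev_family (k + m) h D \<longrightarrow> mi_order \<beta> = j \<longrightarrow>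
     osc_energy 1 (real m / real CARD('n)) (D \<beta>) \<le> ennreal C * (\<Sum>\<alpha> | mi_order \<alpha> = k + m. avg_energy 0 (D \<alpha>)) + (if j = k then 0 else avg_energy 0 (D \<beta>))"
    if j: "j \<le> k" for j
  proof -
    let ?l = "k + m - j"
    have "1 \<le> ?l" using j m by simp
    moreover have "real (?l - 1) / real CARD('n) * r \<le> q" by (rule order_condition) simp
    ultimately obtain C where C: "C > 0" "\<And>(h :: real ^ 'n \<Rightarrow> real) D K (\<beta> :: 'n \<Rightarrow> nat) c. sobolev_family K h D \<Longrightarrow> mi_order \<beta> + ?l \<le> K \<Longrightarrow> 1 \<le> c \<Longrightarrow> c \<le> 2 \<Longrightarrow>
     osc_energy c (real ?l / real CARD('n)) (D \<beta>) \<le> ennreal C * (\<Sum>\<alpha> | mi_order \<alpha> = mi_order \<beta> + ?l. avg_energy 0 (D \<alpha>))"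
      using osc_energy_le_top_order[where 'n = 'n, of ?l] by blast
    have "osc_energy 1 (real m / real CARD('n)) (D \<beta>) \<le> ennreal C * (\<Sum>\<alpha> | mi_order \<alpha> = k + m. avg_energy 0 (D \<alpha>)) + (if j = k then 0 else avg_energy 0 (D \<beta>))"
      if sf: "sobolev_family (k + m) h D" and \<beta>: "mi_order \<beta> = j" for h :: "real ^ 'n \<Rightarrow> real" and D and \<beta> :: "'n \<Rightarrow> nat"
    proof -
      have eq: "mi_order \<beta> + ?l = k + m" using j \<beta> by simp
      have *: "osc_energy 1 (real ?l / real CARD('n)) (D \<beta>) \<le> ennreal C * (\<Sum>\<alpha> | mi_order \<alpha> = k + m. avg_energy 0 (D \<alpha>))"
        using C(2)[OF sf, of \<beta> 1] unfolding eq by simp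
      show ?thesis
      proof (cases "j = k")
        case True
        then show ?thesis using * by simp
      next
        case False
        have "osc_energy 1 (real m / real CARD('n)) (D \<beta>) \<le> osc_energy 1 (real ?l / real CARD('n)) (D \<beta>) + avg_energy 0 (D \<beta>)"
          using j \<beta> by (intro osc_energy_lower_order family_measurable[OF sf]) auto
        also have "\<dots> \<le> ennreal C * (\<Sum>\<alpha> | mi_order \<alpha> = k + m. avg_energy 0 (D \<alpha>)) + avg_energy 0 (D \<beta>)"
          by (intro add_right_mono *)
        finally show ?thesis using False by simp
      qed
    qed
    then show ?thesis using C(1) by blast
  qed
  obtain C1 where C1: "C1 > 0" "\<And>(h :: real ^ 'n \<Rightarrow> real) D (\<beta> :: 'n \<Rightarrow> nat). sobolev_family (k + m) h D \<Longrightarrow> mi_order \<beta> = 0 \<Longrightarrow>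
     osc_energy 1 (real m / real CARD('n)) (D \<beta>) \<le> ennreal C1 * (\<Sum>\<alpha> | mi_order \<alpha> = k + m. avg_energy 0 (D \<alpha>)) + (if 0 = k then 0 else avg_energy 0 (D \<beta>))"
    using main[of 0] by blast
  obtain C2 where C2: "C2 > 0" "\<And>(h :: real ^ 'n \<Rightarrow> real) D (\<beta> :: 'n \<Rightarrow> nat). sobolev_family (k + m) h D \<Longrightarrow> mi_order \<beta> = k \<Longrightarrow>
     osc_energy 1 (real m / real CARD('n)) (D \<beta>) \<le> ennreal C2 * (\<Sum>\<alpha> | mi_order \<alpha> = k + m. avg_energy 0 (D \<alpha>)) + (if k = k then 0 else avg_energy 0 (D \<beta>))"
    using main[of k] by blast
  define M where "M = C1 * (?c * C0) + C0 + C2 * (?c * C0)"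
  have "0 \<le> C1 * (?c * C0)" "0 \<le> C2 * (?c * C0)" using C1(1) C2(1) C0(1) by auto
  then have M: "0 < M" using C0(1) by (simp add: M_def)
  let ?c' = "real (card {\<alpha> :: 'n \<Rightarrow> nat. mi_order \<alpha> = k})"
  define C where "C = M powr (1 / r) + ?c' * M powr (1 / r)"
  have C: "0 < C" using M by (auto simp: C_def intro!: add_pos_nonneg)
  have "h \<in> fst WY \<and> snd WY h \<le> ennreal C * snd WX h" if h: "h \<in> fst WX" for h
  proof
    note sf = derivs_family[OF h]
    note meas = family_measurable[OF sf]
    have "\<exists>g. weak_deriv \<beta> h g \<and> g \<in> fst Y" if \<beta>: "mi_order \<beta> \<le> k" for \<beta>
    proof -
      have fin: "lam (derivs h \<beta>) < top" if "mi_order \<beta> \<le> k + m" for \<beta>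
        using sf that by (simp add: sobolev_family_def)
      have fin': "avg_energy 0 (derivs h \<beta>) < top" if "mi_order \<beta> \<le> k + m" for \<beta>
        using lam_finite_imp_avg_energy[OF meas fin] that by blast
      obtain C where "osc_energy 1 (real m / real CARD('n)) (derivs h \<beta>) \<le> ennreal C * (\<Sum>\<alpha> | mi_order \<alpha> = k + m. avg_energy 0 (derivs h \<alpha>))
          + (if mi_order \<beta> = k then 0 else avg_energy 0 (derivs h \<beta>))"
        using main[OF \<beta>] sf by blast
      also have "\<dots> < top"
        using fin' \<beta> by (auto simp: ennreal_mult_less_top finite_mi_order)
      finally have "derivs h \<beta> \<in> fst Y" using \<beta> by (intro Y_I meas fin) auto
      moreover have "weak_deriv \<beta> h (derivs h \<beta>)" using sf \<beta> by (simp add: sobolev_family_def)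
      ultimately show ?thesis by blast
    qed
    then show "h \<in> fst WY" by (auto simp: W_class_def)
    let ?Z = "epowr (snd WX h) r"
    have S: "(\<Sum>\<alpha> | mi_order \<alpha> = k + m. avg_energy 0 (derivs h \<alpha>)) \<le> ennreal (?c * C0) * ?Z"
      using sum_avg_energy_le[OF C0(2) h] C0(1) by (simp add: ennreal_mult mult.assoc)
    have part: "ennreal A * (\<Sum>\<alpha> | mi_order \<alpha> = k + m. avg_energy 0 (derivs h \<alpha>)) \<le> ennreal (A * (?c * C0)) * ?Z" if "0 \<le> A" for A
      using mult_left_mono[OF S, of "ennreal A"] that C0(1) by (simp add: ennreal_mult mult.assoc)
    have "osc_energy 1 (real m / real CARD('n)) h \<le> ennreal C1 * (\<Sum>\<alpha> | mi_order \<alpha> = k + m. avg_energy 0 (derivs h \<alpha>)) + avg_energy 0 h"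
      using C1(2)[OF sf, of "\<lambda>_. 0"] k by (simp add: mi_order_0 derivs_0)
    also have "\<dots> \<le> ennreal (C1 * (?c * C0)) * ?Z + ennreal C0 * ?Z"
    proof (intro add_mono part)
      have "avg_energy 0 h \<le> ennreal C0 * lam h" using meas[of "\<lambda>_. 0"] by (intro C0(2)) (simp add: mi_order_0 derivs_0)
      also have "\<dots> \<le> ennreal C0 * ?Z" by (intro mult_left_mono lam_le_WX) auto
      finally show "avg_energy 0 h \<le> ennreal C0 * ?Z" .
    qed (use C1 in auto)
    also have "\<dots> = ennreal (C1 * (?c * C0) + C0) * ?Z"
      using C1 C0 by (simp add: distrib_right)
    also have "\<dots> \<le> ennreal M * ?Z"
      using C2 C0 by (intro mult_right_mono ennreal_leI) (auto simp: M_def)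
    finally have 1: "snd Y h \<le> ennreal (M powr (1 / r)) * snd WX h"
      unfolding snd_Y using M r by (intro epowr_root_le) auto
    have 2: "snd Y (wderiv \<beta> h) \<le> ennreal (M powr (1 / r)) * snd WX h" if \<beta>: "mi_order \<beta> = k" for \<beta>
    proof -
      have "osc_energy 1 (real m / real CARD('n)) (derivs h \<beta>) \<le> ennreal C2 * (\<Sum>\<alpha> | mi_order \<alpha> = k + m. avg_energy 0 (derivs h \<alpha>))"
        using C2(2)[OF sf \<beta>] by simp
      also have "\<dots> \<le> ennreal (C2 * (?c * C0)) * ?Z" using C2 by (intro part) auto
      also have "\<dots> \<le> ennreal M * ?Z" using C1 C0 by (intro mult_right_mono ennreal_leI) (auto simp: M_def)
      finally have "snd Y (derivs h \<beta>) \<le> ennreal (M powr (1 / r)) * snd WX h"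
        unfolding snd_Y using M r by (intro epowr_root_le) auto
      then show ?thesis using \<beta> k by (simp add: derivs_eq_wderiv)
    qed
    have "snd WY h = snd Y h + (\<Sum>\<beta> | mi_order \<beta> = k. snd Y (wderiv \<beta> h))" by (simp add: W_class_def)
    also have "\<dots> \<le> ennreal (M powr (1 / r)) * snd WX h + (\<Sum>\<beta> :: 'n \<Rightarrow> nat | mi_order \<beta> = k. ennreal (M powr (1 / r)) * snd WX h)"
      by (intro add_mono 1 sum_mono 2) auto
    also have "\<dots> = ennreal C * snd WX h"
      by (simp add: C_def distrib_right ennreal_mult ennreal_of_nat_eq_real_of_nat mult.assoc)
    finally show "snd WY h \<le> ennreal C * snd WX h" .
  qed
  then show ?thesis using C by blast
qed

lemma osc_energy_diff:
  "\<exists>C>0. \<forall>h h'. h \<in> fst WX \<longrightarrow> h' \<in> fst WX \<longrightarrow>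
     osc_energy 2 (real (k + m) / real CARD('n)) (\<lambda>x. h x - h' x) \<le> ennreal C * (epowr (snd WX h) r + epowr (snd WX h') r)"
proof -
  obtain C0 where C0: "C0 > 0" "\<And>f g :: real ^ 'n \<Rightarrow> real. f \<in> borel_measurable lebesgue \<Longrightarrow> g \<in> borel_measurable lebesgue \<Longrightarrow>
     avg_energy 0 (\<lambda>x. f x - g x) \<le> ennreal C0 * (lam f + lam g)"
    using lam_diff by blast
  have "1 \<le> k + m" using k by simp
  then obtain C1 where C1: "C1 > 0" "\<And>(h :: real ^ 'n \<Rightarrow> real) D K (\<beta> :: 'n \<Rightarrow> nat) c. sobolev_family K h D \<Longrightarrow> mi_order \<beta> + (k + m) \<le> K \<Longrightarrow> 1 \<le> c \<Longrightarrow> c \<le> 2 \<Longrightarrow>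
     osc_energy c (real (k + m) / real CARD('n)) (D \<beta>) \<le> ennreal C1 * (\<Sum>\<alpha> | mi_order \<alpha> = mi_order \<beta> + (k + m). avg_energy 0 (D \<alpha>))"
    using osc_energy_le_top_order[where 'n = 'n, of "k + m"] order_condition[of "k + m"] by blast
  let ?c = "real (card {\<alpha> :: 'n \<Rightarrow> nat. mi_order \<alpha> = k + m})"
  define C where "C = C1 * (?c * C0) + 1"
  have C: "0 < C" using C0 C1 by (auto simp: C_def intro!: add_nonneg_pos)
  have "osc_energy 2 (real (k + m) / real CARD('n)) (\<lambda>x. h x - h' x) \<le> ennreal C * (epowr (snd WX h) r + epowr (snd WX h') r)"
    if h: "h \<in> fst WX" and h': "h' \<in> fst WX" for h h'
  proof -
    let ?D = "\<lambda>\<alpha> x. derivs h \<alpha> x - derivs h' \<alpha> x"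
    let ?Z = "epowr (snd WX h) r + epowr (snd WX h') r"
    note sf = derivs_family[OF h] and sf' = derivs_family[OF h']
    have le: "avg_energy 0 (?D \<alpha>) \<le> ennreal C0 * (lam (derivs h \<alpha>) + lam (derivs h' \<alpha>))" if "mi_order \<alpha> \<le> k + m" for \<alpha>
      by (intro C0(2) family_measurable[OF sf that] family_measurable[OF sf' that])
    have "sobolev_family (k + m) (\<lambda>x. h x - h' x) ?D"
      unfolding sobolev_family_def
    proof (intro allI impI conjI)
      fix \<alpha> :: "'n \<Rightarrow> nat" assume \<alpha>: "mi_order \<alpha> \<le> k + m"
      show "weak_deriv \<alpha> (\<lambda>x. h x - h' x) (?D \<alpha>)"
        using sf sf' \<alpha> by (intro weak_deriv_diff) (auto simp: sobolev_family_def)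
      have "lam (?D \<alpha>) \<le> avg_energy 0 (?D \<alpha>)" by (rule lam_le_avg_energy)
      also have "\<dots> \<le> ennreal C0 * (lam (derivs h \<alpha>) + lam (derivs h' \<alpha>))" by (rule le[OF \<alpha>])
      also have "\<dots> < top" using sf sf' \<alpha> by (simp add: sobolev_family_def ennreal_mult_less_top)
      finally show "lam (?D \<alpha>) < top" .
    qed
    from C1(2)[OF this, of "\<lambda>_. 0" 2]
    have "osc_energy 2 (real (k + m) / real CARD('n)) (\<lambda>x. h x - h' x) \<le> ennreal C1 * (\<Sum>\<alpha> | mi_order \<alpha> = k + m. avg_energy 0 (?D \<alpha>))"
      by (simp add: mi_order_0 derivs_0)
    also have "\<dots> \<le> ennreal C1 * (\<Sum>\<alpha> :: 'n \<Rightarrow> nat | mi_order \<alpha> = k + m. ennreal C0 * ?Z)"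
    proof (intro mult_left_mono sum_mono)
      fix \<alpha> :: "'n \<Rightarrow> nat" assume \<alpha>: "\<alpha> \<in> {\<alpha>. mi_order \<alpha> = k + m}"
      have "avg_energy 0 (?D \<alpha>) \<le> ennreal C0 * (lam (derivs h \<alpha>) + lam (derivs h' \<alpha>))" using \<alpha> by (intro le) auto
      also have "\<dots> \<le> ennreal C0 * ?Z" using \<alpha> by (intro mult_left_mono add_mono lam_le_WX) auto
      finally show "avg_energy 0 (?D \<alpha>) \<le> ennreal C0 * ?Z" .
    qed simp
    also have "\<dots> = ennreal (C1 * (?c * C0)) * ?Z"
      using C0 C1 by (simp add: ennreal_mult mult.assoc ennreal_of_nat_eq_real_of_nat)
    also have "\<dots> \<le> ennreal C * ?Z" by (intro mult_right_mono ennreal_leI) (auto simp: C_def)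
    finally show ?thesis .
  qed
  then show ?thesis using C by blast
qed

end

section \<open>The estimate of the K-functional\<close>

context sobolev_setting begin

text \<open>
  The rough part \<open>g 0\<close> is compared on the \<open>j\<close>-th dyadic piece with \<open>g j\<close>; the difference \<open>h j -
  h 0\<close> is smooth at that scale. The numbers \<open>A j\<close> are upper bounds for the cost of the \<open>j\<close>-th
  decomposition.
\<close>

lemma osc_energy_le_dyadic_sum:
  "\<exists>C>0. \<forall>s0>0. \<forall>g h A. (\<forall>j. g j \<in> fst X \<and> h j \<in> fst WX \<and> (\<forall>x. g 0 x + h 0 x = g j x + h j x)
        \<and> snd X (g j) + ennreal ((s0 / 2 ^ j) ^ (k + m)) * snd WX (h j) \<le> A j) \<longrightarrow>
     osc_energy 1 (real m / real CARD('n)) (g 0)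
       \<le> ennreal C * (\<Sum>j. epowr (ennreal ((s0 / 2 ^ j) powr (- real m)) * A j) r)"
proof -
  let ?N = "real CARD('n)"
  have r0: "0 < r" using r by simp
  obtain C1 where C1: "C1 > 0" "\<And>h h'. h \<in> fst WX \<Longrightarrow> h' \<in> fst WX \<Longrightarrow>
     osc_energy 2 (real (k + m) / ?N) (\<lambda>x. h x - h' x) \<le> ennreal C1 * (epowr (snd WX h) r + epowr (snd WX h') r)"
    using osc_energy_diff by blast
  obtain C2 where C2: "C2 > 0" "\<And>f :: real ^ 'n \<Rightarrow> real. f \<in> borel_measurable lebesgue \<Longrightarrow> avg_energy 0 f \<le> ennreal C2 * lam f"
    using avg_energy_le_lam by blast
  define E1 where "E1 = 2 powr r * (2 powr r * C1)"
  define E2 where "E2 = 2 powr r * ((2 * 2 ^ m) powr r * C2)"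
  define C where "C = C2 + (E1 + E2 + 2 * E1)"
  have E: "0 < E1" "0 < E2" using C1(1) C2(1) by (auto simp: E1_def E2_def)
  then have C: "0 < C" using C2(1) by (simp add: C_def)
  have main: "osc_energy 1 (real m / ?N) (g 0) \<le> ennreal C * (\<Sum>j. epowr (ennreal ((s0 / 2 ^ j) powr (- real m)) * A j) r)"
    if s0: "0 < s0" and gX: "\<And>j. g j \<in> fst X" and hW: "\<And>j. h j \<in> fst WX"
      and eq: "\<And>j x. g 0 x + h 0 x = g j x + h j x"
      and le: "\<And>j. snd X (g j) + ennreal ((s0 / 2 ^ j) ^ (k + m)) * snd WX (h j) \<le> A j"
    for s0 :: real and g h :: "nat \<Rightarrow> real ^ 'n \<Rightarrow> real" and A
  proof -
    define s where "s j = s0 / 2 ^ j" for j :: nat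
    have s: "0 < s j" for j using s0 by (simp add: s_def)
    define Z where "Z j = epowr (ennreal (s j powr (- real m)) * A j) r" for j
    have gm [measurable]: "g j \<in> borel_measurable lebesgue" and gfin: "lam (g j) < top" for j
      using gX[of j] by (auto simp: X_iff)
    have hm [measurable]: "h j \<in> borel_measurable lebesgue" and hfin: "lam (h j) < top" for j
      using derivs_family[OF hW[of j]] by (auto simp: sobolev_family_def derivs_0 mi_order_0 weak_deriv_def
          dest!: spec[of _ "\<lambda>_. 0"] intro: locally_integrable_measurable)
    have lam_g: "lam (g j) \<le> epowr (A j) r" for j
    proof -
      have "snd X (g j) \<le> A j" using le[of j] by (rule order_trans[rotated]) simp
      then show ?thesis unfolding snd_X epowr_inverse_le_iff[OF r0] .
    qed
    have W_h: "snd WX (h j) \<le> ennreal (s j powr (- real (k + m))) * A j" for j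
    proof -
      have "ennreal (s j ^ (k + m)) * snd WX (h j) \<le> A j"
        using le[of j] unfolding s_def by (rule order_trans[rotated]) simp
      then have "ennreal (s j powr (- real (k + m))) * (ennreal (s j ^ (k + m)) * snd WX (h j)) \<le> ennreal (s j powr (- real (k + m))) * A j"
        by (intro mult_left_mono) auto
      moreover have "ennreal (s j powr (- real (k + m))) * ennreal (s j ^ (k + m)) = 1"
        using s[of j] by (simp add: powr_realpow[symmetric] ennreal_mult[symmetric] powr_add[symmetric] del: of_nat_add)
      ultimately show ?thesis by (simp add: mult.assoc[symmetric])
    qed
    let ?F = "\<lambda>t. epowr (ennreal (t powr (- (real m / ?N))) * osc (g 0) (1 * t)) r * u t"
    define I where "I j = {t. 0 < t \<and> s (Suc j) \<le> t powr (1 / ?N) \<and> t powr (1 / ?N) < s j}" for j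
    have [measurable]: "I j \<in> sets borel" for j unfolding I_def by measurable
    \<comment> \<open>On this piece the weight \<open>t powr (-m/n)\<close> is comparable to \<open>s j powr (-m)\<close>, so the two terms of the
      bound on the oscillation of \<open>g 0\<close> become \<open>Z j\<close> and, from \<open>h 0\<close>, a share of \<open>Z 0\<close> that decays with \<open>j\<close>.\<close>
    have piece: "(\<integral>\<^sup>+t\<in>I j. ?F t \<partial>lborel) \<le> ennreal (E1 + E2) * Z j + ennreal E1 * (ennreal ((1 / 2) ^ j) * Z 0)" for j
    proof -
      let ?d = "\<lambda>x. h j x - h 0 x"
      have dm [measurable]: "?d \<in> borel_measurable lebesgue" by measurable
      have dfin: "lam ?d < top"
      proof -
        obtain C where "avg_energy 0 ?d \<le> ennreal C * (lam (h j) + lam (h 0))" using lam_diff hm by blast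
        also have "\<dots> < top" using hfin by (simp add: ennreal_mult_less_top)
        finally show ?thesis using lam_le_avg_energy[of ?d] by (rule le_less_trans[rotated])
      qed
      have g0: "g 0 = (\<lambda>x. ?d x + g j x)" using eq[of _ j] by (intro ext) (simp add: algebra_simps)
      have osc_g0: "osc (g 0) t \<le> 2 * osc ?d (2 * t) + 2 * rearr_avg (g j) t" if "0 < t" for t
        using oscillation_add_le[OF dm gm[of j] that] lam_finite_imp_rearr[OF dm dfin] lam_finite_imp_rearr[OF gm[of j] gfin[of j]]
        unfolding osc_def g0 by simp
      let ?a = "2 * s j ^ k" and ?b = "2 * s (Suc j) powr (- real m)"
      have ab: "0 \<le> ?a" "0 \<le> ?b" using s[of j] by auto
      have "(\<integral>\<^sup>+t\<in>I j. ?F t \<partial>lborel) \<le> (\<integral>\<^sup>+t. ennreal (2 powr r * ?a powr r) * (epowr (ennreal (t powr (- (real (k + m) / ?N))) * osc ?d (2 * t)) r * u t * indicator {0<..} t)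
          + ennreal (2 powr r * ?b powr r) * (epowr (rearr_avg (g j) t) r * u t * indicator {0<..} t) \<partial>lborel)"
      proof (intro nn_integral_mono)
        fix t
        show "?F t * indicator (I j) t \<le> ennreal (2 powr r * ?a powr r) * (epowr (ennreal (t powr (- (real (k + m) / ?N))) * osc ?d (2 * t)) r * u t * indicator {0<..} t)
          + ennreal (2 powr r * ?b powr r) * (epowr (rearr_avg (g j) t) r * u t * indicator {0<..} t)"
        proof (cases "t \<in> I j")
          case True
          then have t: "0 < t" and t1: "s (Suc j) \<le> t powr (1 / ?N)" and t2: "t powr (1 / ?N) < s j" by (auto simp: I_def)
          let ?x = "ennreal (t powr (- (real (k + m) / ?N))) * osc ?d (2 * t)" and ?y = "rearr_avg (g j) t"
          have p: "(t powr (1 / ?N)) powr y = t powr (y / ?N)" for y by (simp add: powr_powr)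
          have w1: "t powr (- (real m / ?N)) \<le> s j ^ k * t powr (- (real (k + m) / ?N))"
          proof -
            have "t powr (- (real m / ?N)) = t powr (real k / ?N) * t powr (- (real (k + m) / ?N))"
              unfolding powr_add[symmetric] of_nat_add add_divide_distrib by simp
            also have "t powr (real k / ?N) = (t powr (1 / ?N)) ^ k"
              by (subst p[symmetric], subst powr_realpow) (use t in auto)
            also have "\<dots> \<le> s j ^ k" using t2 by (intro power_mono) auto
            finally show ?thesis by (simp add: mult_right_mono)
          qed
          have w2: "t powr (- (real m / ?N)) \<le> s (Suc j) powr (- real m)"
            using powr_mono2'[of "- real m" "s (Suc j)" "t powr (1 / ?N)"] t1 s[of "Suc j"] p[of "- real m"] by simp
          have "ennreal (t powr (- (real m / ?N))) * osc (g 0) (1 * t)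
            \<le> ennreal (t powr (- (real m / ?N))) * (2 * osc ?d (2 * t) + 2 * ?y)"
            using osc_g0[OF t] by (intro mult_left_mono) auto
          also have "\<dots> = ennreal (t powr (- (real m / ?N))) * (2 * osc ?d (2 * t)) + ennreal (t powr (- (real m / ?N))) * (2 * ?y)"
            by (rule distrib_left)
          also have "\<dots> \<le> ennreal (s j ^ k * t powr (- (real (k + m) / ?N))) * (2 * osc ?d (2 * t)) + ennreal (s (Suc j) powr (- real m)) * (2 * ?y)"
            by (intro add_mono mult_right_mono ennreal_leI w1 w2) auto
          also have "\<dots> = ennreal ?a * ?x + ennreal ?b * ?y"
            using s[of j] by (simp add: ennreal_mult mult_ac)
          finally have "epowr (ennreal (t powr (- (real m / ?N))) * osc (g 0) (1 * t)) r \<le> epowr (ennreal ?a * ?x + ennreal ?b * ?y) r"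
            using r by (intro epowr_mono) auto
          also have "\<dots> \<le> ennreal (2 powr r) * (epowr (ennreal ?a * ?x) r + epowr (ennreal ?b * ?y) r)"
            by (rule epowr_add_le[OF r0])
          also have "\<dots> = ennreal (2 powr r * ?a powr r) * epowr ?x r + ennreal (2 powr r * ?b powr r) * epowr ?y r"
            unfolding epowr_cmult[OF ab(1) r0] epowr_cmult[OF ab(2) r0] by (simp add: distrib_left ennreal_mult mult.assoc)
          finally have "epowr (ennreal (t powr (- (real m / ?N))) * osc (g 0) (1 * t)) r * u t
            \<le> (ennreal (2 powr r * ?a powr r) * epowr ?x r + ennreal (2 powr r * ?b powr r) * epowr ?y r) * u t"
            by (intro mult_right_mono) auto
          then show ?thesis using True t by (simp add: distrib_right mult.assoc)
        qed simp
      qed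
      also have "\<dots> = ennreal (2 powr r * ?a powr r) * osc_energy 2 (real (k + m) / ?N) ?d + ennreal (2 powr r * ?b powr r) * avg_energy 0 (g j)"
        unfolding osc_energy_def avg_energy_0
        by (subst nn_integral_add, simp, simp, subst nn_integral_cmult, simp, subst nn_integral_cmult, simp, rule refl)
      also have "\<dots> \<le> ennreal (2 powr r * ?a powr r) * (ennreal C1 * (epowr (snd WX (h j)) r + epowr (snd WX (h 0)) r))
          + ennreal (2 powr r * ?b powr r) * (ennreal C2 * epowr (A j) r)"
      proof (intro add_mono mult_left_mono C1(2) hW)
        show "avg_energy 0 (g j) \<le> ennreal C2 * epowr (A j) r"
          using C2(2)[OF gm[of j]] mult_left_mono[OF lam_g[of j], of "ennreal C2"] by (auto intro: order_trans)
      qed auto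
      also have "\<dots> = ennreal (2 powr r * C1) * (ennreal (?a powr r) * epowr (snd WX (h j)) r + ennreal (?a powr r) * epowr (snd WX (h 0)) r)
          + ennreal (2 powr r * C2) * (ennreal (?b powr r) * epowr (A j) r)"
        using C1(1) C2(1) by (simp add: ennreal_mult distrib_left mult_ac)
      also have "ennreal (?a powr r) * epowr (snd WX (h j)) r \<le> ennreal (2 powr r) * Z j"
      proof -
        have "ennreal (?a powr r) * epowr (snd WX (h j)) r = epowr (ennreal ?a * snd WX (h j)) r"
          by (rule epowr_cmult[OF ab(1) r0, symmetric])
        also have "\<dots> \<le> epowr (ennreal ?a * (ennreal (s j powr (- real (k + m))) * A j)) r"
          using r by (intro epowr_mono mult_left_mono W_h) auto
        also have "ennreal ?a * (ennreal (s j powr (- real (k + m))) * A j) = ennreal 2 * (ennreal (s j powr (- real m)) * A j)"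
        proof -
          have "?a * s j powr (- real (k + m)) = 2 * s j powr (- real m)"
            using s[of j] by (simp add: powr_realpow[symmetric] powr_add[symmetric] mult.assoc)
          then have "ennreal ?a * ennreal (s j powr (- real (k + m))) = ennreal 2 * ennreal (s j powr (- real m))"
            using ab by (subst (1 2) ennreal_mult[symmetric]) auto
          then show ?thesis by (simp only: mult.assoc[symmetric])
        qed
        also have "epowr \<dots> r = ennreal (2 powr r) * Z j" unfolding Z_def by (rule epowr_cmult[OF _ r0]) simp
        finally show ?thesis .
      qed
      also have "ennreal (?a powr r) * epowr (snd WX (h 0)) r \<le> ennreal (2 powr r) * (ennreal ((1 / 2) ^ j) * Z 0)"
      proof -
        have "ennreal (?a powr r) * epowr (snd WX (h 0)) r = epowr (ennreal ?a * snd WX (h 0)) r"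
          by (rule epowr_cmult[OF ab(1) r0, symmetric])
        also have "\<dots> \<le> epowr (ennreal ?a * (ennreal (s 0 powr (- real (k + m))) * A 0)) r"
          using r by (intro epowr_mono mult_left_mono W_h) auto
        also have "ennreal ?a * (ennreal (s 0 powr (- real (k + m))) * A 0) = ennreal (2 * ((1 / 2) ^ j) ^ k) * (ennreal (s 0 powr (- real m)) * A 0)"
        proof -
          have "s j = s 0 * (1 / 2) ^ j" by (simp add: s_def power_divide)
          then have "?a * s 0 powr (- real (k + m)) = 2 * ((1 / 2) ^ j) ^ k * (s 0 powr real k * s 0 powr (- real (k + m)))"
            using s[of 0] by (simp add: powr_realpow power_mult_distrib mult_ac)
          also have "s 0 powr real k * s 0 powr (- real (k + m)) = s 0 powr (- real m)" by (simp add: powr_add[symmetric])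
          finally have "ennreal ?a * ennreal (s 0 powr (- real (k + m))) = ennreal (2 * ((1 / 2) ^ j) ^ k) * ennreal (s 0 powr (- real m))"
            using ab by (subst (1 2) ennreal_mult[symmetric]) auto
          then show ?thesis by (simp only: mult.assoc[symmetric])
        qed
        also have "epowr \<dots> r = ennreal ((2 * ((1 / 2) ^ j) ^ k) powr r) * Z 0" unfolding Z_def by (rule epowr_cmult[OF _ r0]) simp
        also have "\<dots> \<le> ennreal (2 powr r * (1 / 2) ^ j) * Z 0"
        proof (intro mult_right_mono ennreal_leI)
          have "(((1 / 2 :: real) ^ j) ^ k) powr r = ((1 / 2) ^ j) powr (real k * r)"
            by (simp add: powr_realpow[symmetric] powr_powr mult.assoc)
          also have "\<dots> \<le> ((1 / 2) ^ j) powr 1"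
          proof (rule powr_mono')
            have "1 * 1 \<le> real k * r" using k r by (intro mult_mono) auto
            then show "1 \<le> real k * r" by simp
          qed (auto simp: power_le_one)
          finally have "(((1 / 2 :: real) ^ j) ^ k) powr r \<le> (1 / 2) ^ j" by simp
          then show "(2 * ((1 / 2) ^ j) ^ k) powr r \<le> 2 powr r * (1 / 2) ^ j"
            unfolding powr_mult by (rule mult_left_mono) simp
        qed simp
        also have "\<dots> = ennreal (2 powr r) * (ennreal ((1 / 2) ^ j) * Z 0)"
          by (subst ennreal_mult) (auto simp: mult.assoc)
        finally show ?thesis .
      qed
      also have "ennreal (?b powr r) * epowr (A j) r \<le> ennreal ((2 * 2 ^ m) powr r) * Z j"
      proof -
        have sS: "s (Suc j) = s j / 2" by (simp add: s_def)
        have "?b = 2 * 2 ^ m * s j powr (- real m)"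
          unfolding sS using s[of j] by (simp add: powr_divide powr_minus powr_realpow field_simps)
        then have "?b powr r = (2 * 2 ^ m) powr r * (s j powr (- real m)) powr r" by (simp add: powr_mult)
        then have "ennreal (?b powr r) * epowr (A j) r = ennreal ((2 * 2 ^ m) powr r) * (ennreal ((s j powr (- real m)) powr r) * epowr (A j) r)"
          by (simp add: ennreal_mult mult.assoc)
        also have "ennreal ((s j powr (- real m)) powr r) * epowr (A j) r = Z j"
          unfolding Z_def by (rule epowr_cmult[OF _ r0, symmetric]) simp
        finally show ?thesis by simp
      qed
      finally have "(\<integral>\<^sup>+t\<in>I j. ?F t \<partial>lborel) \<le> ennreal (2 powr r * C1) * (ennreal (2 powr r) * Z j + ennreal (2 powr r) * (ennreal ((1 / 2) ^ j) * Z 0))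
          + ennreal (2 powr r * C2) * (ennreal ((2 * 2 ^ m) powr r) * Z j)"
        by (simp only: add_mono mult_left_mono zero_le)
      also have "\<dots> = (ennreal E1 * Z j + ennreal E1 * (ennreal ((1 / 2) ^ j) * Z 0)) + ennreal E2 * Z j"
      proof -
        have "ennreal (2 powr r * C1) * ennreal (2 powr r) = ennreal E1" "ennreal (2 powr r * C2) * ennreal ((2 * 2 ^ m) powr r) = ennreal E2"
          using C1(1) C2(1) by (auto simp: E1_def E2_def ennreal_mult[symmetric] mult_ac)
        then show ?thesis by (simp only: distrib_left mult.assoc[symmetric])
      qed
      also have "\<dots> = ennreal (E1 + E2) * Z j + ennreal E1 * (ennreal ((1 / 2) ^ j) * Z 0)"
        using E by (simp add: distrib_right add_ac)
      finally show ?thesis .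
    qed
    \<comment> \<open>For \<open>t\<close> beyond \<open>s 0 ^ n\<close> the weight is at most \<open>s 0 powr (-m)\<close>, and the average of \<open>g 0\<close> itself suffices.\<close>
    define H where "H = {t. 0 < t \<and> s 0 \<le> t powr (1 / ?N)}"
    have [measurable]: "H \<in> sets borel" unfolding H_def by measurable
    have head: "(\<integral>\<^sup>+t\<in>H. ?F t \<partial>lborel) \<le> ennreal C2 * Z 0"
    proof -
      have "(\<integral>\<^sup>+t\<in>H. ?F t \<partial>lborel) \<le> (\<integral>\<^sup>+t. ennreal ((s 0 powr (- real m)) powr r) * (epowr (rearr_avg (g 0) t) r * u t * indicator {0<..} t) \<partial>lborel)"
      proof (intro nn_integral_mono)
        fix t
        show "?F t * indicator H t \<le> ennreal ((s 0 powr (- real m)) powr r) * (epowr (rearr_avg (g 0) t) r * u t * indicator {0<..} t)"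
        proof (cases "t \<in> H")
          case True
          then have t: "0 < t" and t1: "s 0 \<le> t powr (1 / ?N)" by (auto simp: H_def)
          have "t powr (- (real m / ?N)) \<le> s 0 powr (- real m)"
            using powr_mono2'[of "- real m" "s 0" "t powr (1 / ?N)"] t1 s[of 0] by (simp add: powr_powr)
          then have "epowr (ennreal (t powr (- (real m / ?N))) * osc (g 0) (1 * t)) r \<le> epowr (ennreal (s 0 powr (- real m)) * rearr_avg (g 0) t) r"
            using r osc_le_avg[of "g 0" t] by (intro epowr_mono mult_mono ennreal_leI) auto
          also have "\<dots> = ennreal ((s 0 powr (- real m)) powr r) * epowr (rearr_avg (g 0) t) r"
            by (rule epowr_cmult[OF _ r0]) simp
          finally have "epowr (ennreal (t powr (- (real m / ?N))) * osc (g 0) (1 * t)) r * u t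
             \<le> ennreal ((s 0 powr (- real m)) powr r) * epowr (rearr_avg (g 0) t) r * u t" by (intro mult_right_mono) auto
          then show ?thesis using True t by (simp add: mult.assoc)
        qed simp
      qed
      also have "\<dots> = ennreal ((s 0 powr (- real m)) powr r) * avg_energy 0 (g 0)"
        unfolding avg_energy_0 by (rule nn_integral_cmult) simp
      also have "\<dots> \<le> ennreal ((s 0 powr (- real m)) powr r) * (ennreal C2 * epowr (A 0) r)"
        using C2(2)[OF gm[of 0]] mult_left_mono[OF lam_g[of 0], of "ennreal C2"] by (intro mult_left_mono) (auto intro: order_trans)
      also have "\<dots> = ennreal C2 * (ennreal ((s 0 powr (- real m)) powr r) * epowr (A 0) r)" by (simp only: mult_ac)
      also have "ennreal ((s 0 powr (- real m)) powr r) * epowr (A 0) r = Z 0"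
        unfolding Z_def by (rule epowr_cmult[OF _ r0, symmetric]) simp
      finally show ?thesis .
    qed
    have cover: "t \<in> H \<or> (\<exists>j. t \<in> I j)" if t: "0 < t" for t
    proof (cases "s 0 \<le> t powr (1 / ?N)")
      case False
      let ?P = "\<lambda>i. s i \<le> t powr (1 / ?N)"
      have "0 < t powr (1 / ?N)" using t by simp
      then obtain i where "s 0 / t powr (1 / ?N) < 2 ^ i" using real_arch_pow[of 2] by force
      then have "?P i" using \<open>0 < t powr (1 / ?N)\<close> by (simp add: s_def field_simps)
      then obtain i' where i': "\<forall>l<i'. \<not> ?P l" "?P i'" using ex_least_nat_le[of ?P i] by blast
      then have "i' \<noteq> 0" using False by metis
      then obtain j where "i' = Suc j" by (cases i') auto
      then show ?thesis using i' t by (auto simp: I_def not_le)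
    qed (use t in \<open>auto simp: H_def\<close>)
    have "osc_energy 1 (real m / ?N) (g 0) \<le> (\<integral>\<^sup>+t. ?F t * indicator H t + (\<Sum>j. ?F t * indicator (I j) t) \<partial>lborel)"
      unfolding osc_energy_def
    proof (intro nn_integral_mono)
      fix t :: real
      show "?F t * indicator {0<..} t \<le> ?F t * indicator H t + (\<Sum>j. ?F t * indicator (I j) t)"
      proof (cases "0 < t")
        case True
        from cover[OF True] show ?thesis
        proof
          assume "\<exists>j. t \<in> I j"
          then obtain j where "t \<in> I j" by auto
          then have "?F t \<le> (\<Sum>j. ?F t * indicator (I j) t)" using le_suminf_ennreal[of "\<lambda>j. ?F t * indicator (I j) t" j] by simp
          then show ?thesis using True by (simp add: add_increasing)
        qed (use True in \<open>simp add: add_increasing2\<close>)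
      qed simp
    qed
    also have "\<dots> = (\<integral>\<^sup>+t\<in>H. ?F t \<partial>lborel) + (\<Sum>j. \<integral>\<^sup>+t\<in>I j. ?F t \<partial>lborel)"
      by (subst nn_integral_add, simp, simp, subst nn_integral_suminf, simp, rule refl)
    also have "\<dots> \<le> ennreal C2 * Z 0 + (\<Sum>j. ennreal (E1 + E2) * Z j + ennreal E1 * (ennreal ((1 / 2) ^ j) * Z 0))"
      by (intro add_mono head suminf_le piece summableI)
    also have "(\<Sum>j. ennreal (E1 + E2) * Z j + ennreal E1 * (ennreal ((1 / 2) ^ j) * Z 0))
       = ennreal (E1 + E2) * (\<Sum>j. Z j) + ennreal E1 * (2 * Z 0)"
      by (simp only: suminf_add[OF summableI summableI, symmetric] ennreal_suminf_cmult ennreal_suminf_multc suminf_half)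
    also have "ennreal C2 * Z 0 + (ennreal (E1 + E2) * (\<Sum>j. Z j) + ennreal E1 * (2 * Z 0))
       \<le> ennreal C2 * (\<Sum>j. Z j) + (ennreal (E1 + E2) * (\<Sum>j. Z j) + ennreal E1 * (2 * (\<Sum>j. Z j)))"
      by (intro add_mono mult_left_mono le_suminf_ennreal order.refl) auto
    also have "\<dots> = ennreal C * (\<Sum>j. Z j)"
    proof -
      have "ennreal E1 * (2 * x) = ennreal (2 * E1) * x" for x
        using E by (simp add: ennreal_mult mult_ac)
      moreover have "ennreal C = ennreal C2 + (ennreal (E1 + E2) + ennreal (2 * E1))"
        unfolding C_def using C2(1) E by (simp only: ennreal_plus add_nonneg_nonneg mult_nonneg_nonneg less_imp_le zero_le_numeral add.assoc)
      ultimately show ?thesis by (simp only: distrib_right)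
    qed
    finally show ?thesis by (simp add: Z_def s_def)
  qed
  show ?thesis
  proof (intro exI[of _ C] conjI allI impI C)
    fix s0 :: real and g h :: "nat \<Rightarrow> real ^ 'n \<Rightarrow> real" and A
    assume "0 < s0" and H: "\<forall>j. g j \<in> fst X \<and> h j \<in> fst WX \<and> (\<forall>x. g 0 x + h 0 x = g j x + h j x)
        \<and> snd X (g j) + ennreal ((s0 / 2 ^ j) ^ (k + m)) * snd WX (h j) \<le> A j"
    show "osc_energy 1 (real m / ?N) (g 0) \<le> ennreal C * (\<Sum>j. epowr (ennreal ((s0 / 2 ^ j) powr (- real m)) * A j) r)"
    proof (rule main[OF \<open>0 < s0\<close>])
      fix j x
      show "g j \<in> fst X" "h j \<in> fst WX" "g 0 x + h 0 x = g j x + h j x"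
        "snd X (g j) + ennreal ((s0 / 2 ^ j) ^ (k + m)) * snd WX (h j) \<le> A j"
        using H[rule_format, of j] by blast+
    qed
  qed
qed

lemma K_fun_mono: "s \<le> t \<Longrightarrow> K_fun f s X' Y' \<le> K_fun f t X' Y'"
  unfolding K_fun_def
  by (rule Inf_mono) (fastforce intro: add_left_mono mult_right_mono ennreal_leI)

text \<open>
  The integral on the right dominates the dyadic sum, because the K-functional is increasing. An
  infimum need not be attained, so the decompositions are chosen with a slack proportional to
  \<open>\<delta>\<close>, weighted so that its contribution to the dyadic sum is \<open>O(\<delta> powr r)\<close>; then \<open>\<delta>\<close> tends to
  \<open>0\<close>.
\<close>

lemma K_fun_bound:
  "\<exists>C>0. \<forall>t>0. \<forall>f. let Q = (\<integral>\<^sup>+s\<in>{0<..<t}. epowr (ennreal (s powr (- real m)) * K_fun f (s ^ (k + m)) X WX) r * ennreal (1 / s) \<partial>lebesgue)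
     in Q < top \<longrightarrow> epowr (K_fun f (t ^ k) Y WY) r \<le> ennreal C * Q"
proof -
  have r0: "0 < r" using r by simp
  obtain C1 where C1: "0 < C1" "\<And>s0 g h A. 0 < s0 \<Longrightarrow> (\<forall>j. g j \<in> fst X \<and> h j \<in> fst WX \<and> (\<forall>x. g 0 x + h 0 x = g j x + h j x)
        \<and> snd X (g j) + ennreal ((s0 / 2 ^ j) ^ (k + m)) * snd WX (h j) \<le> A j) \<Longrightarrow>
     osc_energy 1 (real m / real CARD('n)) (g 0)
       \<le> ennreal C1 * (\<Sum>j. epowr (ennreal ((s0 / 2 ^ j) powr (- real m)) * A j) r)"
    using osc_energy_le_dyadic_sum by blast
  obtain C2 where C2: "0 < C2" "\<And>h. h \<in> fst WX \<Longrightarrow> h \<in> fst WY \<and> snd WY h \<le> ennreal C2 * snd WX h"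
    using WX_imp_WY by blast
  define C3 where "C3 = C1 powr (1 / r) + C2 * 2 ^ k"
  have C3: "0 < C3" using C1(1) C2(1) by (simp add: C3_def add_pos_pos)
  define C4 where "C4 = 2 * (2 ^ m) powr r"
  have C4: "0 < C4" by (simp add: C4_def)
  define C5 where "C5 = C3 powr r * 2 powr r"
  have C5: "0 < C5" using C3 by (simp add: C5_def)
  have "epowr (K_fun f (t ^ k) Y WY) r \<le> ennreal (C5 * C4) * Q"
    if t: "0 < t" and Q: "Q = (\<integral>\<^sup>+s\<in>{0<..<t}. epowr (ennreal (s powr (- real m)) * K_fun f (s ^ (k + m)) X WX) r * ennreal (1 / s) \<partial>lebesgue)"
      and Q_fin: "Q < top" for t :: real and f Q
  proof -
    define s0 where "s0 = t / 2"
    have s0: "0 < s0" "t = 2 * s0" using t by (auto simp: s0_def)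
    define s where "s j = s0 / 2 ^ j" for j :: nat
    have s: "0 < s j" for j using s0 by (simp add: s_def)
    define \<kappa> where "\<kappa> j = K_fun f (s j ^ (k + m)) X WX" for j
    define Z' where "Z' j = epowr (ennreal (s j powr (- real m)) * \<kappa> j) r" for j
    \<comment> \<open>The K-functional at \<open>s j\<close> is at most its values on \<open>{s j..<2 * s j}\<close>. These intervals lie in \<open>{0<..<t}\<close>
      because \<open>s 0 = t / 2\<close>.\<close>
    have sum_le: "(\<Sum>j. Z' j) \<le> ennreal C4 * Q"
    proof -
      define I where "I j = {s j..<2 * s j}" for j
      have disj: "disjoint_family I"
        unfolding disjoint_family_on_def
      proof (intro ballI impI)
        have lt: "I i \<inter> I j = {}" if "i < j" for i j
        proof -
          have "2 ^ Suc i \<le> (2 ^ j :: real)" using that by (intro power_increasing) auto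
          then have "2 * s j \<le> s i" using s0 by (simp add: s_def field_simps)
          then show ?thesis by (auto simp: I_def)
        qed
        fix i j :: nat assume "i \<noteq> j"
        then show "I i \<inter> I j = {}" using lt[of i j] lt[of j i] by (cases "i < j") auto
      qed
      let ?G = "\<lambda>x. epowr (ennreal (x powr (- real m)) * K_fun f (x ^ (k + m)) X WX) r * ennreal (1 / x) * indicator {0<..<t} x"
      define a where "a j = ennreal (1 / (2 ^ m) powr r) * Z' j * ennreal (1 / (2 * s j))" for j
      have I_le: "a j \<le> ?G x" if x: "x \<in> I j" for j x
      proof -
        have x1: "s j \<le> x" "x < 2 * s j" "0 < x" using x s[of j] by (auto simp: I_def)
        have "2 * s j \<le> t" using s0 by (simp add: s_def field_simps)
        then have xt: "x < t" using x1 by simp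
        have "(1 / 2 ^ m) * s j powr (- real m) \<le> x powr (- real m)"
        proof -
          have "(1 / 2 ^ m) * s j powr (- real m) = (2 * s j) powr (- real m)"
            using s[of j] by (simp add: powr_mult powr_minus powr_realpow field_simps)
          also have "\<dots> \<le> x powr (- real m)" using x1 by (intro powr_mono2') auto
          finally show ?thesis .
        qed
        moreover have "\<kappa> j \<le> K_fun f (x ^ (k + m)) X WX"
          unfolding \<kappa>_def using x1 s[of j] by (intro K_fun_mono power_mono) auto
        ultimately have "ennreal ((1 / 2 ^ m) * s j powr (- real m)) * \<kappa> j \<le> ennreal (x powr (- real m)) * K_fun f (x ^ (k + m)) X WX"
          by (intro mult_mono ennreal_leI) auto
        then have "epowr (ennreal ((1 / 2 ^ m) * s j powr (- real m)) * \<kappa> j) r \<le> epowr (ennreal (x powr (- real m)) * K_fun f (x ^ (k + m)) X WX) r"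
          using r by (intro epowr_mono) auto
        moreover have "epowr (ennreal ((1 / 2 ^ m) * s j powr (- real m)) * \<kappa> j) r = ennreal (1 / (2 ^ m) powr r) * Z' j"
        proof -
          have "ennreal ((1 / 2 ^ m) * s j powr (- real m)) * \<kappa> j = ennreal (1 / 2 ^ m) * (ennreal (s j powr (- real m)) * \<kappa> j)"
            by (subst ennreal_mult) (auto simp: mult.assoc)
          then show ?thesis unfolding Z'_def by (simp only: epowr_cmult[OF _ r0] zero_le_divide_1_iff zero_le_power zero_le_numeral powr_divide powr_one_eq_one)
        qed
        moreover have "ennreal (1 / (2 * s j)) \<le> ennreal (1 / x)" using x1 by (intro ennreal_leI) (simp add: frac_le)
        ultimately show ?thesis using x1 xt unfolding a_def by (simp add: mult_mono)
      qed
      have "(\<Sum>j. a j * indicator (I j) x) \<le> ?G x" for x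
      proof (cases "\<exists>j. x \<in> I j")
        case True
        then obtain j where j: "x \<in> I j" by auto
        have "(\<Sum>j. a j * indicator (I j) x) = a j" by (rule suminf_cmult_indicator[OF disj j])
        then show ?thesis using I_le[OF j] by simp
      qed simp
      then have "(\<integral>\<^sup>+x. (\<Sum>j. a j * indicator (I j) x) \<partial>lborel) \<le> Q"
        unfolding Q nn_integral_completion by (intro nn_integral_mono)
      moreover have "(\<integral>\<^sup>+x. (\<Sum>j. a j * indicator (I j) x) \<partial>lborel) = (\<Sum>j. ennreal (1 / C4) * Z' j)"
      proof -
        have "(\<integral>\<^sup>+x. (\<Sum>j. a j * indicator (I j) x) \<partial>lborel) = (\<Sum>j. (\<integral>\<^sup>+x. a j * indicator (I j) x \<partial>lborel))"
          by (rule nn_integral_suminf) (simp add: I_def)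
        also have "\<dots> = (\<Sum>j. ennreal (1 / C4) * Z' j)"
        proof (intro suminf_cong)
          fix j
          have "(\<integral>\<^sup>+x. a j * indicator (I j) x \<partial>lborel) = a j * ennreal (s j)"
            using s[of j] by (subst nn_integral_cmult_indicator) (auto simp: I_def)
          also have "\<dots> = (ennreal (1 / (2 ^ m) powr r) * ennreal (1 / (2 * s j)) * ennreal (s j)) * Z' j"
            unfolding a_def by (simp only: mult_ac)
          also have "ennreal (1 / (2 ^ m) powr r) * ennreal (1 / (2 * s j)) * ennreal (s j) = ennreal (1 / C4)"
            using s[of j] by (simp add: ennreal_mult[symmetric] C4_def)
          finally show "(\<integral>\<^sup>+x. a j * indicator (I j) x \<partial>lborel) = ennreal (1 / C4) * Z' j" .
        qed
        finally show ?thesis .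
      qed
      ultimately have "ennreal (1 / C4) * (\<Sum>j. Z' j) \<le> Q" by (simp add: ennreal_suminf_cmult)
      then have "ennreal C4 * (ennreal (1 / C4) * (\<Sum>j. Z' j)) \<le> ennreal C4 * Q" by (intro mult_left_mono) auto
      then show ?thesis using C4 by (simp add: mult.assoc[symmetric] ennreal_mult[symmetric])
    qed
    have \<kappa>_fin: "\<kappa> j < top" for j
    proof -
      have "Z' j \<le> ennreal C4 * Q" using le_suminf_ennreal[of Z' j] sum_le by (rule order_trans)
      also have "\<dots> < top" using Q_fin by (simp add: ennreal_mult_less_top)
      finally show ?thesis using s[of j] by (auto simp: Z'_def ennreal_mult_less_top ennreal_mult_eq_top_iff less_top)
    qed
    \<comment> \<open>The slack of \<open>A j\<close> is chosen so that after the factor \<open>s j powr (-m)\<close> only \<open>(1 / 2) ^ j * \<delta>\<close> remains.\<close>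
    have slack: "epowr (K_fun f (t ^ k) Y WY) r \<le> ennreal C5 * (ennreal C4 * Q + ennreal (2 * \<delta> powr r))" if \<delta>: "0 < \<delta>" for \<delta>
    proof -
      define A where "A j = \<kappa> j + ennreal (s j ^ m * ((1 / 2) ^ j * \<delta>))" for j
      have "\<kappa> j < A j" for j
      proof -
        obtain x where x: "\<kappa> j = ennreal x" "0 \<le> x" using \<kappa>_fin[of j] by (cases "\<kappa> j") auto
        have "0 < s j ^ m * ((1 / 2) ^ j * \<delta>)" using s[of j] \<delta> by simp
        then show ?thesis
          unfolding A_def x(1) using x(2) by (subst ennreal_plus[symmetric]) (auto simp: ennreal_less_iff simp del: ennreal_plus)
      qed
      then have "\<exists>p. fst p \<in> fst X \<and> snd p \<in> fst WX \<and> f = (\<lambda>x. fst p x + snd p x)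
          \<and> snd X (fst p) + ennreal (s j ^ (k + m)) * snd WX (snd p) < A j" for j
      proof -
        assume lt: "\<And>j. \<kappa> j < A j"
        obtain g h where "g \<in> fst X" "h \<in> fst WX" "f = (\<lambda>x. g x + h x)" "snd X g + ennreal (s j ^ (k + m)) * snd WX h < A j"
          using lt[of j] unfolding \<kappa>_def K_fun_def Inf_less_iff by blast
        then show ?thesis by (intro exI[of _ "(g, h)"]) simp
      qed
      then obtain P where P: "\<And>j. fst (P j) \<in> fst X \<and> snd (P j) \<in> fst WX \<and> f = (\<lambda>x. fst (P j) x + snd (P j) x)
          \<and> snd X (fst (P j)) + ennreal (s j ^ (k + m)) * snd WX (snd (P j)) < A j"
        using choice[of "\<lambda>j p. fst p \<in> fst X \<and> snd p \<in> fst WX \<and> f = (\<lambda>x. fst p x + snd p x)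
          \<and> snd X (fst p) + ennreal (s j ^ (k + m)) * snd WX (snd p) < A j"] by blast
      define g where "g j = fst (P j)" for j
      define h where "h j = snd (P j)" for j
      have gh: "g j \<in> fst X" "h j \<in> fst WX" "f = (\<lambda>x. g j x + h j x)"
        "snd X (g j) + ennreal (s j ^ (k + m)) * snd WX (h j) < A j" for j
      proof -
        from P[of j] show "g j \<in> fst X" "h j \<in> fst WX" "f = (\<lambda>x. g j x + h j x)"
          "snd X (g j) + ennreal (s j ^ (k + m)) * snd WX (h j) < A j"
          unfolding g_def h_def by blast+
      qed
      define Z where "Z j = epowr (ennreal (s j powr (- real m)) * A j) r" for j
      have Z_le: "Z j \<le> ennreal (2 powr r) * (Z' j + ennreal (\<delta> powr r) * ennreal ((1 / 2) ^ j))" for j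
      proof -
        have "s j powr (- real m) * (s j ^ m * ((1 / 2) ^ j * \<delta>)) = (1 / 2) ^ j * \<delta>"
          using s[of j] by (simp add: powr_minus powr_realpow)
        then have "ennreal (s j powr (- real m)) * A j = ennreal (s j powr (- real m)) * \<kappa> j + ennreal ((1 / 2) ^ j * \<delta>)"
          unfolding A_def distrib_left using s[of j] \<delta> by (subst ennreal_mult[symmetric]) auto
        then have "Z j \<le> ennreal (2 powr r) * (Z' j + epowr (ennreal ((1 / 2) ^ j * \<delta>)) r)"
          unfolding Z_def Z'_def by (simp only: epowr_add_le[OF r0])
        also have "epowr (ennreal ((1 / 2) ^ j * \<delta>)) r \<le> ennreal (\<delta> powr r) * ennreal ((1 / 2) ^ j)"
        proof -
          have "((1 / 2 :: real) ^ j) powr r \<le> ((1 / 2) ^ j) powr 1" using r by (intro powr_mono') (auto simp: power_le_one)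
          then have "((1 / 2) ^ j * \<delta>) powr r \<le> \<delta> powr r * (1 / 2) ^ j"
            unfolding powr_mult using \<delta> by (subst mult.commute) (intro mult_left_mono, auto)
          then show ?thesis using \<delta> by (subst ennreal_mult[symmetric]) (auto intro!: ennreal_leI)
        qed
        finally show ?thesis by (simp add: add_left_mono mult_left_mono)
      qed
      have Z_sum: "(\<Sum>j. Z j) \<le> ennreal (2 powr r) * (ennreal C4 * Q + ennreal (2 * \<delta> powr r))"
      proof -
        have "(\<Sum>j. Z j) \<le> (\<Sum>j. ennreal (2 powr r) * (Z' j + ennreal (\<delta> powr r) * ennreal ((1 / 2) ^ j)))"
          by (intro suminf_le Z_le summableI)
        also have "\<dots> = ennreal (2 powr r) * ((\<Sum>j. Z' j) + ennreal (\<delta> powr r) * 2)"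
          by (simp only: suminf_add[OF summableI summableI, symmetric] ennreal_suminf_cmult suminf_half)
        also have "\<dots> \<le> ennreal (2 powr r) * (ennreal C4 * Q + ennreal (\<delta> powr r) * 2)"
          by (intro mult_left_mono add_right_mono sum_le) auto
        also have "ennreal (\<delta> powr r) * 2 = ennreal (2 * \<delta> powr r)" by (simp add: ennreal_mult mult.commute)
        finally show ?thesis .
      qed
      let ?B = "epowr (\<Sum>j. Z j) (1 / r)"
      have osc0: "osc_energy 1 (real m / real CARD('n)) (g 0) \<le> ennreal C1 * (\<Sum>j. Z j)"
        unfolding Z_def s_def
      proof (rule C1(2)[OF s0(1)], intro allI conjI gh)
        fix j x
        show "g 0 x + h 0 x = g j x + h j x" using gh(3)[of 0] gh(3)[of j] by metis
        show "snd X (g j) + ennreal ((s0 / 2 ^ j) ^ (k + m)) * snd WX (h j) \<le> A j"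
          using gh(4)[of j] unfolding s_def by (rule less_imp_le)
      qed (rule gh(2))
      have "snd Y (g 0) \<le> ennreal (C1 powr (1 / r)) * ?B"
        unfolding snd_Y using osc0 C1(1) r by (intro epowr_root_le) (auto simp: epowr_epowr)
      moreover have "ennreal (t ^ k) * snd WY (h 0) \<le> ennreal (C2 * 2 ^ k) * ?B"
      proof -
        have "ennreal (s 0 ^ (k + m)) * snd WX (h 0) \<le> A 0" using less_imp_le[OF gh(4)[of 0]] by (rule order_trans[rotated]) simp
        then have "ennreal (s 0 powr (- real m)) * (ennreal (s 0 ^ (k + m)) * snd WX (h 0)) \<le> ennreal (s 0 powr (- real m)) * A 0"
          by (intro mult_left_mono) auto
        also have "\<dots> = epowr (Z 0) (1 / r)" unfolding Z_def epowr_epowr using r by simp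
        also have "\<dots> \<le> ?B" using r by (intro epowr_mono le_suminf_ennreal) auto
        finally have "ennreal (s 0 powr (- real m)) * ennreal (s 0 ^ (k + m)) * snd WX (h 0) \<le> ?B" by (simp only: mult.assoc)
        moreover have "ennreal (s 0 powr (- real m)) * ennreal (s 0 ^ (k + m)) = ennreal (s 0 ^ k)"
          using s[of 0] by (subst ennreal_mult[symmetric]) (auto simp: powr_minus powr_realpow power_add)
        ultimately have B: "ennreal (s 0 ^ k) * snd WX (h 0) \<le> ?B" by simp
        have "ennreal (t ^ k) * snd WY (h 0) \<le> ennreal (t ^ k) * (ennreal C2 * snd WX (h 0))"
          using C2(2)[OF gh(2)[of 0]] by (intro mult_left_mono) auto
        also have "\<dots> = ennreal (C2 * 2 ^ k) * (ennreal (s 0 ^ k) * snd WX (h 0))"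
        proof -
          have "t ^ k * C2 = C2 * 2 ^ k * s 0 ^ k" using s0 by (simp add: s_def power_mult_distrib)
          then have "ennreal (t ^ k) * ennreal C2 = ennreal (C2 * 2 ^ k) * ennreal (s 0 ^ k)"
            using C2(1) t s[of 0] by (subst (1 2) ennreal_mult[symmetric]) auto
          then show ?thesis by (simp only: mult.assoc[symmetric])
        qed
        also have "\<dots> \<le> ennreal (C2 * 2 ^ k) * ?B" by (intro mult_left_mono B) auto
        finally show ?thesis .
      qed
      ultimately have "snd Y (g 0) + ennreal (t ^ k) * snd WY (h 0) \<le> ennreal (C1 powr (1 / r)) * ?B + ennreal (C2 * 2 ^ k) * ?B"
        by (rule add_mono)
      also have "\<dots> = ennreal C3 * ?B" using C2(1) by (simp add: C3_def distrib_right)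
      finally have sum_bound: "snd Y (g 0) + ennreal (t ^ k) * snd WY (h 0) \<le> ennreal C3 * ?B" .
      have "g 0 \<in> fst Y"
      proof (rule Y_I)
        show "g 0 \<in> borel_measurable lebesgue" "lam (g 0) < top" using gh(1)[of 0] by (auto simp: X_iff)
        have "(\<Sum>j. Z j) < top" using Z_sum by (rule le_less_trans) (use Q_fin in \<open>simp add: ennreal_mult_less_top\<close>)
        then show "osc_energy 1 (real m / real CARD('n)) (g 0) < top"
          by (intro le_less_trans[OF osc0]) (simp add: ennreal_mult_less_top)
      qed
      then have "K_fun f (t ^ k) Y WY \<le> snd Y (g 0) + ennreal (t ^ k) * snd WY (h 0)"
        unfolding K_fun_def using C2(2)[OF gh(2)[of 0]] gh(3)[of 0] by (intro Inf_lower) blast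
      also note sum_bound
      finally have "epowr (K_fun f (t ^ k) Y WY) r \<le> epowr (ennreal C3 * ?B) r" using r by (intro epowr_mono) auto
      also have "\<dots> = ennreal (C3 powr r) * (\<Sum>j. Z j)" using C3 r by (simp add: epowr_cmult epowr_epowr)
      also have "\<dots> \<le> ennreal (C3 powr r) * (ennreal (2 powr r) * (ennreal C4 * Q + ennreal (2 * \<delta> powr r)))"
        by (intro mult_left_mono Z_sum) auto
      also have "\<dots> = ennreal C5 * (ennreal C4 * Q + ennreal (2 * \<delta> powr r))" by (simp add: C5_def ennreal_mult mult.assoc)
      finally show ?thesis .
    qed
    show ?thesis
    proof (rule ennreal_le_epsilon)
      fix e :: real assume e: "0 < e"
      define \<delta> where "\<delta> = (e / (2 * C5)) powr (1 / r)"
      have \<delta>: "0 < \<delta>" "\<delta> powr r = e / (2 * C5)" using e C5 r by (auto simp: \<delta>_def powr_powr)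
      have "ennreal C5 * (ennreal C4 * Q + ennreal (2 * \<delta> powr r)) = ennreal (C5 * C4) * Q + ennreal e"
        using C5 C4 e by (simp add: \<delta>(2) distrib_left ennreal_mult[symmetric] mult.assoc[symmetric])
      then show "epowr (K_fun f (t ^ k) Y WY) r \<le> ennreal (C5 * C4) * Q + ennreal e" using slack[OF \<delta>(1)] by simp
    qed
  qed
  then show ?thesis using C5 C4 by (intro exI[of _ "C5 * C4"]) (auto simp: Let_def)
qed

end

theorem theorem5p8:
  fixes k m :: nat and r :: real and w :: "real \<Rightarrow> real"
  assumes "1 \<le> k" and "1 \<le> m"
    and "k + m < CARD('n::finite)"
    and "1 < r"
    and "weight w"
    and "\<not> (AE s in lebesgue. 0 < s \<longrightarrow> w s = 0)"
    and "w \<in> B_class r"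
    and "w \<in> B_star_class (r * (real k + real m - 1) / real CARD('n))"
  defines "v \<equiv> (\<lambda>t::real. t powr (- (real m * r / real CARD('n))))"
  shows "\<exists>c>0. \<forall>t>0. \<forall>f :: real ^ 'n \<Rightarrow> real. f \<in> fst (Lambda_class r w) \<longrightarrow>
     (let R = epowr (\<integral>\<^sup>+s\<in>{0<..<t}.
                epowr (ennreal (s powr (- real m))
                        * K_fun f (s ^ (k + m)) (Lambda_class r w) (W_class (k + m) (Lambda_class r w))) r
                * ennreal (1 / s) \<partial>lebesgue) (1 / r)
      in R < \<infinity> \<longrightarrow>
         K_fun f (t ^ k) (S_class r (\<lambda>s. w s * v s)) (W_class k (S_class r (\<lambda>s. w s * v s)))
           \<le> ennreal c * R)"
proof -
  define q where "q = r * (real k + real m - 1) / real CARD('n)"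
  have q: "0 < q" using assms(1,2,4) by (simp add: q_def)
  have w_nonneg: "0 \<le> w s" if "0 < s" for s using assms(5) that by (simp add: weight_def)
  have "(\<lambda>s. ennreal (indicator {0<..} s *\<^sub>R w s)) \<in> borel_measurable lebesgue"
    using assms(5) unfolding weight_def set_borel_measurable_def
    by (intro measurable_compose[OF _ measurable_ennreal]) blast
  then obtain u where u [measurable]: "u \<in> borel_measurable lborel"
    and u_eq: "AE s in lborel. ennreal (indicator {0<..} s *\<^sub>R w s) = u s"
    using completion_ex_borel_measurable[of "\<lambda>s. ennreal (indicator {0<..} s *\<^sub>R w s)" lborel] by auto
  have w_u: "AE s in lborel. 0 < s \<longrightarrow> u s = ennreal (w s)" using u_eq by eventually_elim (auto simp: indicator_def)
  have int_w: "(\<integral>\<^sup>+s\<in>A. ennreal (F s * w s) \<partial>lebesgue) = (\<integral>\<^sup>+s\<in>A. ennreal (F s) * u s \<partial>lborel)"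
    if "A \<subseteq> {0<..}" "\<And>s. 0 \<le> F s" for A F
    unfolding nn_integral_completion
    by (intro nn_integral_cong_AE, use w_u in eventually_elim)
       (use that w_nonneg in \<open>auto simp: indicator_def ennreal_mult\<close>)
  have int_w1: "(\<integral>\<^sup>+s\<in>{0<..<t}. ennreal (w s) \<partial>lebesgue) = (\<integral>\<^sup>+s\<in>{0<..<t}. u s \<partial>lborel)" for t
    using int_w[of "{0<..<t}" "\<lambda>_. 1"] by (simp add: subset_eq)
  obtain cB where cB: "0 < cB" "\<And>t. 0 < t \<Longrightarrow> ennreal (t powr r) * (\<integral>\<^sup>+s\<in>{t<..}. ennreal (s powr (- r)) * u s \<partial>lborel)
       \<le> ennreal cB * (\<integral>\<^sup>+s\<in>{0<..<t}. u s \<partial>lborel)"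
  proof -
    have "(\<integral>\<^sup>+s\<in>{t<..}. ennreal (s powr (- r) * w s) \<partial>lebesgue) = (\<integral>\<^sup>+s\<in>{t<..}. ennreal (s powr (- r)) * u s \<partial>lborel)"
      if "0 < t" for t using that by (intro int_w) auto
    then show thesis using assms(7) that unfolding B_class_def mem_Collect_eq int_w1 by auto
  qed
  obtain cS where cS: "0 < cS" "\<And>t. 0 < t \<Longrightarrow> ennreal (t powr q) * (\<integral>\<^sup>+s\<in>{0<..<t}. ennreal (s powr (- q)) * u s \<partial>lborel)
       \<le> ennreal cS * (\<integral>\<^sup>+s\<in>{0<..<t}. u s \<partial>lborel)"
  proof -
    have "(\<integral>\<^sup>+s\<in>{0<..<t}. ennreal (s powr (- q) * w s) \<partial>lebesgue) = (\<integral>\<^sup>+s\<in>{0<..<t}. ennreal (s powr (- q)) * u s \<partial>lborel)"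
      if "0 < t" for t by (intro int_w) auto
    then show thesis using assms(8) that unfolding B_star_class_def mem_Collect_eq int_w1 q_def[symmetric] by auto
  qed
  have shift: "I \<le> ennreal (c * t powr (- p)) * J" if "ennreal (t powr p) * I \<le> ennreal c * J" "0 < t" "0 < c" for I J c t p
  proof -
    have "ennreal (t powr (- p)) * (ennreal (t powr p) * I) \<le> ennreal (t powr (- p)) * (ennreal c * J)"
      by (intro mult_left_mono that) auto
    moreover have "ennreal (t powr (- p)) * ennreal (t powr p) = 1"
      using that by (simp add: ennreal_mult[symmetric] powr_add[symmetric])
    moreover have "ennreal (t powr (- p)) * ennreal c = ennreal (c * t powr (- p))"
      using that by (simp add: ennreal_mult mult.commute)
    ultimately show ?thesis by (simp only: mult.assoc[symmetric] mult_1)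
  qed
  have nonzero: "(\<integral>\<^sup>+s\<in>{0<..}. u s \<partial>lborel) \<noteq> 0"
  proof
    assume "(\<integral>\<^sup>+s\<in>{0<..}. u s \<partial>lborel) = 0"
    then have "AE s in lborel. u s * indicator {0<..} s = 0" by (subst (asm) nn_integral_0_iff_AE) auto
    with w_u have "AE s in lborel. 0 < s \<longrightarrow> w s = 0"
      by eventually_elim (use w_nonneg in \<open>auto simp: ennreal_eq_0_iff dual_order.antisym\<close>)
    then have "AE s in lebesgue. 0 < s \<longrightarrow> w s = 0" by (rule AE_completion)
    with assms(6) show False by simp
  qed
  interpret sobolev_setting u r q cB cS "\<lambda>t. \<integral>\<^sup>+s\<in>{0<..<t}. u s \<partial>lborel" w v k m "TYPE('n)"
  proof unfold_locales
    show "u \<in> borel_measurable borel" using u by simp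
    show "(\<integral>\<^sup>+s\<in>{t<..}. ennreal (s powr (- r)) * u s \<partial>lborel) \<le> ennreal (cB * t powr (- r)) * (\<integral>\<^sup>+s\<in>{0<..<t}. u s \<partial>lborel)" if "0 < t" for t
      using shift[OF cB(2)[OF that] that cB(1)] .
    show "(\<integral>\<^sup>+s\<in>{0<..<t}. ennreal (s powr (- q)) * u s \<partial>lborel) \<le> ennreal (cS * t powr (- q)) * (\<integral>\<^sup>+s\<in>{0<..<t}. u s \<partial>lborel)" if "0 < t" for t
      using shift[OF cS(2)[OF that] that cS(1)] .
  qed (use assms q cB(1) cS(1) nonzero w_u w_nonneg in \<open>auto simp: v_def q_def\<close>)
  obtain C where C: "0 < C" "\<And>t f. 0 < t \<Longrightarrow>
     (\<integral>\<^sup>+s\<in>{0<..<t}. epowr (ennreal (s powr (- real m)) * K_fun f (s ^ (k + m)) X WX) r * ennreal (1 / s) \<partial>lebesgue) < top \<Longrightarrow>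
     epowr (K_fun f (t ^ k) Y WY) r
       \<le> ennreal C * (\<integral>\<^sup>+s\<in>{0<..<t}. epowr (ennreal (s powr (- real m)) * K_fun f (s ^ (k + m)) X WX) r * ennreal (1 / s) \<partial>lebesgue)"
    using K_fun_bound unfolding Let_def by blast
  show ?thesis
    unfolding Let_def
  proof (intro exI[of _ "C powr (1 / r)"] conjI allI impI)
    show "0 < C powr (1 / r)" using C(1) by simp
    fix t :: real and f :: "real ^ 'n \<Rightarrow> real"
    let ?Q = "\<integral>\<^sup>+s\<in>{0<..<t}. epowr (ennreal (s powr (- real m)) * K_fun f (s ^ (k + m)) X WX) r * ennreal (1 / s) \<partial>lebesgue"
    assume t: "0 < t" and fin: "epowr ?Q (1 / r) < \<infinity>"
    then have "?Q < top" by simp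
    from C(2)[OF t this] have "epowr (K_fun f (t ^ k) Y WY) r \<le> ennreal C * epowr (epowr ?Q (1 / r)) r"
      using assms(4) by (simp add: epowr_epowr)
    then have "epowr (epowr (K_fun f (t ^ k) Y WY) r) (1 / r) \<le> ennreal (C powr (1 / r)) * epowr ?Q (1 / r)"
      using C(1) assms(4) by (intro epowr_root_le) auto
    then show "K_fun f (t ^ k) Y WY \<le> ennreal (C powr (1 / r)) * epowr ?Q (1 / r)"
      using assms(4) by (simp add: epowr_epowr)
  qed
qed

end
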